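(* Let $G$ be a simple grid graph. Then $$\mathfrak{b}^m\leq \tau(G)\leq 4^m,$$ where $$m = \mathrm{Area}(G) = |V(G)|-\tfrac 12 |\partial G| - 1 = |V(G)|-|\hat{\partial} G|$$ (the equality of these three expressions being part of the statement).
   Context: $V(G)$ is the vertex set of a graph $G$ and $\tau(G)$ is the number of spanning trees of a finite connected graph $G$. The constant is $\mathfrak{b}=\exp(4C/\pi)\approx 3.2099$, where $C=\sum_{n\ge 0}\frac{(-1)^n}{(2n+1)^2}$ is Catalan's constant. $\mathcal{L}(\mathbb{Z}^2)$ is the regular square lattice graph: its vertex set is $\mathbb{Z}^2$ and its edges join points at Euclidean distance $1$; its faces are the unit squares with corners in $\mathbb{Z}^2$. A grid graph is a finite connected subgraph of $\mathcal{L}(\mathbb{Z}^2)$. A simple closed loop in $\mathcal{L}(\mathbb{Z}^2)$ is a sequence $\alpha$ of more than two distinct vertices in which each successive pair (including the pair consisting of the first and the last) is an edge of $\mathcal{L}(\mathbb{Z}^2)$. A grid graph $G$ is simple if it consists of all of the vertices and edges of $\mathcal{L}(\mathbb{Z}^2)$ that are on and interior to a simple closed loop $\alpha$; then the boundary $\partial G$ is the set of vertices of $\alpha$, and $\mathrm{Area}(G)$ is the area of the interior of $\alpha$ (viewed as a piecewise-linear closed curve in $\mathbb{R}^2$), equivalently the number of faces of $G$ (unit lattice squares enclosed by $\alpha$). The top-left boundary $\hat{\partial} G$ of a simple grid graph $G$ is the set of all $v\in\partial G$ such that the face of $\mathcal{L}(\mathbb{Z}^2)$ whose bottom-right corner is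 $v$ is not a face of $G$. *)

theory Defs
  imports "HOL-Analysis.Analysis"
begin

section \<open>Undirected simple graphs\<close>

text \<open>
  An edge is the two-element set of its end points. The digraph library's notion of spanning
  tree is not usable here: a symmetric digraph with an edge already has a directed cycle.
\<close>

record 'a ugraph =
  verts :: "'a set"
  edges :: "'a set set"

definition ugraph :: "'a ugraph \<Rightarrow> bool" where
  "ugraph G \<longleftrightarrow> (\<forall>e\<in>edges G. e \<subseteq> verts G \<and> card e = 2)"

definition subgraph :: "'a ugraph \<Rightarrow> 'a ugraph \<Rightarrow> bool" where
  "subgraph H G \<longleftrightarrow> ugraph H \<and> verts H \<subseteq> verts G \<and> edges H \<subseteq> edges G"

definition graph_connected :: "'a ugraph \<Rightarrow> bool" where
  "graph_connected G \<longleftrightarrow> verts G \<noteq> {} \<and>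
     (\<forall>u\<in>verts G. \<forall>v\<in>verts G. (u, v) \<in> {(x, y). {x, y} \<in> edges G}\<^sup>*)"

definition simple_closed_loop :: "'a ugraph \<Rightarrow> 'a list \<Rightarrow> bool" where
  "simple_closed_loop G \<alpha> \<longleftrightarrow> length \<alpha> > 2 \<and> distinct \<alpha> \<and>
     (\<forall>i<length \<alpha>. {\<alpha> ! i, \<alpha> ! (Suc i mod length \<alpha>)} \<in> edges G)"

definition graph_tree :: "'a ugraph \<Rightarrow> bool" where
  "graph_tree T \<longleftrightarrow> graph_connected T \<and> (\<nexists>\<alpha>. simple_closed_loop T \<alpha>)"

definition spanning_trees :: "'a ugraph \<Rightarrow> 'a ugraph set" where
  "spanning_trees G = {T. subgraph T G \<and> verts T = verts G \<and> graph_tree T}"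

definition \<tau> :: "'a ugraph \<Rightarrow> nat" where
  "\<tau> G = card (spanning_trees G)"


section \<open>The square lattice and simple grid graphs\<close>

text \<open>The Euclidean plane is represented by the type of complex numbers.\<close>

definition pt :: "int \<times> int \<Rightarrow> complex" where
  "pt v = Complex (of_int (fst v)) (of_int (snd v))"

definition square_lattice :: "(int \<times> int) ugraph" where
  "square_lattice = \<lparr> verts = UNIV, edges = {{u, v} | u v. dist (pt u) (pt v) = 1} \<rparr>"

definition grid_graph :: "(int \<times> int) ugraph \<Rightarrow> bool" where
  "grid_graph G \<longleftrightarrow> subgraph G square_lattice \<and> finite (verts G) \<and> graph_connected G"

definition loop_curve :: "(int \<times> int) list \<Rightarrow> complex set" where
  "loop_curve \<alpha> =
     (\<Union>i<length \<alpha>. closed_segment (pt (\<alpha> ! i)) (pt (\<alpha> ! (Suc i mod length \<alpha>))))"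

definition loop_region :: "(int \<times> int) list \<Rightarrow> complex set" where
  "loop_region \<alpha> = loop_curve \<alpha> \<union> inside (loop_curve \<alpha>)"

text \<open>
  The bounding loop of a simple grid graph is an explicit argument here and below. It is
  determined by the graph only up to the choice of a starting vertex and a direction.
\<close>

definition simple_grid_graph :: "(int \<times> int) ugraph \<Rightarrow> (int \<times> int) list \<Rightarrow> bool" where
  "simple_grid_graph G \<alpha> \<longleftrightarrow> grid_graph G \<and> simple_closed_loop square_lattice \<alpha> \<and>
     verts G = {v \<in> verts square_lattice. pt v \<in> loop_region \<alpha>} \<and>
     edges G = {{u, v} | u v. {u, v} \<in> edges square_lattice \<and>
                              closed_segment (pt u) (pt v) \<subseteq> loop_region \<alpha>}"

definition boundary :: "(int \<times> int) list \<Rightarrow> (int \<times> int) set" where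
  "boundary \<alpha> = set \<alpha>"

definition area :: "(int \<times> int) list \<Rightarrow> real" where
  "area \<alpha> = measure lborel (inside (loop_curve \<alpha>))"

text \<open>The closed unit square with the given bottom-right corner.\<close>

definition face_bottom_right :: "int \<times> int \<Rightarrow> complex set" where
  "face_bottom_right v = cbox (pt (fst v - 1, snd v)) (pt (fst v, snd v + 1))"

definition top_left_boundary :: "(int \<times> int) list \<Rightarrow> (int \<times> int) set" where
  "top_left_boundary \<alpha> = {v \<in> boundary \<alpha>. \<not> face_bottom_right v \<subseteq> loop_region \<alpha>}"


section \<open>The constant\<close>

definition catalan_const :: real where
  "catalan_const = (\<Sum>n. (-1) ^ n / (2 * real n + 1)\<^sup>2)"

definition \<bb> :: real where
  "\<bb> = exp (4 * catalan_const / pi)"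

end

theory Submission
  imports Defs "Jordan_Normal_Form.Schur_Decomposition"
begin

text \<open>
  Let \<open>F\<close> be the set of faces enclosed by the loop and \<open>m\<close> its number. A face is named by its
  bottom-right corner, so that faces are points of the same lattice, which is its own dual.

  The proof counts spanning trees through the dual lattice. An exit rule chooses for every face of \<open>F\<close>
  one of the four directions in such a way that whoever follows the choices eventually leaves
  \<open>F\<close>. Each choice crosses one edge of the graph, and the edges that are never crossed form a
  spanning tree. Indeed, a loop among the uncrossed edges would trap the trajectories of the faces
  inside it (\<open>uncrossed_loop_free\<close>, which rests on the Jordan curve theorem); and if the uncrossed
  edges left the graph disconnected, then the edges of the cut would all be crossed, but a
  face has an even number of sides in a cut, so one could follow crossed cut edges backwards for ever
  (\<open>uncrossed_connected\<close>). Conversely, the faces that could not escape without crossing a given tree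
  would be bounded by edges of the tree, and a boundary contains a loop
  (\<open>exit_rule_avoiding_tree\<close>). Thus \<open>\<tau> G\<close> is the number of exit rules, and this is at most \<open>4 ^ m\<close>.

  For the lower bound let \<open>A\<close> be the adjacency matrix of \<open>F\<close>. Expanding \<open>det (4 I - A)\<close> by rows writes
  it as a sum over all choices of directions, in which a choice contributes \<open>0\<close> or \<open>\<plusminus>1\<close>, and \<open>0\<close>
  unless it is an exit rule (\<open>det_walk_laplacian_le\<close>). Hence there are at least \<open>\<bar>det (4 I - A)\<bar>\<close>
  exit rules. By way of the eigenvalues of \<open>A\<close>, the logarithm of this number is
  \<open>m ln 4 - (\<Sum>k. tr (A ^ k) / (k 4 ^ k))\<close>, and \<open>tr (A ^ k)\<close> counts closed walks of length \<open>k\<close> that stay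
  in \<open>F\<close>. There are at most \<open>m c\<^sub>k\<close> of them, where \<open>c\<^sub>k\<close> is the number of closed walks of length \<open>k\<close> from the
  origin of the whole lattice. So everything reduces to one series in which \<open>F\<close> no longer occurs,
  and its partial sums are at most \<open>ln 4 - ln \<bb>\<close> (\<open>loop_series_bound\<close>).

  The area formulas come from the same picture. The enclosed faces, named by their corners, are the
  vertices that do not lie on the top-left boundary. The complement of one of the trees above has \<open>m\<close> edges,
  which gives Euler's formula; and every edge of the graph has two enclosed faces, except that the
  edges of the loop have one, which turns Euler's formula into Pick's.
\<close>

section \<open>The closed-walk series and Catalan's constant\<close>

text \<open>
  The probability that a simple walk on the integers is back at its start after \<open>2 n\<close> steps.
\<close>
definition central_prob :: "nat \<Rightarrow> real" where
  "central_prob n = real (2 * n choose n) / 4 ^ n"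

lemma central_prob_0 [simp]: "central_prob 0 = 1"
  by (simp add: central_prob_def)

lemma central_prob_nonneg: "0 \<le> central_prob n"
  by (simp add: central_prob_def)

lemma central_prob_Suc: "(2 * real n + 2) * central_prob (Suc n) = (2 * real n + 1) * central_prob n"
proof -
  have a: "Suc n * (2 * Suc n choose Suc n) = 2 * Suc n * (2 * n + 1 choose n)"
    using Suc_times_binomial[of n "2*n+1"] by (simp add: algebra_simps)
  have b: "Suc n * (2 * n + 1 choose n) = (2 * n + 1) * (2 * n choose n)"
    using binomial_absorb_comp[of "2*n+1" n] by simp
  define x y z where "x = 2 * Suc n choose Suc n" "y = 2 * n choose n" "z = 2 * n + 1 choose n"
  have "Suc n * x = 2 * ((2 * n + 1) * y)"
    using a b unfolding x_y_z_def[symmetric] by (metis mult.assoc)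
  hence "real (Suc n * x) = real (2 * ((2 * n + 1) * y))" by (rule arg_cong)
  hence "(real n + 1) * real x = 2 * ((2 * real n + 1) * real y)" by (simp add: algebra_simps)
  moreover have "(2 * real n + 2) * (u / (4 * p)) = (2 * real n + 1) * (v / p)"
    if "(real n + 1) * u = 2 * ((2 * real n + 1) * v)" "p > 0" for u v p :: real
  proof -
    have "(2 * real n + 2) * u = 4 * ((2 * real n + 1) * v)" using that(1) by (simp only: algebra_simps)
    hence "(2 * real n + 2) * u / (4 * p) = (4 * ((2 * real n + 1) * v)) / (4 * p)" by (rule arg_cong)
    also have "\<dots> = (2 * real n + 1) * v / p" by simp
    finally show ?thesis by (simp only: times_divide_eq_right)
  qed
  ultimately have "(2 * real n + 2) * (real x / (4 * 4 ^ n)) = (2 * real n + 1) * (real y / 4 ^ n)"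
    using zero_less_power zero_less_numeral by blast
  thus ?thesis
    unfolding central_prob_def x_y_z_def power_Suc .
qed

text \<open>
  Wallis's integrals. They make the square of a central binomial probability linear in
  the probability itself, which is how the closed-walk series becomes an integral.
\<close>
lemma integral_sin_even_power:
  "((\<lambda>t. sin t ^ (2 * n)) has_integral pi / 2 * central_prob n) {0..pi/2}"
proof (induction n)
  case 0
  then show ?case using has_integral_const_real[of "1::real" 0 "pi/2"] by simp
next
  case (Suc n)
  have "((\<lambda>t. (2 * real n + 1) * sin t ^ (2*n) - (2 * real n + 2) * sin t ^ (2 * Suc n))
      has_integral (sin (pi/2) ^ (2*n+1) * cos (pi/2) - sin 0 ^ (2*n+1) * cos 0)) {0..pi/2}"
  proof (rule fundamental_theorem_of_calculus)
    fix t :: real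
    have "((\<lambda>t. sin t ^ (2*n+1) * cos t) has_real_derivative
        (real (2*n+1) * sin t ^ (2*n) * cos t) * cos t - sin t ^ (2*n+1) * sin t) (at t within {0..pi/2})"
      by (rule derivative_eq_intros refl | simp)+
    also have "(real (2*n+1) * sin t ^ (2*n) * cos t) * cos t - sin t ^ (2*n+1) * sin t
        = (2 * real n + 1) * sin t ^ (2*n) * (1 - (sin t)\<^sup>2) - sin t ^ (2*n) * (sin t)\<^sup>2"
      unfolding cos_squared_eq[symmetric] by (simp add: power2_eq_square)
    also have "\<dots> = (2 * real n + 1) * sin t ^ (2*n) - (2 * real n + 2) * sin t ^ (2 * Suc n)"
      by (simp add: algebra_simps power2_eq_square)
    finally show "((\<lambda>t. sin t ^ (2*n+1) * cos t) has_vector_derivative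
       (2 * real n + 1) * sin t ^ (2*n) - (2 * real n + 2) * sin t ^ (2 * Suc n)) (at t within {0..pi/2})"
      by (simp add: has_real_derivative_iff_has_vector_derivative)
  qed auto
  hence 1: "((\<lambda>t. (2 * real n + 1) * sin t ^ (2*n) - (2 * real n + 2) * sin t ^ (2 * Suc n))
      has_integral 0) {0..pi/2}" by simp
  from has_integral_diff[OF has_integral_mult_right[OF Suc, of "2 * real n + 1"] 1]
  have "((\<lambda>t. (2 * real n + 2) * sin t ^ (2 * Suc n)) has_integral
      (2 * real n + 1) * (pi / 2 * central_prob n)) {0..pi/2}" by simp
  also have "(2 * real n + 1) * (pi / 2 * central_prob n)
     = (2 * real n + 2) * (pi / 2 * central_prob (Suc n))"
    using central_prob_Suc[of n] by (metis mult.left_commute)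
  finally have *: "((\<lambda>t. (2 * real n + 2) * sin t ^ (2 * Suc n)) has_integral
      (2 * real n + 2) * (pi / 2 * central_prob (Suc n))) {0..pi/2}" .
  have c: "2 * real n + 2 \<noteq> 0" by simp
  show ?case
    using has_integral_divide[OF *, of "2 * real n + 2"] unfolding nonzero_mult_div_cancel_left[OF c] .
qed

text \<open>
  A partial sum of the binomial series of \<open>1 / sqrt (1 - x\<^sup>2)\<close> at \<open>x = sin t\<close>
  lies below its limit \<open>1 / cos t\<close>. In the derivative of the left-hand side the terms telescope, by
  the recursion of the coefficients, to a single nonpositive one.
\<close>
lemma inverse_sqrt_partial_sum:
  assumes "0 \<le> t" "t \<le> pi/2"
  shows "cos t * (\<Sum>n\<le>N. central_prob n * sin t ^ (2 * n)) \<le> 1"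
proof -
  have D: "((\<lambda>t. cos t * (\<Sum>n\<le>N. central_prob n * sin t ^ (2 * n))) has_real_derivative
        - (2 * real N + 1) * central_prob N * sin t ^ (2 * N + 1)) (at t)" for t
  proof (induction N)
    case 0
    show ?case by (auto intro!: derivative_eq_intros)
  next
    case (Suc N)
    have e: "((\<lambda>t. central_prob (Suc N) * (cos t * sin t ^ (2 * Suc N))) has_real_derivative
        central_prob (Suc N) * (- sin t * sin t ^ (2 * Suc N)
           + real (2 * Suc N) * sin t ^ (2 * N + 1) * cos t * cos t)) (at t)"
      by (rule derivative_eq_intros refl | simp)+
    have "- (2 * real N + 1) * central_prob N * sin t ^ (2 * N + 1) +
         central_prob (Suc N) * (- sin t * sin t ^ (2 * Suc N)
           + real (2 * Suc N) * sin t ^ (2 * N + 1) * cos t * cos t)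
      = - (2 * real (Suc N) + 1) * central_prob (Suc N) * sin t ^ (2 * Suc N + 1)"
    proof -
      define s where "s = sin t ^ (2 * N + 1)"
      have s: "sin t * sin t ^ (2 * Suc N) = s * (sin t)\<^sup>2" "sin t ^ (2 * Suc N + 1) = s * (sin t)\<^sup>2"
        by (simp_all add: s_def power2_eq_square)
      have c: "cos t * cos t = 1 - (sin t)\<^sup>2"
        using sin_cos_squared_add[of t] by (simp add: power2_eq_square algebra_simps)
      have r: "(2 * real N + 1) * central_prob N = (2 * real N + 2) * central_prob (Suc N)"
        by (rule central_prob_Suc[symmetric])
      have "- (2 * real N + 1) * central_prob N * s +
         central_prob (Suc N) * (- (s * (sin t)\<^sup>2) + (2 * real N + 2) * s * (cos t * cos t))
        = - (2 * real N + 3) * central_prob (Suc N) * (s * (sin t)\<^sup>2)"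
      proof -
        have e: "- (2 * real N + 1) * central_prob N * s = - ((2 * real N + 2) * central_prob (Suc N)) * s"
          by (simp only: r[symmetric] mult_minus_left)
        show ?thesis unfolding e c by (simp add: algebra_simps)
      qed
      moreover have "real (2 * Suc N) = 2 * real N + 2" "2 * real (Suc N) + 1 = 2 * real N + 3" by simp_all
      ultimately show ?thesis unfolding s mult_minus_left s_def[symmetric] mult.assoc by metis
    qed
    moreover have "(\<lambda>t. cos t * (\<Sum>n\<le>Suc N. central_prob n * sin t ^ (2 * n)))
       = (\<lambda>t. cos t * (\<Sum>n\<le>N. central_prob n * sin t ^ (2 * n)) + central_prob (Suc N) * (cos t * sin t ^ (2 * Suc N)))"
      by (simp add: distrib_left mult.left_commute)
    ultimately show ?case using DERIV_add[OF Suc e] by metis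
  qed
  have "cos t * (\<Sum>n\<le>N. central_prob n * sin t ^ (2 * n))
     \<le> cos 0 * (\<Sum>n\<le>N. central_prob n * sin 0 ^ (2 * n))"
  proof (rule DERIV_nonpos_imp_nonincreasing[OF assms(1)])
    fix x assume x: "0 \<le> x" "x \<le> t"
    hence "0 \<le> sin x" using assms by (intro sin_ge_zero) auto
    hence "0 \<le> (2 * real N + 1) * central_prob N * sin x ^ (2 * N + 1)"
      by (intro mult_nonneg_nonneg zero_le_power) (auto simp: central_prob_nonneg)
    hence "- (2 * real N + 1) * central_prob N * sin x ^ (2 * N + 1) \<le> 0"
      by linarith
    with D[of x] show "\<exists>y. ((\<lambda>t. cos t * (\<Sum>n\<le>N. central_prob n * sin t ^ (2 * n))) has_real_derivative y) (at x) \<and> y \<le> 0"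
      by blast
  qed
  also have "\<dots> = 1" by (simp add: power_0_left if_distrib cong: if_cong)
  finally show ?thesis .
qed

text \<open>
  The previous inequality, with its term for \<open>n = 0\<close> moved to the other side, divided by \<open>sin t\<close> and
  integrated from \<open>0\<close>; note \<open>(1 - cos t) / sin t = sin t / (1 + cos t)\<close>. Working with partial sums avoids every question of convergence: only an upper bound of the
  closed-walk series is needed.
\<close>
lemma log_half_partial_sum:
  assumes "0 \<le> t" "t \<le> pi/2"
  shows "(\<Sum>n=1..N. central_prob n * sin t ^ (2 * n) / (2 * real n)) \<le> - ln ((1 + cos t) / 2)"
proof -
  define g where "g = (\<lambda>t::real. - ln ((1 + cos t) / 2) - (\<Sum>n=1..N. central_prob n * sin t ^ (2 * n) / (2 * real n)))"
  have "g 0 \<le> g t"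
  proof (rule DERIV_nonneg_imp_nondecreasing[OF assms(1)])
    fix x assume x: "0 \<le> x" "x \<le> t"
    hence c: "0 \<le> cos x" using assms by (intro cos_ge_zero) auto
    have s: "0 \<le> sin x" using x assms by (intro sin_ge_zero) auto
    have D: "(g has_real_derivative sin x / (1 + cos x) -
         (\<Sum>n=1..N. central_prob n * sin x ^ (2 * n - 1) * cos x)) (at x)"
      unfolding g_def using c
      by (auto intro!: derivative_eq_intros sum.cong simp: field_simps)
    have "0 \<le> sin x / (1 + cos x) - (\<Sum>n=1..N. central_prob n * sin x ^ (2 * n - 1) * cos x)"
    proof (cases "sin x = 0")
      case True
      hence "(\<Sum>n=1..N. central_prob n * sin x ^ (2 * n - 1) * cos x) = 0"
        by (intro sum.neutral) auto
      thus ?thesis using True by simp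
    next
      case False
      hence s': "sin x > 0" using s by simp
      have "cos x * (\<Sum>n\<le>N. central_prob n * sin x ^ (2 * n)) \<le> 1"
        using inverse_sqrt_partial_sum[of x N] x assms by auto
      moreover have "(\<Sum>n\<le>N. central_prob n * sin x ^ (2 * n))
          = 1 + (\<Sum>n=1..N. central_prob n * sin x ^ (2 * n))"
        by (simp add: atMost_atLeast0 sum.atLeast_Suc_atMost)
      moreover have "(\<Sum>n=1..N. central_prob n * sin x ^ (2 * n))
          = sin x * (\<Sum>n=1..N. central_prob n * sin x ^ (2 * n - 1))"
        unfolding sum_distrib_left
      proof (intro sum.cong refl)
        fix n assume "n \<in> {1..N}"
        then obtain k where "n = Suc k" by (cases n) auto
        thus "central_prob n * sin x ^ (2 * n) = sin x * (central_prob n * sin x ^ (2 * n - 1))" by simp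
      qed
      ultimately have "sin x * (cos x * (\<Sum>n=1..N. central_prob n * sin x ^ (2 * n - 1))) \<le> 1 - cos x"
        by (simp add: algebra_simps)
      also have "1 - cos x = sin x * (sin x / (1 + cos x))"
        using sin_cos_squared_add[of x] c by (simp add: field_simps power2_eq_square)
      finally have "cos x * (\<Sum>n=1..N. central_prob n * sin x ^ (2 * n - 1)) \<le> sin x / (1 + cos x)"
        using s' mult_le_cancel_left_pos[OF s'] by blast
      thus ?thesis by (simp add: sum_distrib_left mult_ac)
    qed
    with D show "\<exists>y. (g has_real_derivative y) (at x) \<and> 0 \<le> y" by blast
  qed
  moreover have "g 0 = 0" by (simp add: g_def zero_power)
  ultimately show ?thesis by (simp add: g_def)
qed

text \<open>
  The real part of the series of \<open>Ln (1 + z)\<close> at \<open>z = r e\<^sup>i\<^sup>t\<close>.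
\<close>
lemma log_norm_fourier_series:
  fixes r t :: real
  assumes r: "0 \<le> r" "r < 1"
  shows "(\<lambda>n. - ((- r) ^ n) * cos (real n * t) / real n) sums (ln (1 + 2 * r * cos t + r\<^sup>2) / 2)"
proof -
  have n: "cmod (rcis r t) < 1" using r by simp
  from Ln_series'[OF n] have "(\<lambda>n. Re (- ((- rcis r t)^n) / of_nat n)) sums Re (ln (1 + rcis r t))"
    by (rule sums_Re)
  moreover have "(\<lambda>n. Re (- ((- rcis r t)^n) / of_nat n)) = (\<lambda>n. - ((- r) ^ n) * cos (real n * t) / real n)"
  proof (rule ext)
    fix n
    have "(- rcis r t)^n = of_real ((-1)^n) * rcis (r ^ n) (real n * t)"
      by (subst power_minus) (simp add: DeMoivre2)
    hence "Re ((- rcis r t)^n) = (-r) ^ n * cos (real n * t)"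
      by (simp only: Re_complex_of_real Im_complex_of_real times_complex.sel Re_rcis power_minus[of r] mult_zero_left diff_zero mult.assoc)
    thus "Re (- ((- rcis r t)^n) / of_nat n) = - ((- r) ^ n) * cos (real n * t) / real n"
      by (simp add: Re_divide_of_nat)
  qed
  moreover have "1 + rcis r t \<noteq> 0"
    using n by (metis add.inverse_inverse add_eq_0_iff norm_minus_cancel norm_one order_less_irrefl)
  moreover have "cmod (1 + rcis r t) = sqrt (1 + 2 * r * cos t + r\<^sup>2)"
  proof -
    have "(1 + r * cos t)\<^sup>2 + (r * sin t)\<^sup>2 = 1 + 2 * r * cos t + r\<^sup>2 * ((sin t)\<^sup>2 + (cos t)\<^sup>2)"
      by (simp only: power2_eq_square algebra_simps mult_1_right)
    thus ?thesis by (simp add: cmod_def)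
  qed
  moreover have "1 + 2 * r * cos t + r\<^sup>2 > 0"
    using calculation(3-4) by (metis real_sqrt_gt_0_iff zero_less_norm_iff)
  moreover have "Re (ln (1 + rcis r t)) = ln (1 + 2 * r * cos t + r\<^sup>2) / 2"
    using calculation(3-5) by (simp add: ln_sqrt)
  ultimately show ?thesis by (simp only:)
qed

text \<open>
  Integrating the Fourier series term by term yields \<open>sin (n \<pi> / 2) r\<^sup>n / n\<^sup>2\<close>, and the sines select
  the odd \<open>n\<close> with alternating signs. A radius \<open>r < 1\<close> keeps the convergence uniform.
\<close>
lemma integral_log_norm:
  fixes r :: real
  assumes r: "0 \<le> r" "r < 1"
  shows "((\<lambda>t. ln (1 + 2 * r * cos t + r\<^sup>2) / 2) has_integral
           (\<Sum>n. (-1) ^ n * r ^ (2 * n + 1) / (2 * real n + 1)\<^sup>2)) {0..pi/2}"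
proof -
  \<comment> \<open>the term for \<open>n = 0\<close> vanishes because division by zero gives zero\<close>
  define f where "f = (\<lambda>(n::nat) (t::real). - ((- r) ^ n) * sin (real n * t) / (real n)\<^sup>2)"
  define f' where "f' = (\<lambda>(n::nat) (t::real). - ((- r) ^ n) * cos (real n * t) / real n)"
  have S: "(\<lambda>n. f' n t) sums (ln (1 + 2 * r * cos t + r\<^sup>2) / 2)" for t
    unfolding f'_def by (rule log_norm_fourier_series[OF r])
  have bound: "norm (f' n t) \<le> r ^ n" for n t
  proof -
    have "\<bar>cos (real n * t)\<bar> / real n \<le> 1"
    proof (cases "n = 0")
      case False
      hence "\<bar>cos (real n * t)\<bar> \<le> real n" using abs_cos_le_one[of "real n * t"]
        by (smt (verit) of_nat_1 of_nat_mono less_one not_less)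
      thus ?thesis using False by simp
    qed auto
    hence "r ^ n * (\<bar>cos (real n * t)\<bar> / real n) \<le> r ^ n * 1"
      using r by (intro mult_left_mono) auto
    thus ?thesis using r by (simp add: f'_def abs_mult power_abs)
  qed
  have D: "((\<lambda>t. \<Sum>n. f n t) has_real_derivative (\<Sum>n. f' n t)) (at t)" "summable (\<lambda>n. f n t)" for t
  proof -
    have 1: "(f n has_field_derivative f' n x) (at x within UNIV)" for n x
      unfolding f_def f'_def
      by (cases "n = 0") (auto intro!: derivative_eq_intros simp: power2_eq_square field_simps)
    have 2: "uniformly_convergent_on UNIV (\<lambda>n x. \<Sum>i<n. f' i x)"
      by (rule Weierstrass_m_test'[where M = "\<lambda>n. r ^ n"]) (use bound r in \<open>auto intro: summable_geometric\<close>)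
    have 3: "summable (\<lambda>n. f n 0)" by (simp add: f_def)
    show "((\<lambda>t. \<Sum>n. f n t) has_real_derivative (\<Sum>n. f' n t)) (at t)" "summable (\<lambda>n. f n t)"
      using has_field_derivative_series'[OF convex_UNIV 1 2 UNIV_I 3, of t] by auto
  qed
  have "((\<lambda>t. ln (1 + 2 * r * cos t + r\<^sup>2) / 2) has_integral (\<Sum>n. f n (pi/2)) - (\<Sum>n. f n 0)) {0..pi/2}"
  proof (rule fundamental_theorem_of_calculus)
    fix t show "((\<lambda>t. \<Sum>n. f n t) has_vector_derivative ln (1 + 2 * r * cos t + r\<^sup>2) / 2) (at t within {0..pi/2})"
      using D(1)[of t] sums_unique[OF S[of t]]
      by (simp add: has_real_derivative_iff_has_vector_derivative has_vector_derivative_at_within)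
  qed auto
  also have "(\<Sum>n. f n 0) = 0" by (simp add: f_def)
  also have "(\<Sum>n. f n (pi/2)) = (\<Sum>n. (-1) ^ n * r ^ (2 * n + 1) / (2 * real n + 1)\<^sup>2)"
  proof -
    have z: "f n (pi/2) = 0" if "n \<notin> range (\<lambda>k. 2 * k + 1)" for n
    proof -
      have "even n" using that by (metis oddE rangeI)
      then obtain k where "n = 2 * k" by auto
      hence "real n * (pi/2) = real k * pi" by simp
      hence "sin (real n * (pi/2)) = 0" by (simp only: sin_npi)
      thus ?thesis by (simp add: f_def)
    qed
    have o: "f (2 * k + 1) (pi/2) = (-1) ^ k * r ^ (2 * k + 1) / (2 * real k + 1)\<^sup>2" for k
    proof -
      have "real (2 * k + 1) * (pi / 2) = real k * pi + pi / 2" by (simp add: field_simps)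
      hence "sin (real (2 * k + 1) * (pi / 2)) = (-1) ^ k"
        by (simp only: sin_add) simp
      thus ?thesis by (simp add: f_def algebra_simps)
    qed
    have "(\<lambda>n. f n (pi/2)) sums (\<Sum>n. f n (pi/2))" using D(2) by (rule summable_sums)
    moreover have "strict_mono (\<lambda>k::nat. 2 * k + 1)" by (simp add: strict_mono_def)
    ultimately have "(\<lambda>k. f (2 * k + 1) (pi/2)) sums (\<Sum>n. f n (pi/2))"
      by (subst sums_mono_reindex[where f = "\<lambda>n. f n (pi/2)"]) (assumption, rule z, assumption+)
    thus ?thesis unfolding o by (rule sums_unique)
  qed
  finally show ?thesis by simp
qed

lemma catalan_partial_tendsto:
  "((\<lambda>r::real. \<Sum>n. (-1) ^ n * r ^ (2 * n + 1) / (2 * real n + 1)\<^sup>2) \<longlongrightarrow> catalan_const) (at_left 1)"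
proof -
  define M where "M = (\<lambda>n. 1 / (real (Suc n))\<^sup>2)"
  have M: "summable M" unfolding M_def
    using inverse_power_summable[of 2, where 'a=real] by (subst summable_Suc_iff) (simp add: divide_inverse)
  have "uniform_limit {0..1} (\<lambda>n (r::real). \<Sum>i<n. (-1) ^ i * r ^ (2 * i + 1) / (2 * real i + 1)\<^sup>2)
      (\<lambda>r. \<Sum>n. (-1) ^ n * r ^ (2 * n + 1) / (2 * real n + 1)\<^sup>2) sequentially"
  proof (rule Weierstrass_m_test[OF _ M])
    fix n and r :: real assume r: "r \<in> {0..1}"
    have "r ^ (2 * n + 1) \<le> 1" using r by (intro power_le_one) auto
    hence "r ^ (2 * n + 1) / (2 * real n + 1)\<^sup>2 \<le> 1 / (real (Suc n))\<^sup>2"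
      using r by (intro frac_le power_mono) auto
    thus "norm ((-1) ^ n * r ^ (2 * n + 1) / (2 * real n + 1)\<^sup>2) \<le> M n"
      using r by (simp add: M_def abs_mult power_abs)
  qed
  hence "continuous_on {0..1} (\<lambda>r::real. \<Sum>n. (-1) ^ n * r ^ (2 * n + 1) / (2 * real n + 1)\<^sup>2)"
    by (rule uniform_limit_theorem[rotated])
      (rule trivial_limit_sequentially, intro always_eventually allI continuous_on_sum continuous_on_divide continuous_on_mult continuous_on_power
        continuous_on_const continuous_on_id, simp_all)
  hence "((\<lambda>r::real. \<Sum>n. (-1) ^ n * r ^ (2 * n + 1) / (2 * real n + 1)\<^sup>2) \<longlongrightarrow>
      (\<Sum>n. (-1) ^ n * 1 ^ (2 * n + 1) / (2 * real n + 1)\<^sup>2)) (at 1 within {0..1})"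
    unfolding continuous_on_def by (rule bspec) simp
  moreover have "at 1 within {0..1} = at_left (1::real)"
    by (simp add: at_within_Icc_at_left)
  ultimately show ?thesis by (simp only: catalan_const_def power_one mult_1_right)
qed

text \<open>
  On the first quadrant \<open>\<bar>1 + r e\<^sup>i\<^sup>t\<bar> \<le> \<bar>1 + e\<^sup>i\<^sup>t\<bar>\<close>, so the value for \<open>r < 1\<close> bounds the integral
  for \<open>r = 1\<close> from below, and \<open>r\<close> may tend to \<open>1\<close> in the value alone.
\<close>
lemma integral_log_ge:
  assumes "((\<lambda>t. ln (2 + 2 * cos t)) has_integral I) {0..pi/2}"
  shows "2 * catalan_const \<le> I"
proof -
  have *: "(\<Sum>n. (-1) ^ n * r ^ (2 * n + 1) / (2 * real n + 1)\<^sup>2) \<le> I / 2" if r: "0 \<le> r" "r < 1" for r :: real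
  proof (rule has_integral_le[OF integral_log_norm[OF r]])
    show "((\<lambda>t. ln (2 + 2 * cos t) / 2) has_integral I / 2) {0..pi/2}"
      using has_integral_divide[OF assms, of 2] .
    fix t :: real assume "t \<in> {0..pi/2}"
    hence c: "0 \<le> cos t" by (intro cos_ge_zero) auto
    have "2 * r * cos t \<le> 2 * 1 * cos t" using c r by (intro mult_right_mono) auto
    moreover have "r\<^sup>2 \<le> 1" using r by (simp add: power_le_one)
    ultimately have "1 + 2 * r * cos t + r\<^sup>2 \<le> 2 + 2 * cos t" by simp
    moreover have "0 < 1 + 2 * r * cos t + r\<^sup>2" using c r
      by (intro add_pos_nonneg mult_nonneg_nonneg) auto
    ultimately have "ln (1 + 2 * r * cos t + r\<^sup>2) \<le> ln (2 + 2 * cos t)"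
      by (subst ln_le_cancel_iff) linarith+
    thus "ln (1 + 2 * r * cos t + r\<^sup>2) / 2 \<le> ln (2 + 2 * cos t) / 2" by linarith
  qed
  have "\<forall>\<^sub>F r in at_left 1. (\<Sum>n. (-1) ^ n * r ^ (2 * n + 1) / (2 * real n + 1)\<^sup>2) \<le> I / 2"
    unfolding eventually_at_left_field
  proof (intro exI[of _ 0] conjI allI impI)
    fix r :: real assume "0 < r" "r < 1"
    thus "(\<Sum>n. (-1) ^ n * r ^ (2 * n + 1) / (2 * real n + 1)\<^sup>2) \<le> I / 2" by (intro *) linarith+
  qed simp
  from tendsto_upperbound[OF catalan_partial_tendsto this] have "catalan_const \<le> I / 2"
    by (simp only: trivial_limit_at_left_real not_False_eq_True)
  thus ?thesis by linarith
qed

text \<open>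
  Replacing one of the two factors \<open>central_prob n\<close> by Wallis's integral sums the series
  under the integral sign to \<open>- ln ((1 + cos t) / 2) = ln 4 - ln (2 + 2 cos t)\<close>.
\<close>
lemma loop_series_bound:
  "(\<Sum>n=1..N. (central_prob n)\<^sup>2 / (2 * real n)) \<le> ln 4 - ln \<bb>"
proof -
  have "continuous_on {0..pi/2} (\<lambda>t::real. ln (2 + 2 * cos t))"
  proof (intro continuous_intros ballI)
    fix t :: real assume "t \<in> {0..pi/2}"
    hence "0 \<le> cos t" by (intro cos_ge_zero) auto
    thus "2 + 2 * cos t \<noteq> 0" by simp
  qed
  from integrable_continuous_real[OF this] obtain I where
    I: "((\<lambda>t. ln (2 + 2 * cos t)) has_integral I) {0..pi/2}" by (auto simp: integrable_on_def)
  have "((\<lambda>t. \<Sum>n=1..N. central_prob n * sin t ^ (2 * n) / (2 * real n)) has_integral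
      (\<Sum>n=1..N. central_prob n * (pi / 2 * central_prob n) / (2 * real n))) {0..pi/2}"
    by (intro has_integral_sum has_integral_divide has_integral_mult_right integral_sin_even_power) auto
  moreover have "((\<lambda>t. ln 4 - ln (2 + 2 * cos t)) has_integral (pi/2 * ln 4 - I)) {0..pi/2}"
    using has_integral_diff[OF has_integral_const_real[of "ln 4::real" 0 "pi/2"] I] by simp
  ultimately have "(\<Sum>n=1..N. central_prob n * (pi / 2 * central_prob n) / (2 * real n)) \<le> pi/2 * ln 4 - I"
  proof (rule has_integral_le)
    fix t :: real assume t: "t \<in> {0..pi/2}"
    hence c: "0 \<le> cos t" by (intro cos_ge_zero) auto
    have "- ln ((1 + cos t) / 2) = ln 4 - ln (2 + 2 * cos t)"
    proof -
      have "(1 + cos t) / 2 = (2 + 2 * cos t) / 4" by (simp add: field_simps)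
      moreover have "ln ((2 + 2 * cos t) / 4) = ln (2 + 2 * cos t) - ln 4"
        using c by (intro ln_divide_pos) auto
      ultimately show ?thesis by (metis minus_diff_eq)
    qed
    thus "(\<Sum>n=1..N. central_prob n * sin t ^ (2 * n) / (2 * real n)) \<le> ln 4 - ln (2 + 2 * cos t)"
      using log_half_partial_sum[of t N] t unfolding atLeastAtMost_iff by metis
  qed
  also have "\<dots> \<le> pi/2 * ln 4 - 2 * catalan_const"
    using integral_log_ge[OF I] by simp
  finally have "pi / 2 * (\<Sum>n=1..N. (central_prob n)\<^sup>2 / (2 * real n)) \<le> pi / 2 * (ln 4 - 4 * catalan_const / pi)"
    by (simp add: sum_distrib_left power2_eq_square algebra_simps)
  thus ?thesis by (simp add: \<bb>_def)
qed

section \<open>Determinants bounded below by traces of powers\<close>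

definition mat_trace :: "'a :: comm_ring_1 mat \<Rightarrow> 'a" where
  "mat_trace A = (\<Sum>i<dim_row A. A $$ (i, i))"

lemma mat_trace_comm:
  assumes "A \<in> carrier_mat n n" "B \<in> carrier_mat n n"
  shows "mat_trace (A * B) = mat_trace (B * A)"
proof -
  have "mat_trace (A * B) = (\<Sum>i<n. \<Sum>j<n. A $$ (i, j) * B $$ (j, i))"
    using assms by (auto simp: mat_trace_def scalar_prod_def atLeast0LessThan intro!: sum.cong)
  also have "\<dots> = (\<Sum>j<n. \<Sum>i<n. A $$ (i, j) * B $$ (j, i))" by (rule sum.swap)
  also have "\<dots> = mat_trace (B * A)"
    using assms by (auto simp: mat_trace_def scalar_prod_def atLeast0LessThan mult.commute intro!: sum.cong)
  finally show ?thesis .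
qed

lemma mat_trace_similar:
  assumes "similar_mat_wit A B P Q"
  shows "mat_trace A = mat_trace B"
proof -
  define n where "n = dim_row A"
  have c: "A \<in> carrier_mat n n" "B \<in> carrier_mat n n" "P \<in> carrier_mat n n" "Q \<in> carrier_mat n n"
    and QP: "Q * P = 1\<^sub>m n" and A: "A = P * B * Q"
    using similar_mat_witD[OF n_def assms] by auto
  have "mat_trace A = mat_trace (P * (B * Q))" using c A by simp
  also have "\<dots> = mat_trace ((B * Q) * P)" by (rule mat_trace_comm) (use c in auto)
  also have "(B * Q) * P = B" using c QP by simp
  finally show ?thesis .
qed

text \<open>
  The traces of the powers of a triangular matrix are power sums of its diagonal.
\<close>
lemma upper_triangular_pow:
  fixes U :: "'a :: comm_ring_1 mat"
  assumes U: "U \<in> carrier_mat n n" "upper_triangular U"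
  shows "upper_triangular (U ^\<^sub>m k) \<and> (\<forall>i<n. (U ^\<^sub>m k) $$ (i, i) = U $$ (i, i) ^ k)"
proof (induction k)
  case 0
  show ?case using U by auto
next
  case (Suc k)
  define V where "V = U ^\<^sub>m k"
  have V: "V \<in> carrier_mat n n" unfolding V_def using U(1) by (rule pow_carrier_mat)
  have zV: "V $$ (i, j) = 0" if "j < i" "i < n" for i j
    using Suc V that unfolding V_def[symmetric] by (auto simp: upper_triangular_def)
  have zU: "U $$ (i, j) = 0" if "j < i" "i < n" for i j
    using U that by (auto simp: upper_triangular_def)
  have e: "(V * U) $$ (i, j) = (\<Sum>l<n. V $$ (i, l) * U $$ (l, j))" if "i < n" "j < n" for i j
    using that U(1) V by (auto simp: scalar_prod_def atLeast0LessThan intro!: sum.cong)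
  have "(V * U) $$ (i, j) = 0" if ij: "j < i" "i < n" for i j
  proof -
    have "V $$ (i, l) * U $$ (l, j) = 0" if "l < n" for l
      using zV[of l i] zU[of j l] ij that by (cases "l < i") auto
    thus ?thesis using e[of i j] ij by simp
  qed
  moreover have "(V * U) $$ (i, i) = U $$ (i, i) ^ Suc k" if i: "i < n" for i
  proof -
    have "V $$ (i, l) * U $$ (l, i) = (if l = i then V $$ (i, i) * U $$ (i, i) else 0)" if "l < n" for l
      using zV[of l i] zU[of i l] i that by (cases l i rule: linorder_cases) auto
    hence "(V * U) $$ (i, i) = (\<Sum>l<n. if l = i then V $$ (i, i) * U $$ (i, i) else 0)"
      unfolding e[OF i i] by (intro sum.cong) auto
    thus ?thesis using Suc i by (simp add: V_def mult.commute)
  qed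
  ultimately show ?case
    using U(1) V unfolding V_def by (auto simp: upper_triangular_def)
qed

text \<open>
  At an entry of maximal modulus of an eigenvector, the eigenvalue equation is a weighted
  sum of entries that are no larger.
\<close>
lemma eigenvalue_norm_le:
  fixes A :: "complex mat"
  assumes A: "A \<in> carrier_mat n n" and ev: "eigenvalue A \<mu>"
    and row: "\<And>i. i < n \<Longrightarrow> (\<Sum>j<n. cmod (A $$ (i, j))) \<le> d"
  shows "cmod \<mu> \<le> d"
proof -
  obtain v where v: "v \<in> carrier_vec n" "v \<noteq> 0\<^sub>v n" "A *\<^sub>v v = \<mu> \<cdot>\<^sub>v v"
    using ev A unfolding eigenvalue_def eigenvector_def by auto
  then obtain i0 where i0: "i0 < n" "v $ i0 \<noteq> 0" by force
  have "Max ((\<lambda>i. cmod (v $ i)) ` {..<n}) \<in> (\<lambda>i. cmod (v $ i)) ` {..<n}"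
    using i0(1) by (intro Max_in) auto
  then obtain i where i: "i < n" and m: "Max ((\<lambda>i. cmod (v $ i)) ` {..<n}) = cmod (v $ i)" by auto
  have max: "cmod (v $ j) \<le> cmod (v $ i)" if "j < n" for j
    unfolding m[symmetric] using that by (intro Max_ge) auto
  have pos: "cmod (v $ i) > 0" using max[OF i0(1)] i0(2)
    by (meson less_le_trans zero_less_norm_iff)
  have "\<mu> * v $ i = (A *\<^sub>v v) $ i" using v i by simp
  also have "\<dots> = (\<Sum>j<n. A $$ (i, j) * v $ j)"
    using A v(1) i by (auto simp: scalar_prod_def atLeast0LessThan intro!: sum.cong)
  finally have "cmod \<mu> * cmod (v $ i) = cmod (\<Sum>j<n. A $$ (i, j) * v $ j)"
    by (metis norm_mult)
  also have "\<dots> \<le> (\<Sum>j<n. cmod (A $$ (i, j)) * cmod (v $ i))"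
    by (rule sum_norm_le) (use max in \<open>auto simp: norm_mult intro!: mult_left_mono\<close>)
  also have "\<dots> \<le> d * cmod (v $ i)"
    using row[OF i] pos by (simp add: sum_distrib_right[symmetric])
  finally show ?thesis using pos by simp
qed

text \<open>
  After triangularisation \<open>det (d I - A)\<close> is the product of \<open>d - \<mu>\<close> over the eigenvalues \<open>\<mu>\<close>, and
  \<open>ln \<bar>1 - \<mu> / d\<bar>\<close> has the power series \<open>- (\<Sum>k. Re (\<mu> ^ k) / (k d ^ k))\<close>; summed over the eigenvalues, its
  coefficients are traces. Since \<open>\<bar>\<mu>\<bar> = d\<close> is possible, the expansion is made at \<open>s d\<close> with \<open>s > 1\<close>,
  and \<open>s\<close> tends to \<open>1\<close> at the end.
\<close>
lemma det_lower_bound: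
  fixes A :: "complex mat" and d S :: real and c :: "nat \<Rightarrow> real"
  assumes A: "A \<in> carrier_mat n n" and d: "d > 0"
    and row: "\<And>i. i < n \<Longrightarrow> (\<Sum>j<n. cmod (A $$ (i, j))) \<le> d"
    and tr: "\<And>k. cmod (mat_trace (A ^\<^sub>m k)) \<le> real n * c k"
    and S: "\<And>N. (\<Sum>k=1..N. c k / (real k * d ^ k)) \<le> S"
  shows "d ^ n * exp (- real n * S) \<le> cmod (det (of_real d \<cdot>\<^sub>m 1\<^sub>m n - A))"
proof -
  obtain es where es: "char_poly A = (\<Prod>a\<leftarrow>es. [:- a, 1:])"
    using char_poly_factorized[OF A] by auto
  obtain U where U: "U \<in> carrier_mat n n" "upper_triangular U" and sim: "similar_mat A U"
    using schur_decomposition_exists[OF A es] by auto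
  then obtain P Q where wit: "similar_mat_wit A U P Q" by (auto simp: similar_mat_def)
  define \<mu> where "\<mu> = (\<lambda>i. U $$ (i, i))"
  have cp: "poly (char_poly A) z = (\<Prod>i<n. z - \<mu> i)" for z
  proof -
    have "poly (char_poly A) z = det (- (char_matrix U z))"
      unfolding char_poly_similar[OF sim] by (rule char_poly_matrix[OF U(1)])
    also have "\<dots> = prod_list (diag_mat (- (char_matrix U z)))"
      by (rule det_upper_triangular[of _ n])
         (use U in \<open>auto simp: upper_triangular_def char_matrix_def\<close>)
    also have "\<dots> = (\<Prod>i<n. z - \<mu> i)"
      using U by (auto simp: prod_list_diag_prod atLeast0LessThan \<mu>_def char_matrix_def intro!: prod.cong)
    finally show ?thesis .
  qed
  have \<mu>_le: "cmod (\<mu> i) \<le> d" if i: "i < n" for i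
  proof (rule eigenvalue_norm_le[OF A _ row])
    have "poly (char_poly A) (\<mu> i) = 0" unfolding cp using i by (auto intro!: prod_zero bexI[of _ i])
    thus "eigenvalue A (\<mu> i)" using eigenvalue_root_char_poly[OF A] by simp
  qed auto
  have trace: "mat_trace (A ^\<^sub>m k) = (\<Sum>i<n. \<mu> i ^ k)" for k
  proof -
    have "mat_trace (A ^\<^sub>m k) = mat_trace (U ^\<^sub>m k)"
      by (rule mat_trace_similar[OF similar_mat_wit_pow[OF wit]])
    thus ?thesis using upper_triangular_pow[OF U, of k] U(1) pow_carrier_mat[OF U(1), of k]
      by (auto simp: mat_trace_def \<mu>_def)
  qed
  have c: "0 \<le> real n * c k" for k using tr[of k] norm_ge_zero order_trans by blast
  have bound: "d ^ n * exp (- real n * S) \<le> (\<Prod>i<n. cmod (of_real (s * d) - \<mu> i))" if s: "s > 1" for s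
  proof -
    define z where "z = (\<lambda>i. \<mu> i / of_real (s * d))"
    have sd: "s * d > 0" "d < s * d" using s d by auto
    have z: "cmod (z i) < 1" if "i < n" for i
      unfolding z_def norm_divide norm_of_real using \<mu>_le[OF that] sd by simp
    hence nz: "1 - z i \<noteq> 0" if "i < n" for i using that by force
    have ln: "(\<lambda>k. Re (- (z i ^ k) / of_nat k)) sums ln (cmod (1 - z i))" if i: "i < n" for i
    proof -
      have "(\<lambda>k. - (z i ^ k) / of_nat k) sums Ln (1 - z i)"
        using Ln_series'[of "- z i"] z[OF i] by simp
      from sums_Re[OF this] show ?thesis using nz[OF i] by simp
    qed
    have "(\<lambda>k. \<Sum>i<n. Re (- (z i ^ k) / of_nat k)) sums (\<Sum>i<n. ln (cmod (1 - z i)))"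
      by (rule sums_sum) (use ln in auto)
    hence lim: "(\<lambda>N. \<Sum>k<N. \<Sum>i<n. Re (- (z i ^ k) / of_nat k)) \<longlonglongrightarrow> (\<Sum>i<n. ln (cmod (1 - z i)))"
      by (simp add: sums_def)
    have kth: "- (real n * c k / (real k * d ^ k)) \<le> (\<Sum>i<n. Re (- (z i ^ k) / of_nat k))" for k
    proof -
      have "(\<Sum>i<n. Re (- (z i ^ k) / of_nat k)) = - (Re (\<Sum>i<n. z i ^ k) / real k)"
        by (simp add: sum_negf sum_divide_distrib[symmetric] Re_divide_of_nat)
      also have "(\<Sum>i<n. z i ^ k) = mat_trace (A ^\<^sub>m k) / of_real ((s * d) ^ k)"
        unfolding trace z_def by (simp add: power_divide sum_divide_distrib)
      finally have eq: "(\<Sum>i<n. Re (- (z i ^ k) / of_nat k))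
          = - (Re (mat_trace (A ^\<^sub>m k) / of_real ((s * d) ^ k)) / real k)" .
      have "Re (mat_trace (A ^\<^sub>m k) / of_real ((s * d) ^ k)) \<le> cmod (mat_trace (A ^\<^sub>m k) / of_real ((s * d) ^ k))"
        by (rule complex_Re_le_cmod)
      also have "\<dots> = cmod (mat_trace (A ^\<^sub>m k)) / (s * d) ^ k"
        unfolding norm_divide norm_of_real using sd by simp
      also have "\<dots> \<le> real n * c k / d ^ k"
        using tr[of k] sd d c[of k] by (intro frac_le power_mono) auto
      finally have "Re (mat_trace (A ^\<^sub>m k) / of_real ((s * d) ^ k)) / real k \<le> real n * c k / d ^ k / real k"
        by (rule divide_right_mono) simp
      thus ?thesis unfolding eq by (simp add: mult.commute)
    qed
    have "- (real n * S) \<le> (\<Sum>i<n. ln (cmod (1 - z i)))"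
    proof (rule LIMSEQ_le_const[OF lim], intro exI[of _ 0] allI impI)
      fix N :: nat
      have "(\<Sum>k<N. c k / (real k * d ^ k)) \<le> S"
      proof (cases N)
        case 0 thus ?thesis using S[of 0] by simp
      next
        case (Suc M)
        have "(\<Sum>k<N. c k / (real k * d ^ k)) = (\<Sum>k=0..M. c k / (real k * d ^ k))"
          unfolding Suc by (simp add: lessThan_Suc_atMost atMost_atLeast0)
        also have "\<dots> = (\<Sum>k=1..M. c k / (real k * d ^ k))"
          by (simp add: sum.atLeast_Suc_atMost)
        finally show ?thesis using S[of M] by simp
      qed
      hence "- (real n * S) \<le> - (real n * (\<Sum>k<N. c k / (real k * d ^ k)))"
        by (simp add: mult_left_mono)
      also have "\<dots> = (\<Sum>k<N. - (real n * c k / (real k * d ^ k)))"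
        by (simp add: sum_distrib_left sum_negf)
      also have "\<dots> \<le> (\<Sum>k<N. \<Sum>i<n. Re (- (z i ^ k) / of_nat k))"
        by (rule sum_mono) (rule kth)
      finally show "- (real n * S) \<le> (\<Sum>k<N. \<Sum>i<n. Re (- (z i ^ k) / of_nat k))" .
    qed
    hence "exp (- real n * S) \<le> exp (\<Sum>i<n. ln (cmod (1 - z i)))" by simp
    also have "\<dots> = (\<Prod>i<n. cmod (1 - z i))"
      using nz by (simp add: exp_sum)
    finally have e: "exp (- real n * S) \<le> (\<Prod>i<n. cmod (1 - z i))" .
    have "d ^ n * exp (- real n * S) \<le> (s * d) ^ n * (\<Prod>i<n. cmod (1 - z i))"
      using e sd d by (intro mult_mono power_mono) auto
    also have "\<dots> = (\<Prod>i<n. (s * d) * cmod (1 - z i))"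
      by (simp add: prod.distrib)
    also have "\<dots> = (\<Prod>i<n. cmod (of_real (s * d) - \<mu> i))"
    proof (rule prod.cong[OF refl])
      fix i
      have "of_real (s * d) - \<mu> i = of_real (s * d) * (1 - z i)"
        using s d by (simp add: z_def right_diff_distrib)
      thus "(s * d) * cmod (1 - z i) = cmod (of_real (s * d) - \<mu> i)"
        using sd by (simp add: norm_mult del: of_real_mult)
    qed
    finally show ?thesis .
  qed
  have "((\<lambda>s. \<Prod>i<n. cmod (of_real (s * d) - \<mu> i)) \<longlongrightarrow> (\<Prod>i<n. cmod (of_real (1 * d) - \<mu> i))) (at_right 1)"
    by (intro tendsto_intros)
  moreover have "\<forall>\<^sub>F s in at_right 1. d ^ n * exp (- real n * S) \<le> (\<Prod>i<n. cmod (of_real (s * d) - \<mu> i))"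
    unfolding eventually_at_right_field by (rule exI[of _ 2]) (use bound in auto)
  ultimately have "d ^ n * exp (- real n * S) \<le> (\<Prod>i<n. cmod (of_real (1 * d) - \<mu> i))"
    by (rule tendsto_lowerbound) simp
  also have "\<dots> = cmod (poly (char_poly A) (of_real d))" unfolding cp by (simp add: prod_norm)
  also have "poly (char_poly A) (of_real d) = det (of_real d \<cdot>\<^sub>m 1\<^sub>m n - A)"
    unfolding char_poly_matrix[OF A]
    by (rule arg_cong[of _ _ det], rule eq_matI) (use A in \<open>auto simp: char_matrix_def\<close>)
  finally show ?thesis .
qed

section \<open>Exit rules and the matrix-tree expansion\<close>

definition leaves :: "'a set \<Rightarrow> ('a \<Rightarrow> 'a) \<Rightarrow> 'a \<Rightarrow> bool" where
  "leaves F g x \<longleftrightarrow> (\<exists>k. (g ^^ k) x \<notin> F)"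

lemma leaves_outside: "x \<notin> F \<Longrightarrow> leaves F g x"
  unfolding leaves_def by (rule exI[of _ 0]) simp

lemma leaves_step: "x \<in> F \<Longrightarrow> leaves F g (g x) \<longleftrightarrow> leaves F g x"
proof
  assume "leaves F g (g x)"
  then obtain k where "(g ^^ k) (g x) \<notin> F" by (auto simp: leaves_def)
  hence "(g ^^ Suc k) x \<notin> F" by (simp add: funpow_swap1)
  thus "leaves F g x" unfolding leaves_def by blast
next
  assume "x \<in> F" "leaves F g x"
  then obtain k where k: "(g ^^ k) x \<notin> F" by (auto simp: leaves_def)
  with \<open>x \<in> F\<close> obtain j where "k = Suc j" by (cases k) auto
  with k have "(g ^^ j) (g x) \<notin> F" by (simp add: funpow_swap1)
  thus "leaves F g (g x)" unfolding leaves_def by blast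
qed

text \<open>
  A periodic trajectory visits no states but those of its first period, so it must leave
  within it.
\<close>
lemma leaves_no_cycle:
  assumes "leaves F g x" and "(g ^^ Suc k) x = x"
  shows "\<exists>l\<le>k. (g ^^ l) x \<notin> F"
proof -
  obtain N where N: "(g ^^ N) x \<notin> F" using assms(1) by (auto simp: leaves_def)
  have "(g ^^ (N mod Suc k)) x = (g ^^ N) x" using assms(2) by (rule funpow_mod_eq)
  moreover have "N mod Suc k \<le> k" by (simp add: less_Suc_eq_le[symmetric])
  ultimately show ?thesis using N by (intro exI[of _ "N mod Suc k"]) simp
qed

text \<open>
  Identity minus the transition matrix of a map, restricted to the listed points; a step
  out of the list leaves only the diagonal entry.
\<close>
definition step_mat :: "'a list \<Rightarrow> ('a \<Rightarrow> 'a) \<Rightarrow> int mat" where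
  "step_mat xs g = mat (length xs) (length xs) (\<lambda>(i, j). of_bool (i = j) - of_bool (g (xs ! i) = xs ! j))"

lemma sum_of_bool_nth:
  fixes w :: "'a \<Rightarrow> 'b :: comm_ring_1"
  assumes "distinct xs"
  shows "(\<Sum>j<length xs. of_bool (y = xs ! j) * w (xs ! j)) = (if y \<in> set xs then w y else 0)"
proof -
  have "(\<Sum>j<length xs. of_bool (y = xs ! j) * w (xs ! j)) = (\<Sum>x\<in>set xs. of_bool (y = x) * w x)"
    using bij_betw_nth[OF assms, of "{..<length xs}" "set xs"]
    by (intro sum.reindex_bij_betw[of "\<lambda>j. xs ! j"]) auto
  also have "\<dots> = (\<Sum>x\<in>set xs. if x = y then w y else 0)" by (intro sum.cong) auto
  finally show ?thesis by simp
qed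

lemma step_mat_action:
  assumes "distinct xs" "i < length xs"
  shows "(\<Sum>j<length xs. step_mat xs g $$ (i, j) * w (xs ! j))
    = w (xs ! i) - (if g (xs ! i) \<in> set xs then w (g (xs ! i)) else 0)"
proof -
  have "(\<Sum>j<length xs. step_mat xs g $$ (i, j) * w (xs ! j))
     = (\<Sum>j<length xs. (if i = j then w (xs ! j) else 0)) - (\<Sum>j<length xs. of_bool (g (xs ! i) = xs ! j) * w (xs ! j))"
    unfolding sum_subtractf[symmetric] using assms
    by (intro sum.cong) (auto simp: step_mat_def left_diff_distrib)
  thus ?thesis using assms by (simp add: sum_of_bool_nth[OF assms(1)])
qed

text \<open>
  A point is trapped iff its image is, so the indicator of the trapped points lies
  in the kernel.
\<close>
lemma det_step_mat_trapped:
  assumes "distinct xs" "x \<in> set xs" "\<not> leaves (set xs) g x"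
  shows "Determinant.det (step_mat xs g) = 0"
proof -
  define n where "n = length xs"
  define w where "w = (\<lambda>x. of_bool (\<not> leaves (set xs) g x) :: int)"
  define v where "v = vec n (\<lambda>j. w (xs ! j))"
  have M: "step_mat xs g \<in> carrier_mat n n" by (simp add: step_mat_def n_def)
  obtain i where i: "i < n" "xs ! i = x" using assms(2) by (auto simp: in_set_conv_nth n_def)
  have "v $ i \<noteq> 0" using i assms(3) by (simp add: v_def w_def)
  hence "v \<noteq> 0\<^sub>v n" using i by auto
  moreover have "step_mat xs g *\<^sub>v v = 0\<^sub>v n"
  proof (rule eq_vecI)
    fix i assume "i < dim_vec (0\<^sub>v n)"
    hence i: "i < n" by simp
    have "(step_mat xs g *\<^sub>v v) $ i = (\<Sum>j<n. step_mat xs g $$ (i, j) * w (xs ! j))"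
      using i M by (auto simp: v_def scalar_prod_def atLeast0LessThan intro!: sum.cong)
    also have "\<dots> = w (xs ! i) - (if g (xs ! i) \<in> set xs then w (g (xs ! i)) else 0)"
      unfolding n_def by (rule step_mat_action[OF assms(1)]) (use i in \<open>simp add: n_def\<close>)
    also have "\<dots> = 0"
      using leaves_step[of "xs ! i" "set xs" g] leaves_outside[of "g (xs ! i)" "set xs" g] i
      by (auto simp: w_def n_def)
    finally show "(step_mat xs g *\<^sub>v v) $ i = 0\<^sub>v n $ i" using i by simp
  qed (use M in auto)
  moreover have "v \<in> carrier_vec n" by (simp add: v_def)
  ultimately show ?thesis using det_0_iff_vec_prod_zero[OF M] by blast
qed

text \<open>
  If nothing is trapped, the matrix has an integral inverse: its entry at \<open>x, y\<close> tells whether the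
  trajectory of \<open>x\<close> visits \<open>y\<close> before leaving. The first step of the trajectory gives the matrix
  equation, because \<open>x\<close> does not return to itself.
\<close>
lemma det_step_mat_leaving:
  assumes "distinct xs" and leave: "\<And>x. x \<in> set xs \<Longrightarrow> leaves (set xs) g x"
  shows "\<bar>Determinant.det (step_mat xs g)\<bar> = 1"
proof -
  define n where "n = length xs"
  \<comment> \<open>\<open>R x y\<close>: the trajectory of \<open>x\<close> visits \<open>y\<close> before it leaves\<close>
  define R where "R = (\<lambda>x y. \<exists>k. (g ^^ k) x = y \<and> (\<forall>l\<le>k. (g ^^ l) x \<in> set xs))"
  define Q :: "int mat" where "Q = mat n n (\<lambda>(i, j). of_bool (R (xs ! i) (xs ! j)))"
  have M: "step_mat xs g \<in> carrier_mat n n" by (simp add: step_mat_def n_def)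
  have Q: "Q \<in> carrier_mat n n" by (simp add: Q_def)
  have R_out: "\<not> R x y" if "x \<notin> set xs" for x y
  proof
    assume "R x y"
    then obtain k where "\<forall>l\<le>k. (g ^^ l) x \<in> set xs" by (auto simp: R_def)
    from this[rule_format, of 0] that show False by simp
  qed
  have R_step: "R x y \<longleftrightarrow> x = y \<or> R (g x) y" if x: "x \<in> set xs" for x y
  proof
    assume "R x y"
    then obtain k where k: "(g ^^ k) x = y" "\<forall>l\<le>k. (g ^^ l) x \<in> set xs" by (auto simp: R_def)
    show "x = y \<or> R (g x) y"
    proof (cases k)
      case 0 thus ?thesis using k by simp
    next
      case (Suc j)
      have "(g ^^ j) (g x) = y" using k(1) Suc by (simp add: funpow_swap1)
      moreover have "(g ^^ l) (g x) \<in> set xs" if "l \<le> j" for l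
        using k(2)[rule_format, of "Suc l"] that Suc by (simp add: funpow_swap1)
      ultimately show ?thesis unfolding R_def by blast
    qed
  next
    assume "x = y \<or> R (g x) y"
    thus "R x y"
    proof
      assume "x = y"
      thus ?thesis unfolding R_def using x by (intro exI[of _ 0]) auto
    next
      assume "R (g x) y"
      then obtain k where k: "(g ^^ k) (g x) = y" "\<forall>l\<le>k. (g ^^ l) (g x) \<in> set xs" by (auto simp: R_def)
      have "(g ^^ Suc k) x = y" using k(1) by (simp add: funpow_swap1)
      moreover have "(g ^^ l) x \<in> set xs" if "l \<le> Suc k" for l
      proof (cases l)
        case 0 thus ?thesis using x by simp
      next
        case (Suc j)
        thus ?thesis using k(2)[rule_format, of j] that by (simp add: funpow_swap1)
      qed
      ultimately show ?thesis unfolding R_def by blast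
    qed
  qed
  have no_return: "\<not> R (g x) x" if x: "x \<in> set xs" for x
  proof
    assume "R (g x) x"
    then obtain k where k: "(g ^^ k) (g x) = x" "\<forall>l\<le>k. (g ^^ l) (g x) \<in> set xs" by (auto simp: R_def)
    have "(g ^^ Suc k) x = x" using k(1) by (simp add: funpow_swap1)
    from leaves_no_cycle[OF leave[OF x] this] obtain l where l: "l \<le> k" "(g ^^ l) x \<notin> set xs" by blast
    show False
    proof (cases l)
      case 0 thus ?thesis using l x by simp
    next
      case (Suc j)
      hence "(g ^^ j) (g x) \<notin> set xs" using l(2) by (simp add: funpow_swap1)
      thus ?thesis using k(2) l(1) Suc by auto
    qed
  qed
  have "step_mat xs g * Q = 1\<^sub>m n"
  proof (rule eq_matI)
    fix i j assume "i < dim_row (1\<^sub>m n :: int mat)" "j < dim_col (1\<^sub>m n :: int mat)"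
    hence ij: "i < n" "j < n" by auto
    have "(step_mat xs g * Q) $$ (i, j) = (\<Sum>l<n. step_mat xs g $$ (i, l) * of_bool (R (xs ! l) (xs ! j)))"
      using ij M Q by (auto simp: Q_def scalar_prod_def atLeast0LessThan intro!: sum.cong)
    also have "\<dots> = of_bool (R (xs ! i) (xs ! j)) -
        (if g (xs ! i) \<in> set xs then of_bool (R (g (xs ! i)) (xs ! j)) else 0)"
      unfolding n_def
      by (rule step_mat_action[OF assms(1), where w = "\<lambda>x. of_bool (R x (xs ! j))"]) (use ij in \<open>simp add: n_def\<close>)
    also have "\<dots> = of_bool (xs ! i = xs ! j)"
      using R_step[of "xs ! i" "xs ! j"] R_out[of "g (xs ! i)" "xs ! j"] no_return[of "xs ! i"] ij
      by (auto simp: n_def)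
    also have "\<dots> = 1\<^sub>m n $$ (i, j)"
      using ij assms(1) by (simp add: n_def nth_eq_iff_index_eq)
    finally show "(step_mat xs g * Q) $$ (i, j) = 1\<^sub>m n $$ (i, j)" .
  qed (use M Q in auto)
  hence "Determinant.det (step_mat xs g) * Determinant.det Q = 1"
    using det_mult[OF M Q] by simp
  hence "\<bar>Determinant.det (step_mat xs g) * Determinant.det Q\<bar> = 1" by simp
  thus ?thesis by (rule abs_zmult_eq_1)
qed

text \<open>
  The entries count directions, so the matrix makes sense for arbitrary step functions; a
  step that leaves the list counts on the diagonal only (Dirichlet boundary).
\<close>
definition walk_laplacian :: "'a list \<Rightarrow> nat \<Rightarrow> ('a \<Rightarrow> nat \<Rightarrow> 'a) \<Rightarrow> int mat" where
  "walk_laplacian xs d nb = mat (length xs) (length xs)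
     (\<lambda>(i, j). (if i = j then int d else 0) - int (card {k. k < d \<and> nb (xs ! i) k = xs ! j}))"

text \<open>
  Rules are extensional functions, so that different members differ on \<open>F\<close>.
\<close>
definition exit_rules :: "'a set \<Rightarrow> nat \<Rightarrow> ('a \<Rightarrow> nat \<Rightarrow> 'a) \<Rightarrow> ('a \<Rightarrow> nat) set" where
  "exit_rules F d nb = {\<psi> \<in> F \<rightarrow>\<^sub>E {..<d}. \<forall>x\<in>F. leaves F (\<lambda>x. nb x (\<psi> x)) x}"

lemma finite_exit_rules: "finite F \<Longrightarrow> finite (exit_rules F d nb)"
  by (rule finite_subset[of _ "F \<rightarrow>\<^sub>E {..<d}"]) (auto simp: exit_rules_def intro: finite_PiE)

text \<open>
  Each row is a sum over the \<open>d\<close> directions of the corresponding row of a step matrix. By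
  multilinearity the determinant is the sum, over all choices of one direction per row, of the
  determinants of step matrices, which are \<open>\<plusminus>1\<close> if the choice is an exit rule and vanish otherwise.
\<close>
lemma det_walk_laplacian_le:
  assumes "distinct xs"
  shows "\<bar>Determinant.det (walk_laplacian xs d nb)\<bar> \<le> int (card (exit_rules (set xs) d nb))"
proof -
  define n where "n = length xs"
  define a where "a = (\<lambda>i k. vec n (\<lambda>j. of_bool (i = j) - of_bool (nb (xs ! i) k = xs ! j)) :: int vec)"
  define FS where "FS = {f. (\<forall>i\<in>{0..<n}. f i \<in> {..<d}) \<and> (\<forall>i. i \<notin> {0..<n} \<longrightarrow> f i = (i::nat))}"
  define idx where "idx = inv_into {..<n} (\<lambda>i. xs ! i)"
  have inj: "inj_on (\<lambda>i. xs ! i) {..<n}"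
    using assms by (auto simp: inj_on_def n_def nth_eq_iff_index_eq)
  have idx: "idx (xs ! i) = i" if "i < n" for i
    unfolding idx_def using inj that by (intro inv_into_f_f) auto
  \<comment> \<open>a choice of directions for the rows, read as a function on the listed points\<close>
  define rule where "rule = (\<lambda>f::nat \<Rightarrow> nat. restrict (\<lambda>x. f (idx x)) (set xs))"
  define step where "step = (\<lambda>f x. nb x (rule f x))"
  have fin: "finite FS" unfolding FS_def by (rule finite_bounded_functions) auto
  have "walk_laplacian xs d nb = mat\<^sub>r n n (\<lambda>i. finsum_vec TYPE(int) n (a i) {..<d})"
  proof (rule eq_matI)
    fix i j assume "i < dim_row (mat\<^sub>r n n (\<lambda>i. finsum_vec TYPE(int) n (a i) {..<d}))"
      "j < dim_col (mat\<^sub>r n n (\<lambda>i. finsum_vec TYPE(int) n (a i) {..<d}))"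
    hence ij: "i < n" "j < n" by auto
    have "(\<Sum>k<d. a i k $ j) = (\<Sum>k<d. of_bool (i = j)) - (\<Sum>k<d. of_bool (nb (xs ! i) k = xs ! j))"
      unfolding sum_subtractf[symmetric] using ij by (simp add: a_def)
    also have "(\<Sum>k<d. of_bool (nb (xs ! i) k = xs ! j)) = int (card {k. k < d \<and> nb (xs ! i) k = xs ! j})"
      by (simp add: sum.If_cases of_bool_def Int_def lessThan_def)
    finally have "(\<Sum>k<d. a i k $ j) = walk_laplacian xs d nb $$ (i, j)"
      using ij by (simp add: walk_laplacian_def n_def)
    moreover have "finsum_vec TYPE(int) n (a i) {..<d} $ j = (\<Sum>k<d. a i k $ j)"
      by (rule index_finsum_vec) (use ij in \<open>auto simp: a_def\<close>)
    ultimately show "walk_laplacian xs d nb $$ (i, j) = mat\<^sub>r n n (\<lambda>i. finsum_vec TYPE(int) n (a i) {..<d}) $$ (i, j)"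
      using ij by simp
  qed (auto simp: walk_laplacian_def n_def)
  hence "Determinant.det (walk_laplacian xs d nb) = (\<Sum>f\<in>FS. Determinant.det (mat\<^sub>r n n (\<lambda>i. a i (f i))))"
    unfolding FS_def by (simp only:) (rule det_linear_rows_sum, auto simp: a_def)
  also have "\<dots> = (\<Sum>f\<in>FS. Determinant.det (step_mat xs (step f)))"
  proof (rule sum.cong[OF refl], rule arg_cong[of _ _ Determinant.det])
    fix f
    show "mat\<^sub>r n n (\<lambda>i. a i (f i)) = step_mat xs (step f)"
    proof (rule eq_matI)
      fix i j assume "i < dim_row (step_mat xs (step f))" "j < dim_col (step_mat xs (step f))"
      hence ij: "i < n" "j < n" by (auto simp: step_mat_def n_def)
      hence "xs ! i \<in> set xs" by (simp add: n_def)
      thus "mat\<^sub>r n n (\<lambda>i. a i (f i)) $$ (i, j) = step_mat xs (step f) $$ (i, j)"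
        using ij idx[of i] by (simp add: a_def step_mat_def n_def step_def rule_def)
    qed (auto simp: step_mat_def n_def)
  qed
  finally have "\<bar>Determinant.det (walk_laplacian xs d nb)\<bar> \<le> (\<Sum>f\<in>FS. \<bar>Determinant.det (step_mat xs (step f))\<bar>)"
    by (simp only: sum_abs)
  also have "\<dots> \<le> (\<Sum>f\<in>FS. of_bool (rule f \<in> exit_rules (set xs) d nb))"
  proof (rule sum_mono)
    fix f assume f: "f \<in> FS"
    show "\<bar>Determinant.det (step_mat xs (step f))\<bar> \<le> of_bool (rule f \<in> exit_rules (set xs) d nb)"
    proof (cases "\<forall>x\<in>set xs. leaves (set xs) (step f) x")
      case True
      have "rule f \<in> set xs \<rightarrow>\<^sub>E {..<d}"
      proof (rule PiE_I)
        fix x assume "x \<in> set xs"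
        then obtain i where "i < n" "x = xs ! i" unfolding n_def by (metis in_set_conv_nth)
        thus "rule f x \<in> {..<d}" using f idx[of i] \<open>x \<in> set xs\<close> by (simp add: rule_def FS_def)
      qed (simp add: rule_def)
      hence "rule f \<in> exit_rules (set xs) d nb"
        using True unfolding exit_rules_def step_def by blast
      thus ?thesis using det_step_mat_leaving[OF assms, of "step f"] True by simp
    next
      case False
      thus ?thesis using det_step_mat_trapped[OF assms, of _ "step f"] by auto
    qed
  qed
  also have "\<dots> = int (card {f \<in> FS. rule f \<in> exit_rules (set xs) d nb})"
    using fin by (simp add: of_bool_def sum.If_cases Int_def)
  also have "\<dots> \<le> int (card (exit_rules (set xs) d nb))"
  proof -
    have "inj_on rule FS"
    proof (rule inj_onI, rule ext)
      fix f g i assume fg: "f \<in> FS" "g \<in> FS" "rule f = rule g"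
      show "f i = g i"
      proof (cases "i < n")
        case True
        have "rule f (xs ! i) = rule g (xs ! i)" using fg(3) by simp
        thus ?thesis using True unfolding rule_def by (simp add: idx) (simp add: idx n_def)
      qed (use fg in \<open>simp add: FS_def\<close>)
    qed
    hence "card (rule ` {f \<in> FS. rule f \<in> exit_rules (set xs) d nb}) = card {f \<in> FS. rule f \<in> exit_rules (set xs) d nb}"
      by (intro card_image) (rule inj_on_subset, assumption, blast)
    moreover have "card (rule ` {f \<in> FS. rule f \<in> exit_rules (set xs) d nb}) \<le> card (exit_rules (set xs) d nb)"
      by (intro card_mono finite_exit_rules finite_set) blast
    ultimately show ?thesis by simp
  qed
  finally show ?thesis .
qed

section \<open>Exit rules on the square lattice\<close>

text \<open>
  Directions are numbered right, left, up, down; every number above \<open>2\<close> means down.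
\<close>
fun lattice_step :: "int \<times> int \<Rightarrow> nat \<Rightarrow> int \<times> int" where
  "lattice_step (x, y) k =
     (if k = 0 then (x + 1, y) else if k = 1 then (x - 1, y) else if k = 2 then (x, y + 1) else (x, y - 1))"

text \<open>
  The number of walks of \<open>k\<close> unit steps on the integers from \<open>u\<close> to \<open>0\<close>.
\<close>
fun line_walks :: "nat \<Rightarrow> int \<Rightarrow> nat" where
  "line_walks 0 u = of_bool (u = 0)"
| "line_walks (Suc k) u = line_walks k (u - 1) + line_walks k (u + 1)"

lemma line_walks_far: "\<bar>u\<bar> > int k \<Longrightarrow> line_walks k u = 0"
  by (induction k arbitrary: u) auto

lemma line_walks_parity: "odd (int k + u) \<Longrightarrow> line_walks k u = 0"
  by (induction k arbitrary: u) auto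

lemma line_walks_binomial: "line_walks k (int k - 2 * int j) = k choose j"
proof (induction k arbitrary: j)
  case 0
  show ?case by (cases j) auto
next
  case (Suc k)
  have 1: "int (Suc k) - 2 * int j - 1 = int k - 2 * int j" by simp
  show ?case
  proof (cases j)
    case 0
    thus ?thesis using Suc.IH[of 0] by (simp add: line_walks_far)
  next
    case (Suc i)
    have "int (Suc k) - 2 * int j + 1 = int k - 2 * int i" using Suc by simp
    thus ?thesis using Suc.IH[of j] Suc.IH[of i] 1 Suc by (simp only: line_walks.simps binomial_Suc_Suc add.commute)
  qed
qed

text \<open>
  The number of lattice walks of length \<open>k\<close> from \<open>p\<close> to \<open>q\<close>. In the coordinates \<open>x + y\<close> and \<open>x - y\<close> a
  step of the lattice is a pair of independent unit steps on the line, whence the product.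
\<close>
definition plane_walks :: "nat \<Rightarrow> int \<times> int \<Rightarrow> int \<times> int \<Rightarrow> real" where
  "plane_walks k p q = real (line_walks k (fst p + snd p - fst q - snd q) * line_walks k (fst p - snd p - fst q + snd q))"

lemma plane_walks_nonneg: "0 \<le> plane_walks k p q"
  by (simp add: plane_walks_def)

lemma plane_walks_Suc: "plane_walks (Suc k) p q = (\<Sum>m<4. plane_walks k (lattice_step p m) q)"
proof -
  obtain a b where p: "p = (a, b)" by fastforce
  obtain c d where q: "q = (c, d)" by fastforce
  define S D where "S = a + b - c - d" and "D = a - b - c + d"
  have s: "(\<Sum>m<4. f m) = f 0 + f 1 + f 2 + (f 3 :: real)" for f :: "nat \<Rightarrow> real"
    by (simp add: lessThan_Suc numeral_eq_Suc)
  have v: "plane_walks k (a', b') (c, d) = real (line_walks k (a' + b' - c - d)) * real (line_walks k (a' - b' - c + d))" for k a' b'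
    by (simp add: plane_walks_def)
  have e: "a + 1 + b - c - d = S + 1" "a + 1 - b - c + d = D + 1"
     "a - 1 + b - c - d = S - 1" "a - 1 - b - c + d = D - 1"
     "a + (b + 1) - c - d = S + 1" "a - (b + 1) - c + d = D - 1"
     "a + (b - 1) - c - d = S - 1" "a - (b - 1) - c + d = D + 1" by (simp_all add: S_def D_def)
  have m: "lattice_step (a, b) 0 = (a + 1, b)" "lattice_step (a, b) 1 = (a - 1, b)"
     "lattice_step (a, b) 2 = (a, b + 1)" "lattice_step (a, b) 3 = (a, b - 1)" by simp_all
  have SD: "a + b - c - d = S" "a - b - c + d = D" by (simp_all add: S_def D_def)
  show ?thesis unfolding s p q m v e SD line_walks.simps of_nat_add
    by (simp only: distrib_left distrib_right add_ac)
qed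

definition adjacency :: "(int \<times> int) list \<Rightarrow> complex mat" where
  "adjacency xs = mat (length xs) (length xs)
     (\<lambda>(i, j). of_nat (card {m. m < 4 \<and> lattice_step (xs ! i) m = xs ! j}))"

lemma adjacency_entry:
  assumes "i < length xs" "j < length xs"
  shows "adjacency xs $$ (i, j) = of_real (\<Sum>m<4. of_bool (lattice_step (xs ! i) m = xs ! j))"
proof -
  have "real (card {m. m < 4 \<and> lattice_step (xs ! i) m = xs ! j}) = (\<Sum>m<4. of_bool (lattice_step (xs ! i) m = xs ! j))"
    by (simp add: sum.If_cases of_bool_def Int_def lessThan_def)
  moreover have "adjacency xs $$ (i, j) = of_real (real (card {m. m < 4 \<and> lattice_step (xs ! i) m = xs ! j}))"
    using assms by (simp add: adjacency_def)
  ultimately show ?thesis by (simp only:)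
qed

lemma adjacency_sum:
  assumes "distinct xs" "i < length xs"
  shows "(\<Sum>j<length xs. cmod (adjacency xs $$ (i, j)) * w (xs ! j))
    = (\<Sum>m<4. if lattice_step (xs ! i) m \<in> set xs then w (lattice_step (xs ! i) m) else 0)"
proof -
  have "(\<Sum>j<length xs. cmod (adjacency xs $$ (i, j)) * w (xs ! j))
      = (\<Sum>j<length xs. \<Sum>m<4. of_bool (lattice_step (xs ! i) m = xs ! j) * w (xs ! j))"
  proof (rule sum.cong[OF refl])
    fix j assume "j \<in> {..<length xs}"
    hence "j < length xs" by simp
    have "0 \<le> (\<Sum>m<4. of_bool (lattice_step (xs ! i) m = xs ! j) :: real)"
      by (rule sum_nonneg) simp
    hence "cmod (adjacency xs $$ (i, j)) = (\<Sum>m<4. of_bool (lattice_step (xs ! i) m = xs ! j))"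
      unfolding adjacency_entry[OF assms(2) \<open>j < length xs\<close>] norm_of_real by (rule abs_of_nonneg)
    thus "cmod (adjacency xs $$ (i, j)) * w (xs ! j) = (\<Sum>m<4. of_bool (lattice_step (xs ! i) m = xs ! j) * w (xs ! j))"
      by (simp only: sum_distrib_right)
  qed
  also have "\<dots> = (\<Sum>m<4. \<Sum>j<length xs. of_bool (lattice_step (xs ! i) m = xs ! j) * w (xs ! j))"
    by (rule sum.swap)
  finally show ?thesis unfolding sum_of_bool_nth[OF assms(1)] .
qed

text \<open>
  A power of the adjacency matrix counts the walks that stay in the list; without this
  restriction there are only more.
\<close>
lemma adjacency_pow_le:
  assumes "distinct xs" "i < length xs" "j < length xs"
  shows "cmod ((adjacency xs ^\<^sub>m k) $$ (i, j)) \<le> plane_walks k (xs ! i) (xs ! j)"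
  using assms(2,3)
proof (induction k arbitrary: i j)
  case 0
  have "dim_row (adjacency xs) = length xs" by (simp add: adjacency_def)
  thus ?case using 0 assms(1)
    by (cases "i = j") (simp_all add: plane_walks_def)
next
  case (Suc k)
  define A where "A = adjacency xs"
  define n where "n = length xs"
  have A: "A \<in> carrier_mat n n" by (simp add: A_def adjacency_def n_def)
  have P: "A ^\<^sub>m k \<in> carrier_mat n n" using A by (rule pow_carrier_mat)
  have comm: "A ^\<^sub>m k * A = A * A ^\<^sub>m k" for k
  proof (induction k)
    case 0 thus ?case using A by auto
  next
    case (Suc k)
    have "A ^\<^sub>m Suc k * A = A * A ^\<^sub>m k * A" using Suc by simp
    also have "\<dots> = A * (A ^\<^sub>m k * A)" using A pow_carrier_mat[OF A, of k] by (intro assoc_mult_mat) auto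
    finally show ?case by simp
  qed
  have "(A ^\<^sub>m Suc k) $$ (i, j) = (\<Sum>l<n. A $$ (i, l) * (A ^\<^sub>m k) $$ (l, j))"
    unfolding pow_mat.simps comm
    using A P Suc.prems by (auto simp: n_def[symmetric] scalar_prod_def atLeast0LessThan intro!: sum.cong)
  hence "cmod ((A ^\<^sub>m Suc k) $$ (i, j)) \<le> (\<Sum>l<n. cmod (A $$ (i, l)) * cmod ((A ^\<^sub>m k) $$ (l, j)))"
    by (simp only: norm_mult[symmetric] norm_sum)
  also have "\<dots> \<le> (\<Sum>l<n. cmod (A $$ (i, l)) * plane_walks k (xs ! l) (xs ! j))"
    using Suc by (intro sum_mono mult_left_mono) (auto simp: A_def n_def)
  also have "\<dots> = (\<Sum>m<4. if lattice_step (xs ! i) m \<in> set xs then plane_walks k (lattice_step (xs ! i) m) (xs ! j) else 0)"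
    unfolding A_def n_def
    by (rule adjacency_sum[OF assms(1) Suc.prems(1), where w = "\<lambda>x. plane_walks k x (xs ! j)"])
  also have "\<dots> \<le> plane_walks (Suc k) (xs ! i) (xs ! j)"
    unfolding plane_walks_Suc by (intro sum_mono) (simp add: plane_walks_nonneg)
  finally show ?case by (simp only: A_def)
qed

text \<open>
  Walks of odd length do not close, and those of length \<open>2 n\<close> are counted by the square of a
  central binomial coefficient.
\<close>
lemma closed_walk_series_bound:
  "(\<Sum>k=1..N. (real (line_walks k 0))\<^sup>2 / (real k * 4 ^ k)) \<le> ln 4 - ln \<bb>"
proof -
  define f where "f = (\<lambda>k. (real (line_walks k 0))\<^sup>2 / (real k * 4 ^ k))"
  have odd: "f k = 0" if "odd k" for k
    using line_walks_parity[of k 0] that by (simp add: f_def)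
  have even: "f (2 * n) = (central_prob n)\<^sup>2 / (2 * real n)" for n
  proof -
    have "line_walks (2 * n) 0 = 2 * n choose n" using line_walks_binomial[of "2 * n" n] by simp
    moreover have "(4::real) ^ (2 * n) = (4 ^ n)\<^sup>2" by (simp add: power_mult[symmetric] mult.commute)
    ultimately show ?thesis by (simp add: f_def central_prob_def power_divide)
  qed
  have "(\<Sum>k=1..N. f k) \<le> (\<Sum>k=1..2*N. f k)"
    by (intro sum_mono2) (auto simp: f_def)
  also have "(\<Sum>k=1..2*N. f k) = (\<Sum>n=1..N. f (2 * n))"
  proof (induction N)
    case (Suc N)
    have "f (2 * N + 1) = 0" by (rule odd) simp
    thus ?case using Suc by simp
  qed simp
  also have "\<dots> \<le> ln 4 - ln \<bb>" unfolding even by (rule loop_series_bound)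
  finally show ?thesis by (simp add: f_def)
qed

text \<open>
  The determinant bound with \<open>d = 4\<close>. The logarithm of \<open>4 ^ n\<close> cancels against the \<open>ln 4\<close> of the
  closed-walk series, which leaves \<open>n ln \<bb>\<close>.
\<close>
theorem card_exit_rules_ge:
  assumes "finite F"
  shows "\<bb> powr real (card F) \<le> real (card (exit_rules F 4 lattice_step))"
proof -
  obtain xs where xs: "set xs = F" "distinct xs" using finite_distinct_list[OF assms] by blast
  define n where "n = length xs"
  have n: "card F = n" using xs distinct_card[of xs] by (simp add: n_def)
  define A where "A = adjacency xs"
  have A: "A \<in> carrier_mat n n" by (simp add: A_def adjacency_def n_def)
  have row: "(\<Sum>j<n. cmod (A $$ (i, j))) \<le> 4" if "i < n" for i
  proof -
    have "(\<Sum>j<n. cmod (A $$ (i, j))) = (\<Sum>m<4. if lattice_step (xs ! i) m \<in> set xs then 1 else 0)"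
      using adjacency_sum[OF xs(2), of i "\<lambda>_. 1"] that by (simp add: A_def n_def)
    also have "\<dots> \<le> (\<Sum>m<(4::nat). 1)" by (intro sum_mono) auto
    finally show ?thesis by simp
  qed
  have tr: "cmod (mat_trace (A ^\<^sub>m k)) \<le> real n * (real (line_walks k 0))\<^sup>2" for k
  proof -
    have "mat_trace (A ^\<^sub>m k) = (\<Sum>i<n. (A ^\<^sub>m k) $$ (i, i))"
      using A by (simp add: mat_trace_def)
    also have "cmod \<dots> \<le> (\<Sum>i<n. (real (line_walks k 0))\<^sup>2)"
    proof (rule sum_norm_le)
      fix i assume "i \<in> {..<n}"
      thus "cmod ((A ^\<^sub>m k) $$ (i, i)) \<le> (real (line_walks k 0))\<^sup>2"
        using adjacency_pow_le[OF xs(2), of i i k] by (simp add: A_def n_def plane_walks_def power2_eq_square)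
    qed
    finally show ?thesis by simp
  qed
  have "4 ^ n * exp (- real n * (ln 4 - ln \<bb>)) \<le> cmod (Determinant.det (of_real 4 \<cdot>\<^sub>m 1\<^sub>m n - A))"
    by (rule det_lower_bound[OF A _ row tr closed_walk_series_bound]) auto
  also have "of_real 4 \<cdot>\<^sub>m 1\<^sub>m n - A = map_mat of_int (walk_laplacian xs 4 lattice_step)"
    by (rule eq_matI) (auto simp: A_def adjacency_def walk_laplacian_def n_def)
  also have "cmod (Determinant.det (map_mat of_int (walk_laplacian xs 4 lattice_step) :: complex mat))
      = real_of_int \<bar>Determinant.det (walk_laplacian xs 4 lattice_step)\<bar>"
    by (simp only: of_int_hom.hom_det norm_of_int of_int_abs)
  also have "\<dots> \<le> real_of_int (int (card (exit_rules (set xs) 4 lattice_step)))"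
    using det_walk_laplacian_le[OF xs(2)] by (simp only: of_int_le_iff)
  finally have "4 ^ n * exp (- real n * (ln 4 - ln \<bb>)) \<le> real (card (exit_rules F 4 lattice_step))"
    using xs by simp
  moreover have "4 ^ n * exp (- real n * (ln 4 - ln \<bb>)) = \<bb> powr real n"
  proof -
    have "(4::real) ^ n = exp (real n * ln 4)"
      by (subst exp_of_nat_mult) simp
    moreover have "real n * ln 4 + - real n * (ln 4 - ln \<bb>) = real n * ln \<bb>"
      by (simp add: right_diff_distrib)
    ultimately have "4 ^ n * exp (- real n * (ln 4 - ln \<bb>)) = exp (real n * ln \<bb>)"
      by (metis exp_add)
    moreover have "\<bb> \<noteq> 0" unfolding \<bb>_def by (rule exp_not_eq_zero)
    ultimately show ?thesis unfolding powr_def by (simp only: if_False)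
  qed
  ultimately show ?thesis using n by simp
qed

section \<open>Loops, paths and trees\<close>

definition loop_edges :: "'a list \<Rightarrow> 'a set set" where
  "loop_edges \<alpha> = {{\<alpha> ! i, \<alpha> ! (Suc i mod length \<alpha>)} | i. i < length \<alpha>}"

lemma simple_closed_loop_iff:
  "simple_closed_loop G \<alpha> \<longleftrightarrow> length \<alpha> > 2 \<and> distinct \<alpha> \<and> loop_edges \<alpha> \<subseteq> edges G"
  unfolding simple_closed_loop_def loop_edges_def by blast

definition path_edges :: "'a list \<Rightarrow> 'a set set" where
  "path_edges p = {{p ! i, p ! Suc i} | i. Suc i < length p}"

lemma path_edges_Nil [simp]: "path_edges [] = {}" and path_edges_single [simp]: "path_edges [x] = {}"
  by (auto simp: path_edges_def)

lemma path_edges_Cons [simp]: "path_edges (x # y # p) = insert {x, y} (path_edges (y # p))"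
proof (rule subset_antisym; rule subsetI)
  fix e assume "e \<in> path_edges (x # y # p)"
  then obtain i where i: "Suc i < length (x # y # p)" "e = {(x # y # p) ! i, (x # y # p) ! Suc i}"
    unfolding path_edges_def by blast
  show "e \<in> insert {x, y} (path_edges (y # p))"
  proof (cases i)
    case (Suc j)
    hence "Suc j < length (y # p)" "e = {(y # p) ! j, (y # p) ! Suc j}" using i by simp_all
    thus ?thesis unfolding path_edges_def by blast
  qed (use i in simp)
next
  fix e assume "e \<in> insert {x, y} (path_edges (y # p))"
  thus "e \<in> path_edges (x # y # p)"
  proof
    assume "e = {x, y}"
    thus ?thesis unfolding path_edges_def by (intro CollectI exI[of _ 0]) simp
  next
    assume "e \<in> path_edges (y # p)"
    then obtain j where "Suc j < length (y # p)" "e = {(y # p) ! j, (y # p) ! Suc j}"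
      unfolding path_edges_def by blast
    thus ?thesis unfolding path_edges_def by (intro CollectI exI[of _ "Suc j"]) simp
  qed
qed

lemma path_edges_subset: "e \<in> path_edges p \<Longrightarrow> e \<subseteq> set p"
  unfolding path_edges_def by auto

lemma path_edges_append_subset: "path_edges q \<subseteq> path_edges (p @ q)"
proof
  fix e assume "e \<in> path_edges q"
  then obtain i where i: "Suc i < length q" "e = {q ! i, q ! Suc i}" unfolding path_edges_def by blast
  have "e = {(p @ q) ! (length p + i), (p @ q) ! Suc (length p + i)}"
    using i(2) nth_append_length_plus[of p q i] nth_append_length_plus[of p q "Suc i"] by simp
  thus "e \<in> path_edges (p @ q)" unfolding path_edges_def
    using i(1) by (intro CollectI exI[of _ "length p + i"] conjI) simp_all
qed

lemma loop_edges_eq: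
  assumes "p \<noteq> []"
  shows "loop_edges p = insert {last p, hd p} (path_edges p)"
proof (rule subset_antisym; rule subsetI)
  fix e assume "e \<in> loop_edges p"
  then obtain i where i: "i < length p" "e = {p ! i, p ! (Suc i mod length p)}"
    unfolding loop_edges_def by blast
  show "e \<in> insert {last p, hd p} (path_edges p)"
  proof (cases "Suc i = length p")
    case True
    hence "i = length p - 1" by simp
    thus ?thesis using i assms True by (simp add: last_conv_nth hd_conv_nth)
  next
    case False
    hence "Suc i < length p" using i by simp
    thus ?thesis using i unfolding path_edges_def by auto
  qed
next
  fix e assume "e \<in> insert {last p, hd p} (path_edges p)"
  thus "e \<in> loop_edges p"
  proof
    assume "e = {last p, hd p}"
    hence "e = {p ! (length p - 1), p ! (Suc (length p - 1) mod length p)}"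
      using assms by (simp add: last_conv_nth hd_conv_nth)
    moreover have "length p - 1 < length p" using assms by simp
    ultimately show ?thesis unfolding loop_edges_def by blast
  next
    assume "e \<in> path_edges p"
    then obtain i where i: "Suc i < length p" "e = {p ! i, p ! Suc i}" unfolding path_edges_def by blast
    hence "e = {p ! i, p ! (Suc i mod length p)}" "i < length p" by simp_all
    thus ?thesis unfolding loop_edges_def by blast
  qed
qed

lemma simple_path_exists:
  assumes "(a, b) \<in> {(x, y). {x, y} \<in> X}\<^sup>*"
  shows "\<exists>p. p \<noteq> [] \<and> distinct p \<and> hd p = a \<and> last p = b \<and> path_edges p \<subseteq> X"
  using assms
proof (induction rule: converse_rtrancl_induct)
  case base
  show ?case by (intro exI[of _ "[b]"]) simp
next
  case (step a c)
  then obtain p where p: "p \<noteq> []" "distinct p" "hd p = c" "last p = b" "path_edges p \<subseteq> X" by blast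
  show ?case
  proof (cases "a \<in> set p")
    case True
    then obtain us vs where uv: "p = us @ a # vs" by (auto simp: in_set_conv_decomp)
    have "path_edges (a # vs) \<subseteq> X"
      using path_edges_append_subset[of "a # vs" us] p(5) uv by (metis order_trans)
    moreover have "distinct (a # vs)" "last (a # vs) = b" using p uv by auto
    ultimately show ?thesis by (intro exI[of _ "a # vs"]) simp
  next
    case False
    obtain q where q: "p = c # q" using p by (cases p) auto
    have "path_edges (a # p) \<subseteq> X" unfolding q path_edges_Cons using p(5) step.hyps(1) q by simp
    thus ?thesis using False p by (intro exI[of _ "a # p"]) simp
  qed
qed

text \<open>
  A simple path that avoids the edge between its ends has at least three vertices and is
  closed by that edge.
\<close>
lemma loop_through_new_edge:
  assumes "(a, b) \<in> {(x, y). {x, y} \<in> X}\<^sup>*" "a \<noteq> b" "{a, b} \<notin> X"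
  shows "\<exists>\<alpha>. length \<alpha> > 2 \<and> distinct \<alpha> \<and> loop_edges \<alpha> \<subseteq> insert {a, b} X"
proof -
  obtain p where p: "p \<noteq> []" "distinct p" "hd p = a" "last p = b" "path_edges p \<subseteq> X"
    using simple_path_exists[OF assms(1)] by blast
  have "loop_edges p \<subseteq> insert {a, b} X"
    unfolding loop_edges_eq[OF p(1)] using p by (auto simp: insert_commute)
  moreover have "length p > 2"
  proof -
    obtain q where q: "p = a # q" using p by (cases p) auto
    obtain c r where r: "q = c # r" using q p(4) assms(2) by (cases q) auto
    have "r \<noteq> []" using q r p assms(3) by auto
    thus ?thesis using q r by simp
  qed
  ultimately show ?thesis using p(2) by blast
qed

text \<open>
  A spanning tree cannot be properly contained in a set of edges without loops.
\<close>
lemma connected_subset_loop_free_eq: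
  assumes con: "\<And>u v. u \<in> V \<Longrightarrow> v \<in> V \<Longrightarrow> (u, v) \<in> {(x, y). {x, y} \<in> T}\<^sup>*"
    and edge: "\<And>e. e \<in> X \<Longrightarrow> e \<subseteq> V \<and> card e = 2"
    and "T \<subseteq> X"
    and free: "\<nexists>\<alpha>. length \<alpha> > 2 \<and> distinct \<alpha> \<and> loop_edges \<alpha> \<subseteq> X"
  shows "T = X"
proof (rule ccontr)
  assume "T \<noteq> X"
  then obtain e where e: "e \<in> X" "e \<notin> T" using assms(3) by blast
  then obtain a b where ab: "e = {a, b}" "a \<noteq> b" using edge[of e] by (auto simp: card_2_iff)
  have "(a, b) \<in> {(x, y). {x, y} \<in> T}\<^sup>*" using con edge[OF e(1)] ab by simp
  from loop_through_new_edge[OF this ab(2)] e ab obtain \<alpha> where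
    "length \<alpha> > 2" "distinct \<alpha>" "loop_edges \<alpha> \<subseteq> insert {a, b} T" by blast
  moreover have "insert {a, b} T \<subseteq> X" using e(1) ab assms(3) by simp
  ultimately show False using free by (meson order_trans)
qed

text \<open>
  Joining every vertex other than \<open>r\<close> to a neighbour nearer to \<open>r\<close> gives distinct edges that
  already connect everything, so there can be no further edge.
\<close>
lemma tree_card_edges:
  assumes fin: "finite V" "r \<in> V"
    and con: "\<And>u v. u \<in> V \<Longrightarrow> v \<in> V \<Longrightarrow> (u, v) \<in> {(x, y). {x, y} \<in> X}\<^sup>*"
    and edge: "\<And>e. e \<in> X \<Longrightarrow> e \<subseteq> V \<and> card e = 2"
    and free: "\<nexists>\<alpha>. length \<alpha> > 2 \<and> distinct \<alpha> \<and> loop_edges \<alpha> \<subseteq> X"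
  shows "card X + 1 = card V"
proof -
  define R where "R = {(x, y). {x, y} \<in> X}"
  \<comment> \<open>the distance from the root\<close>
  define d where "d = (\<lambda>v. LEAST n. (v, r) \<in> R ^^ n)"
  have d: "(v, r) \<in> R ^^ d v" if v: "v \<in> V" for v
  proof -
    obtain n where "(v, r) \<in> R ^^ n"
      using rtrancl_imp_relpow[OF con[OF v fin(2)]] unfolding R_def by blast
    thus ?thesis unfolding d_def by (rule LeastI)
  qed
  have "\<exists>u. {v, u} \<in> X \<and> u \<in> V \<and> d u < d v" if v: "v \<in> V - {r}" for v
  proof -
    have "(v, r) \<in> R ^^ d v" using d v by blast
    then obtain n where n: "d v = Suc n" using v by (cases "d v") auto
    with d[of v] v have "(v, r) \<in> R ^^ Suc n" by simp
    then obtain u where u: "(v, u) \<in> R" "(u, r) \<in> R ^^ n" by (meson relpow_Suc_E2)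
    have "d u \<le> n" unfolding d_def using u(2) by (rule Least_le)
    moreover have "{v, u} \<in> X" using u(1) by (simp add: R_def)
    ultimately show ?thesis using edge[of "{v, u}"] n by auto
  qed
  then obtain par where par: "\<And>v. v \<in> V - {r} \<Longrightarrow> {v, par v} \<in> X \<and> par v \<in> V \<and> d (par v) < d v" by metis
  define T where "T = (\<lambda>v. {v, par v}) ` (V - {r})"
  have "inj_on (\<lambda>v. {v, par v}) (V - {r})"
  proof (rule inj_onI, rule ccontr)
    fix v w assume vw: "v \<in> V - {r}" "w \<in> V - {r}" "{v, par v} = {w, par w}" "v \<noteq> w"
    hence "v = par w" "w = par v" by (auto simp: doubleton_eq_iff)
    thus False using par[OF vw(1)] par[OF vw(2)] by simp
  qed
  hence card: "card T = card V - 1"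
    unfolding T_def using fin by (simp add: card_image)
  have sub: "T \<subseteq> X" using par by (auto simp: T_def)
  have root: "(v, r) \<in> {(x, y). {x, y} \<in> T}\<^sup>*" if "v \<in> V" for v
    using that
  proof (induction "d v" arbitrary: v rule: less_induct)
    case less
    show ?case
    proof (cases "v = r")
      case False
      hence v: "v \<in> V - {r}" using less.prems by simp
      have "{v, par v} \<in> T" using v by (simp add: T_def)
      moreover have "(par v, r) \<in> {(x, y). {x, y} \<in> T}\<^sup>*" using less.hyps[of "par v"] par[OF v] by simp
      ultimately show ?thesis by (intro converse_rtrancl_into_rtrancl[of v "par v"]) simp_all
    qed simp
  qed
  have "T = X"
  proof (rule connected_subset_loop_free_eq[OF _ edge sub free])
    fix u v assume uv: "u \<in> V" "v \<in> V"
    have "sym {(x, y). {x, y} \<in> T}" by (auto simp: sym_def insert_commute)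
    hence "(r, v) \<in> {(x, y). {x, y} \<in> T}\<^sup>*" using root[OF uv(2)] by (meson sym_rtrancl symE)
    thus "(u, v) \<in> {(x, y). {x, y} \<in> T}\<^sup>*" using root[OF uv(1)] by (rule rtrancl_trans[rotated])
  qed
  moreover have "card V > 0" using fin by (auto simp: card_gt_0_iff)
  ultimately show ?thesis using card by simp
qed

text \<open>
  An end of a longest path has a second edge, which must lead back to the path.
\<close>
lemma loop_of_min_degree_2:
  assumes fin: "finite X" and ne: "X \<noteq> {}" and edge: "\<And>e. e \<in> X \<Longrightarrow> card e = 2"
    and deg: "\<And>v e. e \<in> X \<Longrightarrow> v \<in> e \<Longrightarrow> \<exists>e'\<in>X. e' \<noteq> e \<and> v \<in> e'"
  shows "\<exists>\<alpha>. length \<alpha> > 2 \<and> distinct \<alpha> \<and> loop_edges \<alpha> \<subseteq> X"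
proof -
  define P where "P = (\<lambda>p. length p \<ge> 2 \<and> distinct p \<and> path_edges p \<subseteq> X)"
  have finU: "finite (\<Union>X)" 
  proof (rule finite_Union[OF fin])
    fix e assume "e \<in> X"
    thus "finite e" using edge[of e] card.infinite[of e] by (cases "finite e") simp_all
  qed
  have bound: "length p \<le> card (\<Union>X)" if "P p" for p
  proof -
    have "set p \<subseteq> \<Union>X"
    proof
      fix v assume "v \<in> set p"
      then obtain i where i: "i < length p" "v = p ! i" by (auto simp: in_set_conv_nth)
      show "v \<in> \<Union>X"
      proof (cases "Suc i < length p")
        case True
        hence "{p ! i, p ! Suc i} \<in> X" using that unfolding P_def path_edges_def by blast
        thus ?thesis using i by blast
      next
        case False
        hence "i \<noteq> 0" using that unfolding P_def by linarith
        then obtain j where j: "i = Suc j" "Suc j < length p" using i by (cases i) simp_all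
        hence "{p ! j, p ! Suc j} \<in> X" using that unfolding P_def path_edges_def by blast
        thus ?thesis using i j by blast
      qed
    qed
    hence "card (set p) \<le> card (\<Union>X)" by (rule card_mono[OF finU])
    moreover have "card (set p) = length p" using that unfolding P_def by (intro distinct_card) simp
    ultimately show ?thesis by simp
  qed
  obtain e0 where "e0 \<in> X" using ne by blast
  then obtain a b where "e0 = {a, b}" "a \<noteq> b" using edge by (metis card_2_iff)
  hence "P [a, b]" using \<open>e0 \<in> X\<close> by (simp add: P_def)
  have "\<exists>p. P p \<and> (\<forall>q. P q \<longrightarrow> length q \<le> length p)"
    using bound by (intro ex_has_greatest_nat[of P "[a, b]" length "Suc (card (\<Union>X))", OF \<open>P [a, b]\<close>])
      (simp add: less_Suc_eq_le)
  then obtain p where p: "P p" and max: "\<And>q. P q \<Longrightarrow> length q \<le> length p" by blast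
  have len: "length p \<ge> 2" and dist: "distinct p" and pe: "path_edges p \<subseteq> X" using p by (auto simp: P_def)
  obtain x q0 where q0: "p = x # q0" using len by (cases p) auto
  obtain y q where q: "p = x # y # q" using len q0 by (cases q0) auto
  have "{x, y} \<in> X" using pe q by simp
  then obtain e' where e': "e' \<in> X" "e' \<noteq> {x, y}" "x \<in> e'" using deg[of "{x, y}" x] by blast
  obtain z where z: "e' = {x, z}" "z \<noteq> x" 
  proof -
    obtain u w where uw: "e' = {u, w}" "u \<noteq> w" using edge[OF e'(1)] unfolding card_2_iff by blast
    hence "x = u \<or> x = w" using e'(3) by blast
    thus ?thesis using that uw by (metis insert_commute)
  qed
  have "z \<noteq> y" using e' z by blast
  have "z \<in> set p"
  proof (rule ccontr)
    assume "z \<notin> set p"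
    moreover have "{z, x} \<in> X" using e'(1) z(1) by (simp add: insert_commute)
    ultimately have "P (z # p)" using p unfolding P_def q path_edges_Cons[of z x] by simp
    from max[OF this] show False by simp
  qed
  then obtain k where k: "k < length p" "p ! k = z" by (auto simp: in_set_conv_nth)
  have k2: "k \<ge> 2"
  proof (rule ccontr)
    assume "\<not> 2 \<le> k"
    hence "k = 0 \<or> k = 1" by auto
    thus False using k z \<open>z \<noteq> y\<close> q by auto
  qed
  define \<alpha> where "\<alpha> = take (Suc k) p"
  have l: "length \<alpha> = Suc k" using k by (simp add: \<alpha>_def)
  have "path_edges \<alpha> \<subseteq> path_edges p"
  proof
    fix e assume "e \<in> path_edges \<alpha>"
    then obtain i where "Suc i < length \<alpha>" "e = {\<alpha> ! i, \<alpha> ! Suc i}" unfolding path_edges_def by blast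
    hence "Suc i < length p" "e = {p ! i, p ! Suc i}" using l k by (simp_all add: \<alpha>_def)
    thus "e \<in> path_edges p" unfolding path_edges_def by blast
  qed
  moreover have "last \<alpha> = z" using k by (simp add: \<alpha>_def take_Suc_conv_app_nth)
  moreover have "hd \<alpha> = x" using q by (simp add: \<alpha>_def)
  moreover have "\<alpha> \<noteq> []" using l by auto
  ultimately have "loop_edges \<alpha> \<subseteq> X"
    using loop_edges_eq[of \<alpha>] pe e'(1) z(1) insert_commute[of x z "{}"] by (metis insert_subset order_trans)
  moreover have "distinct \<alpha>" using dist by (simp add: \<alpha>_def)
  ultimately show ?thesis using l k2 by (intro exI[of _ \<alpha>]) simp
qed

lemma card_loop_edges:
  assumes "length \<alpha> > 2" "distinct \<alpha>"
  shows "card (loop_edges \<alpha>) = length \<alpha>"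
proof -
  define n where "n = length \<alpha>"
  have n: "n > 2" using assms n_def by simp
  have "inj_on (\<lambda>i. {\<alpha> ! i, \<alpha> ! (Suc i mod n)}) {..<n}"
  proof (rule inj_onI, rule ccontr)
    fix i j assume ij: "i \<in> {..<n}" "j \<in> {..<n}" "{\<alpha> ! i, \<alpha> ! (Suc i mod n)} = {\<alpha> ! j, \<alpha> ! (Suc j mod n)}" "i \<noteq> j"
    have eq: "\<alpha> ! a = \<alpha> ! b \<longleftrightarrow> a = b" if "a < n" "b < n" for a b
      using assms(2) that by (simp add: n_def nth_eq_iff_index_eq)
    have lt: "Suc i mod n < n" "Suc j mod n < n" "i < n" "j < n" using n ij(1,2) by simp_all
    have "\<alpha> ! i \<noteq> \<alpha> ! j" using eq[OF lt(3,4)] ij(4) by simp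
    hence "\<alpha> ! i = \<alpha> ! (Suc j mod n)" "\<alpha> ! (Suc i mod n) = \<alpha> ! j"
      using ij(3) unfolding doubleton_eq_iff by blast+
    hence cyc: "i = Suc j mod n" "Suc i mod n = j"
      using eq[OF lt(3,2)] eq[OF lt(1,4)] by blast+
    have "Suc a mod n = (if Suc a = n then 0 else Suc a)" if "a < n" for a using that by simp
    from this[OF lt(3)] this[OF lt(4)] show False using cyc lt(3,4) n by (simp split: if_splits)
  qed
  moreover have "loop_edges \<alpha> = (\<lambda>i. {\<alpha> ! i, \<alpha> ! (Suc i mod n)}) ` {..<n}"
    unfolding loop_edges_def n_def by blast
  ultimately show ?thesis by (simp add: card_image n_def)
qed

section \<open>Planar duality\<close>

text \<open>
  The lattice edge between a face and its neighbour in a given direction. The face \<open>(x, y)\<close> is the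
  unit square with bottom-right corner \<open>(x, y)\<close>.
\<close>
fun face_side :: "int \<times> int \<Rightarrow> nat \<Rightarrow> (int \<times> int) set" where
  "face_side (x, y) k =
     (if k = 0 then {(x, y), (x, y + 1)} else if k = 1 then {(x - 1, y), (x - 1, y + 1)}
      else if k = 2 then {(x - 1, y + 1), (x, y + 1)} else {(x - 1, y), (x, y)})"

definition opposite :: "nat \<Rightarrow> nat" where
  "opposite k = (if k = 0 then 1 else if k = 1 then 0 else if k = 2 then 3 else 2)"

lemma less_4_cases: "k < (4::nat) \<Longrightarrow> k = 0 \<or> k = 1 \<or> k = 2 \<or> k = 3"
  by linarith

lemma opposite_less: "opposite k < 4"
  by (simp add: opposite_def)

lemma lattice_step_opposite: "k < 4 \<Longrightarrow> lattice_step (lattice_step f k) (opposite k) = f"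
  by (drule less_4_cases) (cases f; auto simp: opposite_def)

lemma face_side_opposite: "k < 4 \<Longrightarrow> face_side (lattice_step f k) (opposite k) = face_side f k"
  by (drule less_4_cases) (cases f; auto simp: opposite_def)

lemma lattice_step_neq: "lattice_step f k \<noteq> f"
  by (cases f) auto

lemma card_face_side: "card (face_side f k) = 2"
  by (cases f) auto

text \<open>
  Every edge separates exactly two faces.
\<close>
lemma face_side_eq_iff:
  assumes "k < 4" "l < 4"
  shows "face_side f k = face_side g l \<longleftrightarrow> (g = f \<and> l = k) \<or> (g = lattice_step f k \<and> l = opposite k)"
proof -
  obtain a b where f: "f = (a, b)" by fastforce
  obtain c d where g: "g = (c, d)" by fastforce
  show ?thesis using less_4_cases[OF assms(1)] less_4_cases[OF assms(2)] unfolding f g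
    by (elim disjE) (simp_all add: opposite_def doubleton_eq_iff, arith+)
qed

declare face_side.simps [simp del] lattice_step.simps [simp del]

definition region_edges :: "(int \<times> int) set \<Rightarrow> (int \<times> int) set set" where
  "region_edges F = {face_side f k | f k. f \<in> F \<and> k < 4}"

definition crossed :: "(int \<times> int) set \<Rightarrow> (int \<times> int \<Rightarrow> nat) \<Rightarrow> (int \<times> int) set set" where
  "crossed F \<psi> = (\<lambda>f. face_side f (\<psi> f)) ` F"

abbreviation rule_step :: "(int \<times> int \<Rightarrow> nat) \<Rightarrow> int \<times> int \<Rightarrow> int \<times> int" where
  "rule_step \<psi> f \<equiv> lattice_step f (\<psi> f)"

lemma exit_rulesD:
  assumes "\<psi> \<in> exit_rules F 4 lattice_step" "f \<in> F"
  shows "\<psi> f < 4" "leaves F (rule_step \<psi>) f"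
  using assms unfolding exit_rules_def by auto

text \<open>
  Two faces that point at each other would be trapped.
\<close>
lemma exit_rules_no_2cycle:
  assumes "\<psi> \<in> exit_rules F 4 lattice_step" "f \<in> F" "lattice_step f (\<psi> f) \<in> F"
  shows "\<psi> (lattice_step f (\<psi> f)) \<noteq> opposite (\<psi> f)"
proof
  assume "\<psi> (lattice_step f (\<psi> f)) = opposite (\<psi> f)"
  hence "(rule_step \<psi> ^^ Suc 1) f = f"
    using lattice_step_opposite[OF exit_rulesD(1)[OF assms(1,2)]] by simp
  from leaves_no_cycle[OF exit_rulesD(2)[OF assms(1,2)] this]
  obtain l where "l \<le> 1" "(rule_step \<psi> ^^ l) f \<notin> F" by blast
  thus False using assms(2,3) by (cases "l = 0") (auto simp: le_Suc_eq)
qed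

lemma inj_on_crossed:
  assumes "\<psi> \<in> exit_rules F 4 lattice_step"
  shows "inj_on (\<lambda>f. face_side f (\<psi> f)) F"
proof (rule inj_onI, rule ccontr)
  fix f g assume fg: "f \<in> F" "g \<in> F" "face_side f (\<psi> f) = face_side g (\<psi> g)" "f \<noteq> g"
  hence "g = lattice_step f (\<psi> f)" "\<psi> g = opposite (\<psi> f)"
    using face_side_eq_iff[of "\<psi> f" "\<psi> g" f g] exit_rulesD(1)[OF assms] by auto
  thus False using exit_rules_no_2cycle[OF assms fg(1)] fg(2) by simp
qed

lemma card_crossed: "\<psi> \<in> exit_rules F 4 lattice_step \<Longrightarrow> card (crossed F \<psi>) = card F"
  unfolding crossed_def by (rule card_image) (rule inj_on_crossed)

lemma crossed_subset: "\<psi> \<in> exit_rules F 4 lattice_step \<Longrightarrow> crossed F \<psi> \<subseteq> region_edges F"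
  unfolding crossed_def region_edges_def using exit_rulesD(1) by fastforce

text \<open>
  The crossed edges form a tree of faces rooted outside, and its orientation towards the root
  is determined: where two rules cross the same edges but differ at a face, they also
  differ at the next face of the trajectory, which is therefore still inside.
\<close>
lemma crossed_inj:
  assumes \<psi>: "\<psi> \<in> exit_rules F 4 lattice_step" and \<phi>: "\<phi> \<in> exit_rules F 4 lattice_step"
    and eq: "crossed F \<psi> = crossed F \<phi>"
  shows "\<psi> = \<phi>"
proof -
  have step: "rule_step \<psi> f \<in> F \<and> \<psi> (rule_step \<psi> f) \<noteq> \<phi> (rule_step \<psi> f)" if f: "f \<in> F" "\<psi> f \<noteq> \<phi> f" for f
  proof -
    have "face_side f (\<psi> f) \<in> crossed F \<phi>" using f eq by (auto simp: crossed_def)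
    then obtain g where g: "g \<in> F" "face_side f (\<psi> f) = face_side g (\<phi> g)" by (auto simp: crossed_def)
    hence "g = rule_step \<psi> f" "\<phi> g = opposite (\<psi> f)"
      using face_side_eq_iff[of "\<psi> f" "\<phi> g" f g] exit_rulesD(1)[OF \<psi> f(1)] exit_rulesD(1)[OF \<phi> g(1)] f(2) by auto
    thus ?thesis using g(1) exit_rules_no_2cycle[OF \<psi> f(1)] by auto
  qed
  have "\<psi> f = \<phi> f" if f: "f \<in> F" for f
  proof (rule ccontr)
    assume ne: "\<psi> f \<noteq> \<phi> f"
    have "(rule_step \<psi> ^^ k) f \<in> F \<and> \<psi> ((rule_step \<psi> ^^ k) f) \<noteq> \<phi> ((rule_step \<psi> ^^ k) f)" for k
    proof (induction k)
      case 0 thus ?case using f ne by simp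
    next
      case (Suc k) thus ?case using step[of "(rule_step \<psi> ^^ k) f"] by simp
    qed
    thus False using exit_rulesD(2)[OF \<psi> f] by (auto simp: leaves_def)
  qed
  moreover have "\<psi> \<in> F \<rightarrow>\<^sub>E {..<4}" "\<phi> \<in> F \<rightarrow>\<^sub>E {..<4}"
    using \<psi> \<phi> unfolding exit_rules_def by blast+
  ultimately show ?thesis by (intro PiE_ext) auto
qed

lemma face_side_corner:
  assumes "k < 4" "(a, b) \<in> face_side f k"
  shows "k = 0 \<and> f = (a, b) \<or> k = 0 \<and> f = (a, b - 1) \<or> k = 1 \<and> f = (a + 1, b) \<or> k = 1 \<and> f = (a + 1, b - 1) \<or>
    k = 2 \<and> f = (a + 1, b - 1) \<or> k = 2 \<and> f = (a, b - 1) \<or> k = 3 \<and> f = (a + 1, b) \<or> k = 3 \<and> f = (a, b)"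
proof -
  obtain x y where f: "f = (x, y)" by fastforce
  from less_4_cases[OF assms(1)] assms(2) show ?thesis
    unfolding f by (elim disjE) (simp_all add: face_side.simps, linarith+)
qed

text \<open>
  Going round a vertex, one changes between the selected and the other faces an even
  number of times.
\<close>
lemma corner_parity:
  fixes sel :: "int \<times> int \<Rightarrow> bool"
  assumes e: "e = face_side f k" "k < 4" and sel: "sel f \<noteq> sel (lattice_step f k)" and v: "v \<in> e"
  shows "\<exists>g l. l < 4 \<and> sel g \<noteq> sel (lattice_step g l) \<and> face_side g l \<noteq> e \<and> v \<in> face_side g l"
proof -
  obtain a b where ab: "v = (a, b)" by fastforce
  define A where "A = (\<lambda>g l. l < 4 \<and> sel g \<noteq> sel (lattice_step g l) \<and> face_side g l \<noteq> e \<and> (a, b) \<in> face_side g l)"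
  have s: "face_side (a, b) 0 = {(a, b), (a, b + 1)}" "face_side (a + 1, b) 3 = {(a, b), (a + 1, b)}"
    "face_side (a, b - 1) 0 = {(a, b - 1), (a, b)}" "face_side (a, b) 3 = {(a - 1, b), (a, b)}"
    "lattice_step (a, b) 0 = (a + 1, b)" "lattice_step (a + 1, b) 3 = (a + 1, b - 1)"
    "lattice_step (a, b - 1) 0 = (a + 1, b - 1)" "lattice_step (a, b) 3 = (a, b - 1)"
    by (simp_all add: face_side.simps lattice_step.simps)
  have up: "A (a, b) 0" if "sel (a, b) \<noteq> sel (a + 1, b)" "e \<noteq> {(a, b), (a, b + 1)}"
    using that unfolding A_def s by simp
  have right: "A (a + 1, b) 3" if "sel (a + 1, b) \<noteq> sel (a + 1, b - 1)" "e \<noteq> {(a, b), (a + 1, b)}"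
    using that unfolding A_def s by simp
  have down: "A (a, b - 1) 0" if "sel (a, b - 1) \<noteq> sel (a + 1, b - 1)" "e \<noteq> {(a, b - 1), (a, b)}"
    using that unfolding A_def s by simp
  have left: "A (a, b) 3" if "sel (a, b) \<noteq> sel (a, b - 1)" "e \<noteq> {(a - 1, b), (a, b)}"
    using that unfolding A_def s by simp
  have "(a, b) \<in> face_side f k" using v e(1) ab by simp
  from face_side_corner[OF e(2) this]
  have cases: "(e = {(a, b), (a, b + 1)} \<and> sel (a, b) \<noteq> sel (a + 1, b)) \<or>
     (e = {(a, b), (a + 1, b)} \<and> sel (a + 1, b) \<noteq> sel (a + 1, b - 1)) \<or>
     (e = {(a, b - 1), (a, b)} \<and> sel (a, b - 1) \<noteq> sel (a + 1, b - 1)) \<or>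
     (e = {(a - 1, b), (a, b)} \<and> sel (a, b) \<noteq> sel (a, b - 1))"
    using e(1) sel
    by (elim disjE conjE; simp only: face_side.simps lattice_step.simps; simp; fail)
  have ne: "{(a, b), (a, b + 1)} \<noteq> {(a, b), (a + 1, b)}" "{(a, b), (a, b + 1)} \<noteq> {(a, b - 1), (a, b)}"
    "{(a, b), (a, b + 1)} \<noteq> {(a - 1, b), (a, b)}" "{(a, b), (a + 1, b)} \<noteq> {(a, b - 1), (a, b)}"
    "{(a, b), (a + 1, b)} \<noteq> {(a - 1, b), (a, b)}" "{(a, b - 1), (a, b)} \<noteq> {(a - 1, b), (a, b)}"
    by (simp_all add: doubleton_eq_iff)
  have "\<exists>g l. A g l" using cases
  proof (elim disjE conjE)
    assume e: "e = {(a, b), (a, b + 1)}" and "sel (a, b) \<noteq> sel (a + 1, b)"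
    have ne_e: "e \<noteq> {(a, b), (a + 1, b)}" "e \<noteq> {(a, b - 1), (a, b)}" "e \<noteq> {(a - 1, b), (a, b)}"
      unfolding e by (rule ne ne[THEN not_sym])+
    have "sel (a + 1, b) \<noteq> sel (a + 1, b - 1) \<or> sel (a, b - 1) \<noteq> sel (a + 1, b - 1) \<or> sel (a, b) \<noteq> sel (a, b - 1)"
      using \<open>sel (a, b) \<noteq> sel (a + 1, b)\<close> by argo
    thus ?thesis
      by (elim disjE) (rule exI, rule exI, erule up right down left, rule ne_e)+
  next
    assume e: "e = {(a, b), (a + 1, b)}" and "sel (a + 1, b) \<noteq> sel (a + 1, b - 1)"
    have ne_e: "e \<noteq> {(a, b), (a, b + 1)}" "e \<noteq> {(a, b - 1), (a, b)}" "e \<noteq> {(a - 1, b), (a, b)}"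
      unfolding e by (rule ne ne[THEN not_sym])+
    have "sel (a, b) \<noteq> sel (a + 1, b) \<or> sel (a, b - 1) \<noteq> sel (a + 1, b - 1) \<or> sel (a, b) \<noteq> sel (a, b - 1)"
      using \<open>sel (a + 1, b) \<noteq> sel (a + 1, b - 1)\<close> by argo
    thus ?thesis
      by (elim disjE) (rule exI, rule exI, erule up right down left, rule ne_e)+
  next
    assume e: "e = {(a, b - 1), (a, b)}" and "sel (a, b - 1) \<noteq> sel (a + 1, b - 1)"
    have ne_e: "e \<noteq> {(a, b), (a, b + 1)}" "e \<noteq> {(a, b), (a + 1, b)}" "e \<noteq> {(a - 1, b), (a, b)}"
      unfolding e by (rule ne ne[THEN not_sym])+
    have "sel (a, b) \<noteq> sel (a + 1, b) \<or> sel (a + 1, b) \<noteq> sel (a + 1, b - 1) \<or> sel (a, b) \<noteq> sel (a, b - 1)"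
      using \<open>sel (a, b - 1) \<noteq> sel (a + 1, b - 1)\<close> by argo
    thus ?thesis
      by (elim disjE) (rule exI, rule exI, erule up right down left, rule ne_e)+
  next
    assume e: "e = {(a - 1, b), (a, b)}" and "sel (a, b) \<noteq> sel (a, b - 1)"
    have ne_e: "e \<noteq> {(a, b), (a, b + 1)}" "e \<noteq> {(a, b), (a + 1, b)}" "e \<noteq> {(a, b - 1), (a, b)}"
      unfolding e by (rule ne ne[THEN not_sym])+
    have "sel (a, b) \<noteq> sel (a + 1, b) \<or> sel (a + 1, b) \<noteq> sel (a + 1, b - 1) \<or> sel (a, b - 1) \<noteq> sel (a + 1, b - 1)"
      using \<open>sel (a, b) \<noteq> sel (a, b - 1)\<close> by argo
    thus ?thesis
      by (elim disjE) (rule exI, rule exI, erule up right down left, rule ne_e)+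
  qed
  thus ?thesis unfolding A_def ab .
qed

text \<open>
  Dually, going round a face, one enters and leaves a set \<open>U\<close> of vertices equally often.
\<close>
lemma side_parity:
  assumes "k < 4" "face_side f k = {u, v}" "u \<in> U" "v \<notin> U"
  shows "\<exists>l<4. l \<noteq> k \<and> (\<exists>u v. face_side f l = {u, v} \<and> u \<in> U \<and> v \<notin> U)"
proof -
  obtain x y where f: "f = (x, y)" by fastforce
  define a and b and c and d where abcd: "a = (x, y)" "b = (x - 1, y)" "c = (x, y + 1)" "d = (x - 1, y + 1)"
  have s: "face_side f 0 = {a, c}" "face_side f 1 = {b, d}" "face_side f 2 = {d, c}" "face_side f 3 = {b, a}"
    by (simp_all add: f abcd face_side.simps)
  define D where "D = (\<lambda>l. \<exists>u v. face_side f l = {u, v} \<and> u \<in> U \<and> v \<notin> U)"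
  have D: "D l \<longleftrightarrow> (p \<in> U) \<noteq> (q \<in> U)" if "face_side f l = {p, q}" for l p q
    unfolding D_def that doubleton_eq_iff by blast
  have "D k" using assms unfolding D_def by blast
  note Ds = D[OF s(1)] D[OF s(2)] D[OF s(3)] D[OF s(4)]
  have x: "D 0 \<Longrightarrow> D 1 \<or> D 2 \<or> D 3" "D 1 \<Longrightarrow> D 0 \<or> D 2 \<or> D 3"
    "D 2 \<Longrightarrow> D 0 \<or> D 1 \<or> D 3" "D 3 \<Longrightarrow> D 0 \<or> D 1 \<or> D 2"
    unfolding Ds by blast+
  have "\<exists>l\<in>{0,1,2,3}. l \<noteq> k \<and> D l"
    using less_4_cases[OF assms(1)]
  proof (elim disjE)
    assume "k = 0" with x(1) \<open>D k\<close> show ?thesis by auto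
  next
    assume "k = 1" with x(2) \<open>D k\<close> show ?thesis by auto
  next
    assume "k = 2" with x(3) \<open>D k\<close> show ?thesis by auto
  next
    assume "k = 3" with x(4) \<open>D k\<close> show ?thesis by auto
  qed
  then obtain l where "l \<in> {0,1,2,3}" "l \<noteq> k" "D l" by blast
  moreover from this(1) have "l < 4" by auto
  ultimately show ?thesis unfolding D_def by blast
qed

text \<open>
  Suppose the uncrossed edges do not connect \<open>u\<close> and \<open>v\<close>, and let \<open>U\<close> be the part reachable from \<open>u\<close>.
  All edges leaving \<open>U\<close> are crossed. Among the faces that cross one of them take the one whose
  exit takes longest. By parity it has another side in the cut; that side is crossed from
  the neighbour, which needs one more step to leave.
\<close>
lemma uncrossed_connected:
  assumes fin: "finite F" and \<psi>: "\<psi> \<in> exit_rules F 4 lattice_step"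
    and con: "\<And>u v. u \<in> V \<Longrightarrow> v \<in> V \<Longrightarrow> (u, v) \<in> {(x, y). {x, y} \<in> region_edges F}\<^sup>*"
    and uv: "u \<in> V" "v \<in> V"
  shows "(u, v) \<in> {(x, y). {x, y} \<in> region_edges F - crossed F \<psi>}\<^sup>*"
proof (rule ccontr)
  let ?R = "{(x, y). {x, y} \<in> region_edges F - crossed F \<psi>}\<^sup>*"
  assume no: "(u, v) \<notin> ?R"
  define U where "U = {w. (u, w) \<in> ?R}"
  define cut where "cut = (\<lambda>e. \<exists>p q. e = {p, q} \<and> p \<in> U \<and> q \<notin> U)"
  have cut_crossed: "e \<in> crossed F \<psi>" if "e \<in> region_edges F" "cut e" for e
  proof (rule ccontr)
    assume n: "e \<notin> crossed F \<psi>"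
    obtain p q where pq: "e = {p, q}" "p \<in> U" "q \<notin> U" using \<open>cut e\<close> unfolding cut_def by blast
    have "(p, q) \<in> {(x, y). {x, y} \<in> region_edges F - crossed F \<psi>}" using n that(1) pq(1) by simp
    hence "q \<in> U" using pq(2) unfolding U_def by (simp add: rtrancl.rtrancl_into_rtrancl)
    thus False using pq(3) by simp
  qed
  have "\<exists>e\<in>region_edges F. cut e"
  proof (rule ccontr)
    assume nc: "\<not> (\<exists>e\<in>region_edges F. cut e)"
    have "w \<in> U" if "(u, w) \<in> {(x, y). {x, y} \<in> region_edges F}\<^sup>*" for w
      using that
    proof (induction rule: rtrancl_induct)
      case base show ?case by (simp add: U_def)
    next
      case (step p q)
      hence "{p, q} \<in> region_edges F" by simp
      thus ?case using nc step.IH unfolding cut_def by blast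
    qed
    from this[OF con[OF uv]] show False using no by (simp add: U_def)
  qed
  then obtain e where e: "e \<in> region_edges F" "cut e" by blast
  define Z where "Z = {f \<in> F. cut (face_side f (\<psi> f))}"
  \<comment> \<open>the number of steps to the exit\<close>
  define t where "t = (\<lambda>f. LEAST k. (rule_step \<psi> ^^ k) f \<notin> F)"
  have "Z \<noteq> {}" using cut_crossed[OF e] e(2) by (auto simp: crossed_def Z_def)
  moreover have "finite Z" using fin by (simp add: Z_def)
  ultimately have "Max (t ` Z) \<in> t ` Z" by (intro Max_in) auto
  then obtain f where f: "f \<in> Z" "Max (t ` Z) = t f" by auto
  have fF: "f \<in> F" and fc: "cut (face_side f (\<psi> f))" using f(1) by (auto simp: Z_def)
  have f4: "\<psi> f < 4" using exit_rulesD(1)[OF \<psi> fF] .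
  obtain p q where pq: "face_side f (\<psi> f) = {p, q}" "p \<in> U" "q \<notin> U" using fc unfolding cut_def by blast
  obtain l where l: "l < 4" "l \<noteq> \<psi> f" "cut (face_side f l)"
    using side_parity[OF f4 pq] unfolding cut_def by blast
  have "face_side f l \<in> region_edges F" using fF l(1) unfolding region_edges_def by blast
  from cut_crossed[OF this l(3)] obtain g where g: "g \<in> F" "face_side f l = face_side g (\<psi> g)"
    unfolding crossed_def by blast
  have g4: "\<psi> g < 4" using exit_rulesD(1)[OF \<psi> g(1)] .
  have "g = lattice_step f l" "\<psi> g = opposite l"
    using face_side_eq_iff[OF l(1) g4, of f g] g(2) l(2) by auto
  hence gf: "rule_step \<psi> g = f" using lattice_step_opposite[OF l(1)] by simp
  have "g \<in> Z" using g l(3) by (simp add: Z_def)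
  hence "t g \<le> t f" using f(2) \<open>finite Z\<close> Max_ge[of "t ` Z" "t g"] by simp
  moreover have "t f < t g"
  proof -
    have "\<exists>k. (rule_step \<psi> ^^ k) g \<notin> F" using exit_rulesD(2)[OF \<psi> g(1)] by (simp add: leaves_def)
    hence tg: "(rule_step \<psi> ^^ t g) g \<notin> F" unfolding t_def by (rule LeastI_ex)
    hence "t g \<noteq> 0" using g(1) by (intro notI) simp
    then obtain k where k: "t g = Suc k" by (cases "t g") auto
    have "(rule_step \<psi> ^^ Suc k) g = (rule_step \<psi> ^^ k) (rule_step \<psi> g)"
      by (simp only: funpow_Suc_right o_apply)
    hence "(rule_step \<psi> ^^ k) f \<notin> F" using tg gf k by (simp only: not_False_eq_True)
    hence "t f \<le> k" unfolding t_def by (rule Least_le)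
    thus ?thesis using k by simp
  qed
  ultimately show False by simp
qed

text \<open>
  The faces \<open>S\<close> that cannot get out without crossing \<open>T\<close> are separated from all others by edges of
  \<open>T\<close>. If there were any, these edges would have even degree at each vertex, so \<open>T\<close> would contain a
  loop. Hence all faces get out, and each of them may choose the first step of a shortest way.
\<close>
lemma exit_rule_avoiding_tree:
  assumes fin: "finite F"
    and free: "\<nexists>\<alpha>. length \<alpha> > 2 \<and> distinct \<alpha> \<and> loop_edges \<alpha> \<subseteq> T"
  shows "\<exists>\<psi>\<in>exit_rules F 4 lattice_step. crossed F \<psi> \<inter> T = {}"
proof -
  \<comment> \<open>\<open>reach n f\<close>: one can go from \<open>f\<close> to a face outside \<open>F\<close> in \<open>n\<close> steps across edges not in \<open>T\<close>\<close>
  define reach where "reach = rec_nat (\<lambda>f. f \<notin> F) (\<lambda>_ R f. \<exists>k<4. face_side f k \<notin> T \<and> R (lattice_step f k))"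
  have r0: "reach 0 f \<longleftrightarrow> f \<notin> F" for f by (simp add: reach_def)
  have rS: "reach (Suc n) f \<longleftrightarrow> (\<exists>k<4. face_side f k \<notin> T \<and> reach n (lattice_step f k))" for n f
    by (simp add: reach_def)
  define S where "S = {f. \<nexists>n. reach n f}"
  have SF: "S \<subseteq> F" using r0 by (auto simp: S_def)
  hence finS: "finite S" using fin by (rule finite_subset)
  have edge: "face_side f k \<in> T" if fk: "k < 4" "f \<in> S" "lattice_step f k \<notin> S" for f k
  proof (rule ccontr)
    assume "face_side f k \<notin> T"
    moreover obtain n where "reach n (lattice_step f k)" using fk(3) by (auto simp: S_def)
    ultimately have "reach (Suc n) f" using rS fk(1) by blast
    thus False using fk(2) by (auto simp: S_def)
  qed
  have "S = {}"
  proof (rule ccontr)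
    assume ne: "S \<noteq> {}"
    define chg where "chg = (\<lambda>f k. (f \<in> S) \<noteq> (lattice_step f k \<in> S))"
    have chg: "lattice_step f k \<in> S" if "chg f k" "f \<notin> S" for f k using that by (simp add: chg_def)
    have chg': "lattice_step f k \<notin> S" if "chg f k" "f \<in> S" for f k using that by (simp add: chg_def)
    define B where "B = {face_side f k | f k. k < 4 \<and> chg f k}"
    have BT: "B \<subseteq> T"
    proof
      fix e assume "e \<in> B"
      then obtain f k where fk: "e = face_side f k" "k < 4" "chg f k"
        unfolding B_def by blast
      show "e \<in> T"
      proof (cases "f \<in> S")
        case True thus ?thesis using edge[OF fk(2) True chg'[OF fk(3) True]] fk(1) by simp
      next
        case False
        hence "lattice_step f k \<in> S" using chg fk(3) by blast
        from edge[OF opposite_less this, of k] show ?thesis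
          using fk False lattice_step_opposite face_side_opposite by simp
      qed
    qed
    have "B \<subseteq> region_edges F"
    proof
      fix e assume "e \<in> B"
      then obtain f k where fk: "e = face_side f k" "k < 4" "chg f k"
        unfolding B_def by blast
      show "e \<in> region_edges F"
      proof (cases "f \<in> S")
        case True thus ?thesis using fk SF unfolding region_edges_def by blast
      next
        case False
        hence "lattice_step f k \<in> F" using chg fk(3) SF by blast
        thus ?thesis using fk face_side_opposite[OF fk(2), of f] opposite_less[of k]
          unfolding region_edges_def by blast
      qed
    qed
    moreover have "region_edges F = (\<lambda>(f, k). face_side f k) ` (F \<times> {..<4})"
      by (auto simp: region_edges_def image_iff Bex_def lessThan_iff)
    moreover have "finite ((\<lambda>(f, k). face_side f k) ` (F \<times> {..<4::nat}))" using fin by (intro finite_imageI finite_SigmaI) simp_all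
    ultimately have finB: "finite B" by (simp only: finite_subset)
    have "B \<noteq> {}"
    proof -
      have "Max (fst ` S) \<in> fst ` S" using finS ne by (intro Max_in) auto
      then obtain x y where xy: "(x, y) \<in> S" "Max (fst ` S) = x" by auto
      have "lattice_step (x, y) 0 \<notin> S"
      proof
        assume "lattice_step (x, y) 0 \<in> S"
        hence "(x + 1, y) \<in> S" by (simp add: lattice_step.simps)
        hence "x + 1 \<in> fst ` S" by force
        hence "x + 1 \<le> x" using xy(2) finS Max_ge[of "fst ` S" "x + 1"] by simp
        thus False by simp
      qed
      hence "chg (x, y) 0" using xy(1) by (simp add: chg_def)
      hence "face_side (x, y) 0 \<in> B" unfolding B_def using zero_less_numeral by blast
      thus ?thesis by blast
    qed
    moreover have "card e = 2" if "e \<in> B" for e using that card_face_side unfolding B_def by blast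
    moreover have "\<exists>e'\<in>B. e' \<noteq> e \<and> v \<in> e'" if e: "e \<in> B" "v \<in> e" for v e
    proof -
      obtain f k where fk: "e = face_side f k" "k < 4" "chg f k"
        using e(1) unfolding B_def by blast
      from corner_parity[of e f k "\<lambda>g. g \<in> S", OF fk(1,2) fk(3)[unfolded chg_def] e(2)]
      obtain g l where gl: "l < 4" "chg g l" "face_side g l \<noteq> e" "v \<in> face_side g l"
        unfolding chg_def by (elim exE conjE)
      hence "face_side g l \<in> B" unfolding B_def by blast
      thus ?thesis using gl(3,4) by (intro bexI[of _ "face_side g l"] conjI)
    qed
    ultimately obtain \<alpha> where "length \<alpha> > 2" "distinct \<alpha>" "loop_edges \<alpha> \<subseteq> B"
      using loop_of_min_degree_2[OF finB] by blast
    thus False using free BT by (meson order_trans)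
  qed
  hence ex: "\<exists>n. reach n f" for f unfolding S_def by blast
  define t where "t = (\<lambda>f. LEAST n. reach n f)"
  have t: "reach (t f) f" for f unfolding t_def using ex by (rule LeastI_ex)
  have t_le: "t f \<le> n" if "reach n f" for f n unfolding t_def using that by (rule Least_le)
  have "\<exists>k<4. face_side f k \<notin> T \<and> t (lattice_step f k) < t f" if f: "f \<in> F" for f
  proof -
    have "t f \<noteq> 0" using t[of f] f r0 by (intro notI) simp
    then obtain n where n: "t f = Suc n" by (cases "t f") auto
    with t[of f] rS obtain k where k: "k < 4" "face_side f k \<notin> T" "reach n (lattice_step f k)" by auto
    thus ?thesis using t_le[OF k(3)] n by (intro exI[of _ k]) simp
  qed
  hence "\<forall>f\<in>F. \<exists>k. k < 4 \<and> face_side f k \<notin> T \<and> t (lattice_step f k) < t f" by blast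
  from bchoice[OF this] obtain c where
    c: "\<forall>f\<in>F. c f < 4 \<and> face_side f (c f) \<notin> T \<and> t (lattice_step f (c f)) < t f" ..
  define \<psi> where "\<psi> = restrict c F"
  have lv: "leaves F (rule_step \<psi>) f" for f
  proof (induction "t f" arbitrary: f rule: less_induct)
    case less
    show ?case
    proof (cases "f \<in> F")
      case True
      have "leaves F (rule_step \<psi>) (rule_step \<psi> f)"
        by (rule less.hyps) (use c True in \<open>simp add: \<psi>_def\<close>)
      thus ?thesis using leaves_step[OF True, of "rule_step \<psi>"] by simp
    qed (rule leaves_outside)
  qed
  moreover have "\<psi> \<in> F \<rightarrow>\<^sub>E {..<4}" using c by (simp add: \<psi>_def restrict_PiE_iff)
  ultimately have rule: "\<psi> \<in> exit_rules F 4 lattice_step" unfolding exit_rules_def by simp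
  have "face_side f (\<psi> f) \<notin> T" if "f \<in> F" for f using c that by (simp add: \<psi>_def)
  hence "crossed F \<psi> \<inter> T = {}" unfolding crossed_def by blast
  thus ?thesis using rule by (rule bexI)
qed

text \<open>
  The empty set of edges has no loops.
\<close>
lemma exit_rules_nonempty:
  assumes "finite F"
  shows "\<exists>\<psi>. \<psi> \<in> exit_rules F 4 lattice_step"
proof -
  have "\<nexists>\<alpha>. length \<alpha> > 2 \<and> distinct \<alpha> \<and> loop_edges \<alpha> \<subseteq> ({} :: (int \<times> int) set set)"
  proof
    assume "\<exists>\<alpha>. length \<alpha> > 2 \<and> distinct \<alpha> \<and> loop_edges \<alpha> \<subseteq> ({} :: (int \<times> int) set set)"
    then obtain \<alpha> :: "(int \<times> int) list" where "length \<alpha> > 2" "loop_edges \<alpha> \<subseteq> {}" by blast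
    thus False unfolding loop_edges_def by force
  qed
  from exit_rule_avoiding_tree[OF assms this] show ?thesis by blast
qed

section \<open>Lattice edges as segments\<close>

lemma Re_pt [simp]: "Re (pt v) = of_int (fst v)" and Im_pt [simp]: "Im (pt v) = of_int (snd v)"
  by (simp_all add: pt_def)

lemma pt_eq_iff [simp]: "pt u = pt v \<longleftrightarrow> u = v"
  by (auto simp: complex_eq_iff prod_eq_iff)

text \<open>
  The segment of an edge, defined so that it depends on the edge as a set only.
\<close>
definition edge_seg :: "(int \<times> int) set \<Rightarrow> complex set" where
  "edge_seg e = convex hull (pt ` e)"

lemma edge_seg_doubleton: "edge_seg {u, v} = closed_segment (pt u) (pt v)"
  by (simp add: edge_seg_def segment_convex_hull)

lemma edge_seg_vertical:
  "edge_seg {(a, b), (a, b + 1)} = {z. Re z = of_int a \<and> of_int b \<le> Im z \<and> Im z \<le> of_int b + 1}"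
  unfolding edge_seg_doubleton by (subst closed_segment_same_Re) (auto simp: closed_segment_eq_real_ivl)

lemma edge_seg_horizontal:
  "edge_seg {(a, b), (a + 1, b)} = {z. Im z = of_int b \<and> of_int a \<le> Re z \<and> Re z \<le> of_int a + 1}"
  unfolding edge_seg_doubleton by (subst closed_segment_same_Im) (auto simp: closed_segment_eq_real_ivl)

lemma int_unit_distance:
  fixes a b :: int
  assumes "(of_int a)\<^sup>2 + (of_int b)\<^sup>2 = (1 :: real)"
  shows "(a = 0 \<and> (b = 1 \<or> b = -1)) \<or> (b = 0 \<and> (a = 1 \<or> a = -1))"
proof -
  have "real_of_int (a\<^sup>2 + b\<^sup>2) = real_of_int 1" using assms by simp
  hence e: "a\<^sup>2 + b\<^sup>2 = 1" by (simp only: of_int_eq_iff)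
  have "a\<^sup>2 = 0 \<or> b\<^sup>2 = 0"
  proof (rule ccontr)
    assume n: "\<not> (a\<^sup>2 = 0 \<or> b\<^sup>2 = 0)"
    hence "a\<^sup>2 > 0" "b\<^sup>2 > 0" by simp_all
    thus False using e by linarith
  qed
  thus ?thesis
  proof
    assume "a\<^sup>2 = 0"
    moreover from this e have "b\<^sup>2 = 1" by simp
    ultimately show ?thesis by (simp add: power2_eq_1_iff)
  next
    assume "b\<^sup>2 = 0"
    moreover from this e have "a\<^sup>2 = 1" by simp
    ultimately show ?thesis by (simp add: power2_eq_1_iff)
  qed
qed

lemma lattice_edge_cases:
  assumes "e \<in> edges square_lattice"
  obtains (vertical) a b where "e = {(a, b), (a, b + 1)}" | (horizontal) a b where "e = {(a, b), (a + 1, b)}"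
proof -
  obtain u v where uv: "e = {u, v}" "dist (pt u) (pt v) = 1"
    using assms by (auto simp: square_lattice_def)
  obtain a b c d where p: "u = (a, b)" "v = (c, d)" by (metis surj_pair)
  have "(of_int (a - c))\<^sup>2 + (of_int (b - d))\<^sup>2 = (1 :: real)"
    using uv(2) by (simp add: p dist_complex_def cmod_def)
  from int_unit_distance[OF this] consider "c = a" "b = d + 1" | "c = a" "d = b + 1" | "d = b" "a = c + 1" | "d = b" "c = a + 1"
    by linarith
  thus ?thesis
  proof cases
    case 1 thus ?thesis using vertical[of a d] uv(1) p by (simp add: insert_commute)
  next
    case 2 thus ?thesis using vertical[of a b] uv(1) p by simp
  next
    case 3 thus ?thesis using horizontal[of c b] uv(1) p by (simp add: insert_commute)
  next
    case 4 thus ?thesis using horizontal[of a b] uv(1) p by simp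
  qed
qed

lemma lattice_edge_vertical: "{(a, b), (a, b + 1)} \<in> edges square_lattice"
proof -
  have "dist (pt (a, b)) (pt (a, b + 1)) = 1" by (simp add: dist_complex_def cmod_def)
  thus ?thesis unfolding square_lattice_def by auto
qed

lemma lattice_edge_horizontal: "{(a, b), (a + 1, b)} \<in> edges square_lattice"
proof -
  have "dist (pt (a, b)) (pt (a + 1, b)) = 1" by (simp add: dist_complex_def cmod_def)
  thus ?thesis unfolding square_lattice_def by auto
qed

lemma face_side_lattice_edge: "face_side f k \<in> edges square_lattice"
proof -
  obtain x y where "f = (x, y)" by fastforce
  thus ?thesis
    using lattice_edge_vertical[of x y] lattice_edge_vertical[of "x - 1" y]
      lattice_edge_horizontal[of "x - 1" y] lattice_edge_horizontal[of "x - 1" "y + 1"]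
    by (simp add: face_side.simps)
qed

lemma lattice_edge_is_side:
  assumes "e \<in> edges square_lattice"
  obtains f k where "k < 4" "e = face_side f k"
  using assms
proof (cases rule: lattice_edge_cases)
  case (vertical a b)
  thus ?thesis using that[of 0 "(a, b)"] by (simp add: face_side.simps)
next
  case (horizontal a b)
  thus ?thesis using that[of 3 "(a + 1, b)"] by (simp add: face_side.simps)
qed

lemma edge_seg_endpoints: "v \<in> e \<Longrightarrow> pt v \<in> edge_seg e"
  unfolding edge_seg_def by (rule hull_inc) simp

lemma int_touching:
  fixes a d :: int and x :: real
  assumes "of_int a \<le> x" "x \<le> of_int a + 1" "of_int d \<le> x" "x \<le> of_int d + 1" "d \<noteq> a"
  shows "d = a + 1 \<and> x = of_int d \<or> a = d + 1 \<and> x = of_int a"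
proof -
  have "real_of_int a \<le> of_int (d + 1)" "real_of_int d \<le> of_int (a + 1)" using assms by simp_all
  hence "a \<le> d + 1" "d \<le> a + 1" by (simp_all only: of_int_le_iff)
  hence "d = a + 1 \<or> a = d + 1" using assms(5) by linarith
  thus ?thesis using assms by auto
qed

text \<open>
  This is where the loop curve gets its simplicity from: distinct lattice edges meet
  in common end points only.
\<close>
lemma edge_seg_inter:
  assumes "e \<in> edges square_lattice" "e' \<in> edges square_lattice" "e \<noteq> e'"
    and z: "z \<in> edge_seg e" "z \<in> edge_seg e'"
  shows "\<exists>v\<in>e \<inter> e'. z = pt v"
proof -
  have mixed: "\<exists>v\<in>{(a, b), (a, b + 1)} \<inter> {(c, d), (c + 1, d)}. z = pt v"
    if "Re z = of_int a" "of_int b \<le> Im z" "Im z \<le> of_int b + 1" "Im z = of_int d" "of_int c \<le> Re z" "Re z \<le> of_int c + 1" for a b c d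
  proof -
    have "real_of_int b \<le> of_int d" "real_of_int d \<le> of_int (b + 1)" "real_of_int c \<le> of_int a" "real_of_int a \<le> of_int (c + 1)"
      using that by simp_all
    hence "b \<le> d" "d \<le> b + 1" "c \<le> a" "a \<le> c + 1" by (simp_all only: of_int_le_iff)
    hence "d = b \<or> d = b + 1" "a = c \<or> a = c + 1" by linarith+
    hence "(a, d) \<in> {(a, b), (a, b + 1)} \<inter> {(c, d), (c + 1, d)}" by auto
    moreover have "z = pt (a, d)" using that by (simp add: complex_eq_iff)
    ultimately show ?thesis by blast
  qed
  show ?thesis using assms(1)
  proof (cases rule: lattice_edge_cases)
    case (vertical a b)
    note z1 = z(1)[unfolded vertical edge_seg_vertical mem_Collect_eq]
    show ?thesis using assms(2)
    proof (cases rule: lattice_edge_cases)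
      case v2: (vertical c d)
      note z2 = z(2)[unfolded v2 edge_seg_vertical mem_Collect_eq]
      have "a = c" using z1 z2 by simp
      hence "d \<noteq> b" using assms(3) vertical v2 by auto
      hence "d = b + 1 \<and> Im z = of_int d \<or> b = d + 1 \<and> Im z = of_int b"
        using int_touching[of b "Im z" d] z1 z2 by simp
      thus ?thesis
      proof
        assume "d = b + 1 \<and> Im z = of_int d"
        moreover from this have "z = pt (a, d)" using z1 by (simp add: complex_eq_iff)
        ultimately show ?thesis using vertical v2 \<open>a = c\<close> by (intro bexI[of _ "(a, d)"]) simp_all
      next
        assume "b = d + 1 \<and> Im z = of_int b"
        moreover from this have "z = pt (a, b)" using z1 by (simp add: complex_eq_iff)
        ultimately show ?thesis using vertical v2 \<open>a = c\<close> by (intro bexI[of _ "(a, b)"]) simp_all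
      qed
    next
      case h: (horizontal c d)
      note z2 = z(2)[unfolded h edge_seg_horizontal mem_Collect_eq]
      show ?thesis unfolding vertical h by (rule mixed) (use z1 z2 in simp_all)
    qed
  next
    case h: (horizontal c d)
    note z1 = z(1)[unfolded h edge_seg_horizontal mem_Collect_eq]
    show ?thesis using assms(2)
    proof (cases rule: lattice_edge_cases)
      case (vertical a b)
      note z2 = z(2)[unfolded vertical edge_seg_vertical mem_Collect_eq]
      show ?thesis unfolding vertical h Int_commute[of "{(c, d), (c + 1, d)}"] by (rule mixed) (use z1 z2 in simp_all)
    next
      case h2: (horizontal a b)
      note z2 = z(2)[unfolded h2 edge_seg_horizontal mem_Collect_eq]
      have "b = d" using z1 z2 by simp
      hence "a \<noteq> c" using assms(3) h h2 by auto
      hence "a = c + 1 \<and> Re z = of_int a \<or> c = a + 1 \<and> Re z = of_int c"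
        using int_touching[of c "Re z" a] z1 z2 by simp
      thus ?thesis
      proof
        assume "a = c + 1 \<and> Re z = of_int a"
        moreover from this have "z = pt (a, b)" using z2 by (simp add: complex_eq_iff)
        ultimately show ?thesis using h h2 \<open>b = d\<close> by (intro bexI[of _ "(a, b)"]) simp_all
      next
        assume "c = a + 1 \<and> Re z = of_int c"
        moreover from this have "z = pt (c, b)" using z2 by (simp add: complex_eq_iff)
        ultimately show ?thesis using h h2 \<open>b = d\<close> by (intro bexI[of _ "(c, b)"]) simp_all
      qed
    qed
  qed
qed

lemma lattice_edge_distinct: "{u, v} \<in> edges square_lattice \<Longrightarrow> u \<noteq> v"
  by (erule lattice_edge_cases) (auto simp: doubleton_eq_iff)

text \<open>
  The segments of a path are joined one at a time; a new segment meets the arc built so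
  far only in their common vertex.
\<close>
lemma lattice_path_arc:
  assumes "length p \<ge> 2" "distinct p" "path_edges p \<subseteq> edges square_lattice"
  shows "\<exists>g. arc g \<and> pathstart g = pt (hd p) \<and> pathfinish g = pt (last p) \<and> path_image g = \<Union> (edge_seg ` path_edges p)"
  using assms
proof (induction p)
  case Nil thus ?case by simp
next
  case (Cons u q)
  then obtain v r where q: "q = v # r" by (cases q) auto
  have uv: "{u, v} \<in> edges square_lattice" using Cons.prems(3) q by simp
  hence arc1: "arc (linepath (pt u) (pt v))" using lattice_edge_distinct[OF uv] by simp
  show ?case
  proof (cases r)
    case Nil
    thus ?thesis using arc1 q
      by (intro exI[of _ "linepath (pt u) (pt v)"]) (simp add: edge_seg_doubleton)
  next
    case (Cons w s)
    have "length q \<ge> 2" "distinct q" "path_edges q \<subseteq> edges square_lattice"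
      using q Cons Cons.prems by simp_all
    from Cons.IH[OF this] obtain g where g: "arc g" "pathstart g = pt (hd q)" "pathfinish g = pt (last q)"
      "path_image g = \<Union> (edge_seg ` path_edges q)" by blast
    have "path_image (linepath (pt u) (pt v)) \<inter> path_image g \<subseteq> {pathstart g}"
    proof
      fix z assume z: "z \<in> path_image (linepath (pt u) (pt v)) \<inter> path_image g"
      then obtain e where e: "e \<in> path_edges q" "z \<in> edge_seg e" using g(4) by auto
      have zu: "z \<in> edge_seg {u, v}" using z by (simp add: edge_seg_doubleton)
      have "u \<notin> e" using path_edges_subset[OF e(1)] Cons.prems(2) by auto
      hence "{u, v} \<noteq> e" by auto
      moreover have "e \<in> edges square_lattice" using e(1) \<open>path_edges q \<subseteq> edges square_lattice\<close> by blast
      ultimately obtain x where "x \<in> {u, v} \<inter> e" "z = pt x" using edge_seg_inter[OF uv _ _ zu e(2)] by blast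
      hence "z = pt v" using \<open>u \<notin> e\<close> by auto
      thus "z \<in> {pathstart g}" using g(2) q by simp
    qed
    moreover have "pathfinish (linepath (pt u) (pt v)) = pathstart g" using g(2) q by simp
    ultimately have "arc (linepath (pt u) (pt v) +++ g)" using arc1 g(1) by (intro arc_join)
    moreover have "path_image (linepath (pt u) (pt v) +++ g) = \<Union> (edge_seg ` path_edges (u # q))"
      using g q by (subst path_image_join) (simp_all add: edge_seg_doubleton)
    moreover have "last (u # q) = last q" using q by simp
    ultimately show ?thesis using g
      by (intro exI[of _ "linepath (pt u) (pt v) +++ g"]) simp
  qed
qed

lemma loop_curve_eq: "loop_curve \<alpha> = \<Union> (edge_seg ` loop_edges \<alpha>)"
proof -
  have "loop_edges \<alpha> = (\<lambda>i. {\<alpha> ! i, \<alpha> ! (Suc i mod length \<alpha>)}) ` {..<length \<alpha>}"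
    unfolding loop_edges_def by blast
  thus ?thesis unfolding loop_curve_def by (simp add: edge_seg_doubleton)
qed

text \<open>
  All edges of the loop but one form an arc; the last edge closes it. It is a new edge because
  a loop with at least three vertices has as many edges as vertices.
\<close>
lemma loop_curve_simple_path:
  assumes "length \<alpha> > 2" "distinct \<alpha>" "loop_edges \<alpha> \<subseteq> edges square_lattice"
  obtains c where "simple_path c" "pathfinish c = pathstart c" "path_image c = loop_curve \<alpha>"
proof -
  have ne: "\<alpha> \<noteq> []" using assms(1) by auto
  have le: "loop_edges \<alpha> = insert {last \<alpha>, hd \<alpha>} (path_edges \<alpha>)" by (rule loop_edges_eq[OF ne])
  hence pe: "path_edges \<alpha> \<subseteq> edges square_lattice" and lh: "{last \<alpha>, hd \<alpha>} \<in> edges square_lattice"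
    using assms(3) by auto
  obtain g where g: "arc g" "pathstart g = pt (hd \<alpha>)" "pathfinish g = pt (last \<alpha>)"
      "path_image g = \<Union> (edge_seg ` path_edges \<alpha>)"
    using lattice_path_arc[OF _ assms(2) pe] assms(1) by auto
  let ?l = "linepath (pt (last \<alpha>)) (pt (hd \<alpha>))"
  have arc: "arc ?l" using lattice_edge_distinct[OF lh] by simp
  have new: "{last \<alpha>, hd \<alpha>} \<notin> path_edges \<alpha>"
  proof
    assume "{last \<alpha>, hd \<alpha>} \<in> path_edges \<alpha>"
    hence "loop_edges \<alpha> = path_edges \<alpha>" using le by auto
    moreover have "path_edges \<alpha> = (\<lambda>i. {\<alpha> ! i, \<alpha> ! Suc i}) ` {..<length \<alpha> - 1}"
      unfolding path_edges_def by (auto simp: less_diff_conv)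
    ultimately have "card (loop_edges \<alpha>) \<le> length \<alpha> - 1"
      using card_image_le[of "{..<length \<alpha> - 1}" "\<lambda>i. {\<alpha> ! i, \<alpha> ! Suc i}"] by simp
    thus False using card_loop_edges[OF assms(1,2)] assms(1) by simp
  qed
  have "path_image g \<inter> path_image ?l \<subseteq> {pathstart g, pathstart ?l}"
  proof
    fix z assume z: "z \<in> path_image g \<inter> path_image ?l"
    then obtain e where e: "e \<in> path_edges \<alpha>" "z \<in> edge_seg e" using g(4) by auto
    have zl: "z \<in> edge_seg {last \<alpha>, hd \<alpha>}" using z by (simp add: edge_seg_doubleton)
    have "e \<in> edges square_lattice" using e(1) pe by blast
    moreover have "e \<noteq> {last \<alpha>, hd \<alpha>}" using e(1) new by blast
    ultimately obtain x where "x \<in> e \<inter> {last \<alpha>, hd \<alpha>}" "z = pt x"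
      using edge_seg_inter[OF _ lh _ e(2) zl] by blast
    thus "z \<in> {pathstart g, pathstart ?l}" using g(2) by auto
  qed
  hence "simple_path (g +++ ?l)"
    using g arc by (intro simple_path_join_loop) simp_all
  moreover have "pathfinish (g +++ ?l) = pathstart (g +++ ?l)" using g by simp
  moreover have "path_image (g +++ ?l) = loop_curve \<alpha>"
    using g by (subst path_image_join) (auto simp: loop_curve_eq le edge_seg_doubleton)
  ultimately show ?thesis using that by blast
qed

section \<open>Faces and neighbourhoods\<close>

definition open_face :: "int \<times> int \<Rightarrow> complex set" where
  "open_face f = box (pt (fst f - 1, snd f)) (pt (fst f, snd f + 1))"

lemma in_open_face:
  "z \<in> open_face (x, y) \<longleftrightarrow> of_int x - 1 < Re z \<and> Re z < of_int x \<and> of_int y < Im z \<and> Im z < of_int y + 1"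
  by (auto simp: open_face_def in_box_complex_iff)

lemma in_face:
  "z \<in> face_bottom_right (x, y) \<longleftrightarrow> of_int x - 1 \<le> Re z \<and> Re z \<le> of_int x \<and> of_int y \<le> Im z \<and> Im z \<le> of_int y + 1"
  by (auto simp: face_bottom_right_def in_cbox_complex_iff)

lemma open_face_nonempty: "open_face f \<noteq> {}"
proof -
  have "Complex (of_int (fst f) - 1/2) (of_int (snd f) + 1/2) \<in> open_face (fst f, snd f)"
    unfolding in_open_face by simp
  thus ?thesis by auto
qed

lemma closure_open_face: "closure (open_face f) = face_bottom_right f"
  using open_face_nonempty[of f] unfolding open_face_def face_bottom_right_def by (rule closure_box)

lemma open_face_connected: "connected (open_face f)" and open_open_face: "open (open_face f)"
  unfolding open_face_def by (rule convex_connected[OF convex_box(2)], rule open_box)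

lemma open_faces_disjoint:
  assumes "z \<in> open_face f" "z \<in> open_face g"
  shows "f = g"
proof -
  obtain x y x' y' where fg: "f = (x, y)" "g = (x', y')" by (metis surj_pair)
  note z = assms[unfolded fg in_open_face]
  have "real_of_int x < of_int (x' + 1)" "real_of_int x' < of_int (x + 1)"
    "real_of_int y < of_int (y' + 1)" "real_of_int y' < of_int (y + 1)" using z by simp_all
  thus ?thesis unfolding fg by (simp only: of_int_less_iff) simp
qed

text \<open>
  Closed faces cover the plane.
\<close>
lemma every_point_in_face: "\<exists>f. z \<in> face_bottom_right f"
proof -
  have "z \<in> face_bottom_right (\<lfloor>Re z\<rfloor> + 1, \<lfloor>Im z\<rfloor>)"
    unfolding in_face by (simp add: less_imp_le)
  thus ?thesis by blast
qed

lemma edge_seg_disjoint_open_face: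
  assumes "e \<in> edges square_lattice"
  shows "edge_seg e \<inter> open_face f = {}"
proof (rule ccontr)
  assume "edge_seg e \<inter> open_face f \<noteq> {}"
  then obtain z where z: "z \<in> edge_seg e" "z \<in> open_face f" by blast
  obtain x y where f: "f = (x, y)" by fastforce
  note zf = z(2)[unfolded f in_open_face]
  show False using assms
  proof (cases rule: lattice_edge_cases)
    case (vertical a b)
    hence "Re z = of_int a" using z(1) edge_seg_vertical by simp
    hence "real_of_int (x - 1) < of_int a" "real_of_int a < of_int x" using zf by simp_all
    hence "x - 1 < a" "a < x" by (simp_all only: of_int_less_iff)
    thus False by simp
  next
    case (horizontal a b)
    hence "Im z = of_int b" using z(1) edge_seg_horizontal by simp
    hence "real_of_int y < of_int b" "real_of_int b < of_int (y + 1)" using zf by simp_all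
    hence "y < b" "b < y + 1" by (simp_all only: of_int_less_iff)
    thus False by simp
  qed
qed

lemma face_side_subset_face: "edge_seg (face_side f k) \<subseteq> face_bottom_right f"
proof -
  obtain x y where f: "f = (x, y)" by fastforce
  have s: "edge_seg {(x - 1, y), (x, y)} = {z. Im z = of_int y \<and> of_int x - 1 \<le> Re z \<and> Re z \<le> of_int x}"
    "edge_seg {(x - 1, y + 1), (x, y + 1)} = {z. Im z = of_int y + 1 \<and> of_int x - 1 \<le> Re z \<and> Re z \<le> of_int x}"
    using edge_seg_horizontal[of "x - 1" y] edge_seg_horizontal[of "x - 1" "y + 1"] by simp_all
  show ?thesis
    unfolding f face_side.simps by (auto simp: s edge_seg_vertical in_face)
qed

text \<open>
  An open rectangle \<open>B\<close> made up of the two faces \<open>f\<close> and \<open>g\<close> and the open edge \<open>s\<close> between them, together with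
  a point \<open>z\<close> of that edge. It meets no other lattice edge, so the loop curve can
  separate its two halves only along \<open>s\<close>.
\<close>
definition edge_nbhd :: "complex set \<Rightarrow> complex \<Rightarrow> (int \<times> int) set \<Rightarrow> int \<times> int \<Rightarrow> int \<times> int \<Rightarrow> bool" where
  "edge_nbhd B z s f g \<longleftrightarrow> open B \<and> connected B \<and> z \<in> B \<and> z \<in> edge_seg s \<and> open_face f \<subseteq> B \<and> open_face g \<subseteq> B \<and>
    B \<subseteq> open_face f \<union> open_face g \<union> edge_seg s \<and>
    (\<forall>e\<in>edges square_lattice. e \<noteq> s \<longrightarrow> edge_seg e \<inter> B = {})"

lemma edge_nbhd_sym: "edge_nbhd B z s f g \<Longrightarrow> edge_nbhd B z s g f"
  unfolding edge_nbhd_def Un_commute[of "open_face g"] by (intro conjI; elim conjE; assumption)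

lemma edge_nbhdI:
  assumes B: "B = box p q" and z: "z \<in> B" "z \<in> edge_seg s" and fg: "open_face f \<subseteq> B" "open_face g \<subseteq> B"
    and sub: "B \<subseteq> open_face f \<union> open_face g \<union> edge_seg s" and s: "s \<in> edges square_lattice"
    and ends: "\<And>v. v \<in> s \<Longrightarrow> pt v \<notin> B"
  shows "edge_nbhd B z s f g"
proof -
  have "edge_seg e \<inter> B = {}" if e: "e \<in> edges square_lattice" "e \<noteq> s" for e
  proof (rule ccontr)
    assume "edge_seg e \<inter> B \<noteq> {}"
    then obtain w where w: "w \<in> edge_seg e" "w \<in> B" by blast
    have "w \<in> edge_seg s"
      using w sub edge_seg_disjoint_open_face[OF e(1)] by blast
    from edge_seg_inter[OF e(1) s e(2) w(1) this]
    obtain v where "v \<in> s" "w = pt v" by blast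
    thus False using w(2) ends by blast
  qed
  moreover have "open B" "connected B" unfolding B by (rule open_box, rule convex_connected[OF convex_box(2)])
  ultimately show ?thesis unfolding edge_nbhd_def using z fg sub by (intro conjI ballI impI)
qed

lemma edge_nbhd_vertical: "\<exists>B z. edge_nbhd B z {(a, b), (a, b + 1)} (a, b) (a + 1, b)"
proof (intro exI)
  let ?B = "box (pt (a - 1, b)) (pt (a + 1, b + 1))"
  show "edge_nbhd ?B (Complex (of_int a) (of_int b + 1/2)) {(a, b), (a, b + 1)} (a, b) (a + 1, b)"
  proof (rule edge_nbhdI[OF refl])
    show "Complex (of_int a) (of_int b + 1/2) \<in> ?B" by (simp add: in_box_complex_iff)
    show "Complex (of_int a) (of_int b + 1/2) \<in> edge_seg {(a, b), (a, b + 1)}" by (simp add: edge_seg_vertical)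
    show "open_face (a, b) \<subseteq> ?B" "open_face (a + 1, b) \<subseteq> ?B"
      by (auto simp: in_open_face in_box_complex_iff)
    show "?B \<subseteq> open_face (a, b) \<union> open_face (a + 1, b) \<union> edge_seg {(a, b), (a, b + 1)}"
    proof
      fix z assume "z \<in> ?B"
      hence "of_int a - 1 < Re z" "Re z < of_int a + 1" "of_int b < Im z" "Im z < of_int b + 1"
        by (simp_all add: in_box_complex_iff)
      moreover have "Re z < of_int a \<or> Re z = of_int a \<or> Re z > of_int a" by linarith
      ultimately show "z \<in> open_face (a, b) \<union> open_face (a + 1, b) \<union> edge_seg {(a, b), (a, b + 1)}"
        by (elim disjE) (simp_all add: in_open_face edge_seg_vertical)
    qed
    fix v assume "v \<in> {(a, b), (a, b + 1)}"
    thus "pt v \<notin> ?B" by (elim insertE) (simp_all add: in_box_complex_iff)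
  qed (rule lattice_edge_vertical)
qed

lemma edge_nbhd_horizontal: "\<exists>B z. edge_nbhd B z {(a, b), (a + 1, b)} (a + 1, b) (a + 1, b - 1)"
proof (intro exI)
  let ?B = "box (pt (a, b - 1)) (pt (a + 1, b + 1))"
  show "edge_nbhd ?B (Complex (of_int a + 1/2) (of_int b)) {(a, b), (a + 1, b)} (a + 1, b) (a + 1, b - 1)"
  proof (rule edge_nbhdI[OF refl])
    show "Complex (of_int a + 1/2) (of_int b) \<in> ?B" by (simp add: in_box_complex_iff)
    show "Complex (of_int a + 1/2) (of_int b) \<in> edge_seg {(a, b), (a + 1, b)}" by (simp add: edge_seg_horizontal)
    show "open_face (a + 1, b) \<subseteq> ?B" "open_face (a + 1, b - 1) \<subseteq> ?B"
      by (auto simp: in_open_face in_box_complex_iff)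
    show "?B \<subseteq> open_face (a + 1, b) \<union> open_face (a + 1, b - 1) \<union> edge_seg {(a, b), (a + 1, b)}"
    proof
      fix z assume "z \<in> ?B"
      hence "of_int a < Re z" "Re z < of_int a + 1" "of_int b - 1 < Im z" "Im z < of_int b + 1"
        by (simp_all add: in_box_complex_iff)
      moreover have "Im z < of_int b \<or> Im z = of_int b \<or> Im z > of_int b" by linarith
      ultimately show "z \<in> open_face (a + 1, b) \<union> open_face (a + 1, b - 1) \<union> edge_seg {(a, b), (a + 1, b)}"
        by (elim disjE) (simp_all add: in_open_face edge_seg_horizontal)
    qed
    fix v assume "v \<in> {(a, b), (a + 1, b)}"
    thus "pt v \<notin> ?B" by (elim insertE) (simp_all add: in_box_complex_iff)
  qed (rule lattice_edge_horizontal)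
qed

lemma edge_nbhd_exists:
  assumes "k < 4"
  shows "\<exists>B z. edge_nbhd B z (face_side f k) f (lattice_step f k)"
proof -
  obtain x y where f: "f = (x, y)" by fastforce
  consider "k = 0" | "k = 1" | "k = 2" | "k = 3" using assms by linarith
  thus ?thesis
  proof cases
    case 1
    thus ?thesis using edge_nbhd_vertical[of x y] by (simp add: f face_side.simps lattice_step.simps)
  next
    case 2
    obtain B z where "edge_nbhd B z {(x - 1, y), (x - 1, y + 1)} (x - 1, y) (x - 1 + 1, y)"
      using edge_nbhd_vertical[of "x - 1" y] by blast
    from edge_nbhd_sym[OF this] have "edge_nbhd B z (face_side f k) f (lattice_step f k)"
      by (simp add: f 2 face_side.simps lattice_step.simps)
    thus ?thesis by blast
  next
    case 3
    obtain B z where "edge_nbhd B z {(x - 1, y + 1), (x - 1 + 1, y + 1)} (x - 1 + 1, y + 1) (x - 1 + 1, y + 1 - 1)"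
      using edge_nbhd_horizontal[of "x - 1" "y + 1"] by blast
    from edge_nbhd_sym[OF this] have "edge_nbhd B z (face_side f k) f (lattice_step f k)"
      by (simp add: f 3 face_side.simps lattice_step.simps)
    thus ?thesis by blast
  next
    case 4
    thus ?thesis using edge_nbhd_horizontal[of "x - 1" y] by (simp add: f face_side.simps lattice_step.simps)
  qed
qed

lemma vertex_nbhd_exists:
  "\<exists>B. open B \<and> connected B \<and> pt v \<in> B \<and> open_face v \<subseteq> B \<and>
    (\<forall>e\<in>edges square_lattice. edge_seg e \<inter> B \<noteq> {} \<longrightarrow> v \<in> e)"
proof -
  obtain x y where v: "v = (x, y)" by fastforce
  let ?B = "box (pt (x - 1, y - 1)) (pt (x + 1, y + 1))"
  have "v \<in> e" if e: "e \<in> edges square_lattice" and z: "z \<in> edge_seg e" "z \<in> ?B" for e z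
    using e
  proof (cases rule: lattice_edge_cases)
    case (vertical a b)
    have r: "Re z = of_int a" "of_int b \<le> Im z" "Im z \<le> of_int b + 1"
      using z(1) unfolding vertical edge_seg_vertical by simp_all
    have "real_of_int (x - 1) < of_int a" "real_of_int a < of_int (x + 1)"
      "real_of_int (y - 1) < of_int (b + 1)" "real_of_int b < of_int (y + 1)"
      using z(2) r by (simp_all add: in_box_complex_iff)
    hence "x - 1 < a" "a < x + 1" "y - 1 < b + 1" "b < y + 1" by (simp_all only: of_int_less_iff)
    hence "a = x" "b = y \<or> b + 1 = y" by linarith+
    thus ?thesis unfolding vertical v by auto
  next
    case (horizontal a b)
    have r: "Im z = of_int b" "of_int a \<le> Re z" "Re z \<le> of_int a + 1"
      using z(1) unfolding horizontal edge_seg_horizontal by simp_all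
    have "real_of_int (y - 1) < of_int b" "real_of_int b < of_int (y + 1)"
      "real_of_int (x - 1) < of_int (a + 1)" "real_of_int a < of_int (x + 1)"
      using z(2) r by (simp_all add: in_box_complex_iff)
    hence "y - 1 < b" "b < y + 1" "x - 1 < a + 1" "a < x + 1" by (simp_all only: of_int_less_iff)
    hence "b = y" "a = x \<or> a + 1 = x" by linarith+
    thus ?thesis unfolding horizontal v by auto
  qed
  moreover have "pt v \<in> ?B" "open_face v \<subseteq> ?B"
    unfolding v by (auto simp: in_box_complex_iff in_open_face)
  ultimately show ?thesis by (intro exI[of _ ?B]) (auto simp: convex_connected)
qed

section \<open>Faces enclosed by a lattice loop\<close>

text \<open>
  Kept apart from graphs, because the Jordan curve theorem is applied both to the boundary of a
  grid graph and to loops inside it.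
\<close>
locale lattice_loop =
  fixes \<alpha> :: "(int \<times> int) list"
  assumes length_gt_2: "length \<alpha> > 2" and distinct: "distinct \<alpha>"
    and lattice_edges: "loop_edges \<alpha> \<subseteq> edges square_lattice"
begin

definition faces :: "(int \<times> int) set" where
  "faces = {f. open_face f \<subseteq> inside (loop_curve \<alpha>)}"

lemma jordan:
  "inside (loop_curve \<alpha>) \<noteq> {}" "open (inside (loop_curve \<alpha>))" "bounded (inside (loop_curve \<alpha>))"
  "open (outside (loop_curve \<alpha>))" "connected (outside (loop_curve \<alpha>))" "\<not> bounded (outside (loop_curve \<alpha>))"
  "inside (loop_curve \<alpha>) \<inter> outside (loop_curve \<alpha>) = {}"
  "inside (loop_curve \<alpha>) \<union> outside (loop_curve \<alpha>) = - loop_curve \<alpha>"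
  "frontier (inside (loop_curve \<alpha>)) = loop_curve \<alpha>" "frontier (outside (loop_curve \<alpha>)) = loop_curve \<alpha>"
proof -
  obtain c where c: "simple_path c" "pathfinish c = pathstart c" "path_image c = loop_curve \<alpha>"
    using loop_curve_simple_path[OF length_gt_2 distinct lattice_edges] by blast
  note J = Jordan_inside_outside[OF c(1,2), unfolded c(3)]
  show "inside (loop_curve \<alpha>) \<noteq> {}" "open (inside (loop_curve \<alpha>))" "bounded (inside (loop_curve \<alpha>))"
    "open (outside (loop_curve \<alpha>))" "connected (outside (loop_curve \<alpha>))" "\<not> bounded (outside (loop_curve \<alpha>))"
    "inside (loop_curve \<alpha>) \<inter> outside (loop_curve \<alpha>) = {}"
    "inside (loop_curve \<alpha>) \<union> outside (loop_curve \<alpha>) = - loop_curve \<alpha>"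
    "frontier (inside (loop_curve \<alpha>)) = loop_curve \<alpha>" "frontier (outside (loop_curve \<alpha>)) = loop_curve \<alpha>"
    using J by simp_all
qed

text \<open>
  All that is used of separation: a connected set that avoids the curve lies on one side.
\<close>
lemma connected_one_side:
  assumes "connected C" "C \<inter> loop_curve \<alpha> = {}"
  shows "C \<subseteq> inside (loop_curve \<alpha>) \<or> C \<subseteq> outside (loop_curve \<alpha>)"
proof -
  have sub: "C \<subseteq> inside (loop_curve \<alpha>) \<union> outside (loop_curve \<alpha>)" using assms(2) jordan(8) by blast
  moreover have "inside (loop_curve \<alpha>) \<inter> outside (loop_curve \<alpha>) \<inter> C = {}" using jordan(7) by blast
  ultimately have "inside (loop_curve \<alpha>) \<inter> C = {} \<or> outside (loop_curve \<alpha>) \<inter> C = {}"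
    using connectedD[OF assms(1) jordan(2,4)] by blast
  thus ?thesis using sub by blast
qed

lemma open_face_avoids: "open_face f \<inter> loop_curve \<alpha> = {}"
  unfolding loop_curve_eq using edge_seg_disjoint_open_face lattice_edges by blast

lemma not_face_iff: "f \<notin> faces \<longleftrightarrow> open_face f \<subseteq> outside (loop_curve \<alpha>)"
proof
  assume "f \<notin> faces"
  thus "open_face f \<subseteq> outside (loop_curve \<alpha>)"
    using connected_one_side[OF open_face_connected open_face_avoids] unfolding faces_def by blast
next
  assume "open_face f \<subseteq> outside (loop_curve \<alpha>)"
  thus "f \<notin> faces" using open_face_nonempty[of f] jordan(7) unfolding faces_def by blast
qed

lemma face_if_meets: "open_face f \<inter> inside (loop_curve \<alpha>) \<noteq> {} \<Longrightarrow> f \<in> faces"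
  using not_face_iff[of f] jordan(7) by blast

text \<open>
  A neighbourhood of \<open>z\<close> is inside, and a closed face is the closure of the open one, so the open face
  has a point inside even if \<open>z\<close> lies on a lattice line.
\<close>
lemma face_of_inner_point:
  assumes "z \<in> inside (loop_curve \<alpha>)" "z \<in> face_bottom_right f"
  shows "f \<in> faces"
proof -
  have "z \<in> closure (open_face f)" using assms(2) by (simp only: closure_open_face)
  hence "inside (loop_curve \<alpha>) \<inter> open_face f \<noteq> {}"
    using assms(1) jordan(2) open_Int_closure_eq_empty by blast
  thus ?thesis by (intro face_if_meets) blast
qed

lemma faces_nonempty: "faces \<noteq> {}"
proof -
  obtain z where z: "z \<in> inside (loop_curve \<alpha>)" using jordan(1) by blast
  obtain f where "z \<in> face_bottom_right f" using every_point_in_face by blast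
  thus ?thesis using face_of_inner_point[OF z] by blast
qed

lemma closure_inside: "closure (inside (loop_curve \<alpha>)) = loop_region \<alpha>"
  unfolding loop_region_def closure_Un_frontier jordan(9) by (rule Un_commute)

lemma face_region_iff: "face_bottom_right f \<subseteq> loop_region \<alpha> \<longleftrightarrow> f \<in> faces"
proof
  assume "f \<in> faces"
  hence "closure (open_face f) \<subseteq> closure (inside (loop_curve \<alpha>))"
    unfolding faces_def by (intro closure_mono) simp
  thus "face_bottom_right f \<subseteq> loop_region \<alpha>" by (simp only: closure_open_face closure_inside)
next
  assume *: "face_bottom_right f \<subseteq> loop_region \<alpha>"
  have "open_face f \<subseteq> face_bottom_right f" unfolding closure_open_face[symmetric] by (rule closure_subset)
  hence "open_face f \<subseteq> inside (loop_curve \<alpha>)" using * open_face_avoids[of f] unfolding loop_region_def by blast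
  thus "f \<in> faces" by (simp add: faces_def)
qed

text \<open>
  The edge rectangle avoids the curve and is connected.
\<close>
lemma side_not_in_loop:
  assumes k: "k < 4" and nl: "face_side f k \<notin> loop_edges \<alpha>"
  shows "f \<in> faces \<longleftrightarrow> lattice_step f k \<in> faces"
    and "edge_seg (face_side f k) \<subseteq> loop_region \<alpha> \<Longrightarrow> f \<in> faces"
proof -
  obtain B z where "edge_nbhd B z (face_side f k) f (lattice_step f k)" using edge_nbhd_exists[OF k] by blast
  hence B: "connected B" "z \<in> B" "z \<in> edge_seg (face_side f k)" "open_face f \<subseteq> B" "open_face (lattice_step f k) \<subseteq> B"
    and e: "\<forall>e\<in>edges square_lattice. e \<noteq> face_side f k \<longrightarrow> edge_seg e \<inter> B = {}"
    unfolding edge_nbhd_def by simp_all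
  have "edge_seg e' \<inter> B = {}" if "e' \<in> loop_edges \<alpha>" for e'
  proof -
    have "e' \<in> edges square_lattice" using that lattice_edges by (rule subsetD[rotated])
    moreover have "e' \<noteq> face_side f k" using that nl by (intro notI) simp
    ultimately show ?thesis using e by simp
  qed
  hence avoid: "B \<inter> loop_curve \<alpha> = {}" unfolding loop_curve_eq by blast
  from connected_one_side[OF B(1) this]
  show "f \<in> faces \<longleftrightarrow> lattice_step f k \<in> faces"
  proof
    assume "B \<subseteq> inside (loop_curve \<alpha>)"
    hence "f \<in> faces" "lattice_step f k \<in> faces" using B(4,5) unfolding faces_def by blast+
    thus ?thesis by simp
  next
    assume "B \<subseteq> outside (loop_curve \<alpha>)"
    hence "f \<notin> faces" "lattice_step f k \<notin> faces" using B(4,5) unfolding not_face_iff by blast+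
    thus ?thesis by simp
  qed
  show "f \<in> faces" if "edge_seg (face_side f k) \<subseteq> loop_region \<alpha>"
  proof -
    have "z \<in> loop_region \<alpha>" using that B(3) by (rule subsetD)
    moreover have "z \<notin> loop_curve \<alpha>" using avoid B(2) by (intro notI) (simp add: disjoint_iff)
    ultimately have "z \<in> inside (loop_curve \<alpha>)" unfolding loop_region_def by simp
    hence "\<not> B \<subseteq> outside (loop_curve \<alpha>)" using B(2) jordan(7) by blast
    hence "B \<subseteq> inside (loop_curve \<alpha>)" using connected_one_side[OF B(1) avoid] by blast
    thus ?thesis using B(4) unfolding faces_def by blast
  qed
qed

text \<open>
  A point of the curve is in the closure of the inside and of the outside, so the edge
  rectangle meets both; off the curve it consists of the two faces.
\<close>
lemma side_in_loop:
  assumes k: "k < 4" and l: "face_side f k \<in> loop_edges \<alpha>"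
  shows "f \<in> faces \<longleftrightarrow> lattice_step f k \<notin> faces"
proof -
  obtain B z where "edge_nbhd B z (face_side f k) f (lattice_step f k)" using edge_nbhd_exists[OF k] by blast
  hence B: "open B" "z \<in> B" "z \<in> edge_seg (face_side f k)"
    and sub: "B \<subseteq> open_face f \<union> open_face (lattice_step f k) \<union> edge_seg (face_side f k)"
    unfolding edge_nbhd_def by simp_all
  have K: "edge_seg (face_side f k) \<subseteq> loop_curve \<alpha>" using l unfolding loop_curve_eq by blast
  hence zK: "z \<in> loop_curve \<alpha>" using B(3) by blast
  have "z \<in> closure (inside (loop_curve \<alpha>))" "z \<in> closure (outside (loop_curve \<alpha>))"
    using zK jordan(9,10) unfolding frontier_def by blast+
  hence "B \<inter> inside (loop_curve \<alpha>) \<noteq> {}" "B \<inter> outside (loop_curve \<alpha>) \<noteq> {}"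
    using B(1,2) open_Int_closure_eq_empty by blast+
  then obtain p q where p: "p \<in> B" "p \<in> inside (loop_curve \<alpha>)" and q: "q \<in> B" "q \<in> outside (loop_curve \<alpha>)" by blast
  have "p \<notin> loop_curve \<alpha>" "q \<notin> loop_curve \<alpha>" using p(2) q(2) jordan(8) by blast+
  hence "p \<in> open_face f \<or> p \<in> open_face (lattice_step f k)" "q \<in> open_face f \<or> q \<in> open_face (lattice_step f k)"
    using p(1) q(1) sub K by blast+
  moreover have "g \<in> faces" if "p \<in> open_face g" for g
    using that p(2) face_if_meets[of g] by blast
  moreover have "g \<notin> faces" if "q \<in> open_face g" for g
    using that q(2) jordan(7) unfolding faces_def by blast
  ultimately have "f \<in> faces \<or> lattice_step f k \<in> faces" "f \<notin> faces \<or> lattice_step f k \<notin> faces"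
    by metis+
  thus ?thesis by argo
qed

text \<open>
  An edge of the region that is not on the loop has both faces enclosed, and one on the loop has
  one; so the graph is determined by its faces.
\<close>
lemma region_edges_eq:
  "{e \<in> edges square_lattice. edge_seg e \<subseteq> loop_region \<alpha>} = region_edges faces"
proof (rule subset_antisym; rule subsetI)
  fix e assume "e \<in> {e \<in> edges square_lattice. edge_seg e \<subseteq> loop_region \<alpha>}"
  hence e: "e \<in> edges square_lattice" "edge_seg e \<subseteq> loop_region \<alpha>" by auto
  obtain f k where fk: "k < 4" "e = face_side f k" using lattice_edge_is_side[OF e(1)] by blast
  have "f \<in> faces \<or> lattice_step f k \<in> faces"
  proof (cases "e \<in> loop_edges \<alpha>")
    case True thus ?thesis using side_in_loop[OF fk(1), of f] fk(2) by blast
  next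
    case False thus ?thesis using side_not_in_loop(2)[OF fk(1), of f] fk(2) e(2) by blast
  qed
  thus "e \<in> region_edges faces"
  proof
    assume "f \<in> faces" thus ?thesis using fk unfolding region_edges_def by blast
  next
    assume "lattice_step f k \<in> faces"
    moreover have "e = face_side (lattice_step f k) (opposite k)" using face_side_opposite[OF fk(1)] fk(2) by simp
    ultimately show ?thesis using opposite_less[of k] unfolding region_edges_def by blast
  qed
next
  fix e assume "e \<in> region_edges faces"
  then obtain f k where "f \<in> faces" "k < 4" "e = face_side f k" unfolding region_edges_def by blast
  thus "e \<in> {e \<in> edges square_lattice. edge_seg e \<subseteq> loop_region \<alpha>}"
    using face_side_lattice_edge[of f k] face_side_subset_face[of f k] face_region_iff[of f] by simp
qed

lemma loop_edges_subset_region: "loop_edges \<alpha> \<subseteq> region_edges faces"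
proof
  fix e assume e: "e \<in> loop_edges \<alpha>"
  hence "edge_seg e \<subseteq> loop_region \<alpha>" unfolding loop_region_def loop_curve_eq by blast
  thus "e \<in> region_edges faces" using e lattice_edges unfolding region_edges_eq[symmetric] by blast
qed

lemma vertex_on_curve: "pt v \<in> loop_curve \<alpha> \<longleftrightarrow> v \<in> set \<alpha>"
proof
  assume "pt v \<in> loop_curve \<alpha>"
  then obtain e where e: "e \<in> loop_edges \<alpha>" "pt v \<in> edge_seg e" unfolding loop_curve_eq by blast
  obtain B where "pt v \<in> B" "\<forall>e\<in>edges square_lattice. edge_seg e \<inter> B \<noteq> {} \<longrightarrow> v \<in> e"
    using vertex_nbhd_exists[of v] by blast
  hence "v \<in> e" using e lattice_edges by blast
  moreover have "e \<subseteq> set \<alpha>"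
  proof -
    have "Suc i mod length \<alpha> < length \<alpha>" for i using length_gt_2 by (intro mod_less_divisor) linarith
    thus ?thesis using e(1) unfolding loop_edges_def by auto
  qed
  ultimately show "v \<in> set \<alpha>" by blast
next
  assume "v \<in> set \<alpha>"
  then obtain i where i: "i < length \<alpha>" "v = \<alpha> ! i" by (auto simp: in_set_conv_nth)
  hence "{\<alpha> ! i, \<alpha> ! (Suc i mod length \<alpha>)} \<in> loop_edges \<alpha>" unfolding loop_edges_def by blast
  moreover have "pt v \<in> edge_seg {\<alpha> ! i, \<alpha> ! (Suc i mod length \<alpha>)}"
    using i(2) by (intro edge_seg_endpoints) simp
  ultimately show "pt v \<in> loop_curve \<alpha>" unfolding loop_curve_eq by blast
qed

text \<open>
  All four faces around an inner vertex are enclosed, in particular the one named by it.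
\<close>
lemma inner_vertex_is_face:
  assumes "pt v \<in> loop_region \<alpha>" "v \<notin> set \<alpha>"
  shows "v \<in> faces"
proof -
  have "pt v \<in> inside (loop_curve \<alpha>)" using assms vertex_on_curve unfolding loop_region_def by blast
  moreover have "pt v \<in> face_bottom_right v" by (cases v) (simp add: in_face)
  ultimately show ?thesis by (rule face_of_inner_point)
qed

lemma face_corner_in_region:
  assumes "f \<in> faces"
  shows "pt f \<in> loop_region \<alpha>"
proof -
  have "pt f \<in> face_bottom_right f" by (cases f) (simp add: in_face)
  thus ?thesis using assms face_region_iff by blast
qed

text \<open>
  The inside lies between the union of the open and the union of the closed enclosed faces.
\<close>
lemma area_eq_card_faces:
  assumes "finite faces"
  shows "area \<alpha> = real (card faces)"
proof -
  have m1: "measure lborel (open_face f) = 1" and m2: "measure lborel (face_bottom_right f) = 1" for f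
    by (simp_all add: open_face_def face_bottom_right_def measure_lborel_box_eq measure_lborel_cbox_eq Basis_complex_def)
  have fin: "emeasure lborel (open_face f) \<noteq> \<infinity>" "emeasure lborel (face_bottom_right f) \<noteq> \<infinity>" for f
    using emeasure_bounded_finite[of "open_face f"] emeasure_bounded_finite[of "face_bottom_right f"]
    by (auto simp: open_face_def face_bottom_right_def)
  have sub1: "(\<Union>f\<in>faces. open_face f) \<subseteq> inside (loop_curve \<alpha>)" by (auto simp: faces_def)
  have sub2: "inside (loop_curve \<alpha>) \<subseteq> (\<Union>f\<in>faces. face_bottom_right f)"
    using every_point_in_face face_of_inner_point by blast
  have meas: "inside (loop_curve \<alpha>) \<in> sets lborel" using jordan(2) by simp
  have "real (card faces) = (\<Sum>f\<in>faces. measure lborel (open_face f))" by (simp add: m1)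
  also have "\<dots> = measure lborel (\<Union>f\<in>faces. open_face f)"
  proof (rule measure_finite_Union[symmetric, OF assms])
    show "disjoint_family_on open_face faces"
      using open_faces_disjoint unfolding disjoint_family_on_def by blast
  qed (use fin in \<open>auto simp: open_open_face\<close>)
  also have "\<dots> \<le> measure lborel (inside (loop_curve \<alpha>))"
  proof (rule measure_mono_fmeasurable[OF sub1])
    show "(\<Union>f\<in>faces. open_face f) \<in> sets lborel" by (auto simp: open_open_face)
    show "inside (loop_curve \<alpha>) \<in> fmeasurable lborel"
      using meas emeasure_bounded_finite[OF jordan(3)] by (intro fmeasurableI) auto
  qed
  finally have le: "real (card faces) \<le> area \<alpha>" by (simp add: area_def)
  have "area \<alpha> \<le> measure lborel (\<Union>f\<in>faces. face_bottom_right f)"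
    unfolding area_def
  proof (rule measure_mono_fmeasurable[OF sub2 meas])
    show "(\<Union>f\<in>faces. face_bottom_right f) \<in> fmeasurable lborel"
      using assms fin by (intro fmeasurable.finite_UN) (auto intro!: fmeasurableI simp: face_bottom_right_def top.not_eq_extremum)
  qed
  also have "\<dots> \<le> (\<Sum>f\<in>faces. measure lborel (face_bottom_right f))"
    by (rule measure_UNION_le[OF assms]) (simp add: face_bottom_right_def)
  also have "\<dots> = real (card faces)" by (simp add: m2)
  finally show ?thesis using le by simp
qed

end

text \<open>
  The outside of \<open>\<alpha>\<close> is connected and unbounded and avoids \<open>\<beta>\<close>, so it is outside \<open>\<beta>\<close>.
\<close>
lemma faces_of_enclosed_loop:
  assumes "lattice_loop \<alpha>" "lattice_loop \<beta>" "loop_edges \<beta> \<subseteq> region_edges (lattice_loop.faces \<alpha>)"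
  shows "lattice_loop.faces \<beta> \<subseteq> lattice_loop.faces \<alpha>"
proof -
  interpret A: lattice_loop \<alpha> by fact
  interpret B: lattice_loop \<beta> by fact
  have "loop_curve \<beta> \<subseteq> loop_region \<alpha>"
    using assms(3) unfolding A.region_edges_eq[symmetric] loop_curve_eq[of \<beta>] by blast
  hence "outside (loop_curve \<alpha>) \<inter> loop_curve \<beta> = {}"
    using A.jordan(7,8) unfolding loop_region_def by blast
  from B.connected_one_side[OF A.jordan(5) this]
  have "outside (loop_curve \<alpha>) \<subseteq> outside (loop_curve \<beta>)"
    using A.jordan(6) B.jordan(3) bounded_subset by blast
  thus ?thesis using A.not_face_iff B.not_face_iff by blast
qed

text \<open>
  A face inside \<open>\<beta>\<close> moves through an edge that is not in \<open>\<beta>\<close>, hence to a face inside \<open>\<beta>\<close>. Its trajectory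
  never leaves, although it would have to.
\<close>
lemma uncrossed_loop_free:
  assumes "lattice_loop \<alpha>" and \<psi>: "\<psi> \<in> exit_rules (lattice_loop.faces \<alpha>) 4 lattice_step"
  shows "\<nexists>\<beta>. length \<beta> > 2 \<and> distinct \<beta> \<and>
    loop_edges \<beta> \<subseteq> region_edges (lattice_loop.faces \<alpha>) - crossed (lattice_loop.faces \<alpha>) \<psi>"
proof
  assume "\<exists>\<beta>. length \<beta> > 2 \<and> distinct \<beta> \<and>
    loop_edges \<beta> \<subseteq> region_edges (lattice_loop.faces \<alpha>) - crossed (lattice_loop.faces \<alpha>) \<psi>"
  then obtain \<beta> where \<beta>: "length \<beta> > 2" "distinct \<beta>"
    "loop_edges \<beta> \<subseteq> region_edges (lattice_loop.faces \<alpha>) - crossed (lattice_loop.faces \<alpha>) \<psi>" by blast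
  interpret A: lattice_loop \<alpha> by fact
  have "loop_edges \<beta> \<subseteq> edges square_lattice" using \<beta>(3) unfolding A.region_edges_eq[symmetric] by blast
  then interpret B: lattice_loop \<beta> using \<beta>(1,2) by unfold_locales
  have sub: "B.faces \<subseteq> A.faces"
    using \<beta>(3) by (intro faces_of_enclosed_loop A.lattice_loop_axioms B.lattice_loop_axioms) blast
  have step: "rule_step \<psi> f \<in> B.faces" if f: "f \<in> B.faces" for f
  proof -
    have "f \<in> A.faces" using f sub by blast
    hence "\<psi> f < 4" "face_side f (\<psi> f) \<in> crossed A.faces \<psi>"
      using exit_rulesD(1)[OF \<psi>] unfolding crossed_def by blast+
    hence "face_side f (\<psi> f) \<notin> loop_edges \<beta>" using \<beta>(3) by blast
    thus ?thesis using B.side_not_in_loop(1)[OF \<open>\<psi> f < 4\<close>, of f] f by simp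
  qed
  obtain f where f: "f \<in> B.faces" using B.faces_nonempty by blast
  have "(rule_step \<psi> ^^ k) f \<in> B.faces" for k
    by (induction k) (use f step in simp_all)
  hence "(rule_step \<psi> ^^ k) f \<in> A.faces" for k using sub by blast
  thus False using exit_rulesD(2)[OF \<psi>, of f] f sub unfolding leaves_def by blast
qed

section \<open>Spanning trees of simple grid graphs\<close>

locale simple_grid =
  fixes G :: "(int \<times> int) ugraph" and \<alpha> :: "(int \<times> int) list"
  assumes simple_grid: "simple_grid_graph G \<alpha>"

sublocale simple_grid \<subseteq> lattice_loop \<alpha>
proof
  have "simple_closed_loop square_lattice \<alpha>" using simple_grid by (simp add: simple_grid_graph_def)
  thus "length \<alpha> > 2" "distinct \<alpha>" "loop_edges \<alpha> \<subseteq> edges square_lattice"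
    unfolding simple_closed_loop_iff by simp_all
qed

context simple_grid
begin

lemma verts_eq: "verts G = {v. pt v \<in> loop_region \<alpha>}"
  using simple_grid by (simp add: simple_grid_graph_def square_lattice_def)

lemma edges_eq: "edges G = region_edges faces"
proof -
  have "edges G = {e \<in> edges square_lattice. edge_seg e \<subseteq> loop_region \<alpha>}"
  proof (rule subset_antisym; rule subsetI)
    fix e assume "e \<in> edges G"
    then obtain u v where "e = {u, v}" "{u, v} \<in> edges square_lattice" "closed_segment (pt u) (pt v) \<subseteq> loop_region \<alpha>"
      using simple_grid unfolding simple_grid_graph_def by blast
    thus "e \<in> {e \<in> edges square_lattice. edge_seg e \<subseteq> loop_region \<alpha>}" by (simp add: edge_seg_doubleton)
  next
    fix e assume e: "e \<in> {e \<in> edges square_lattice. edge_seg e \<subseteq> loop_region \<alpha>}"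
    then obtain u v where uv: "e = {u, v}" unfolding square_lattice_def by auto
    have "\<exists>u v. e = {u, v} \<and> {u, v} \<in> edges square_lattice \<and> closed_segment (pt u) (pt v) \<subseteq> loop_region \<alpha>"
      using e uv by (intro exI[of _ u] exI[of _ v]) (simp add: edge_seg_doubleton)
    thus "e \<in> edges G" using simple_grid unfolding simple_grid_graph_def by simp
  qed
  thus ?thesis by (simp only: region_edges_eq)
qed

lemma finite_verts: "finite (verts G)"
  using simple_grid unfolding simple_grid_graph_def grid_graph_def by blast

lemma connected: "u \<in> verts G \<Longrightarrow> v \<in> verts G \<Longrightarrow> (u, v) \<in> {(x, y). {x, y} \<in> region_edges faces}\<^sup>*"
  using simple_grid unfolding edges_eq[symmetric] simple_grid_graph_def grid_graph_def graph_connected_def by blast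

lemma verts_nonempty: "verts G \<noteq> {}"
  using simple_grid unfolding simple_grid_graph_def grid_graph_def graph_connected_def by blast

lemma faces_subset_verts: "faces \<subseteq> verts G"
  unfolding verts_eq using face_corner_in_region by blast

lemma finite_faces: "finite faces"
  using faces_subset_verts finite_verts by (rule finite_subset)

lemma edge_in_graph:
  assumes "e \<in> region_edges faces"
  shows "e \<subseteq> verts G \<and> card e = 2"
proof
  have e: "edge_seg e \<subseteq> loop_region \<alpha>" using assms unfolding region_edges_eq[symmetric] by simp
  show "e \<subseteq> verts G"
  proof
    fix v assume "v \<in> e"
    hence "pt v \<in> loop_region \<alpha>" using edge_seg_endpoints e by blast
    thus "v \<in> verts G" by (simp add: verts_eq)
  qed
  show "card e = 2" using assms card_face_side unfolding region_edges_def by auto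
qed

lemma finite_region_edges: "finite (region_edges faces)"
proof (rule finite_subset)
  show "region_edges faces \<subseteq> (\<lambda>(f, k). face_side f k) ` (faces \<times> {..<4})"
    by (auto simp: region_edges_def image_iff Bex_def)
  show "finite ((\<lambda>(f, k). face_side f k) ` (faces \<times> {..<4::nat}))"
    using finite_faces by (intro finite_imageI finite_SigmaI) simp_all
qed

text \<open>
  The enclosed faces, named by their bottom-right corners, are the vertices that are not
  in the top-left boundary.
\<close>
lemma card_verts_top_left: "card (verts G) = card faces + card (top_left_boundary \<alpha>)"
proof -
  have "verts G - faces = top_left_boundary \<alpha>"
  proof (rule subset_antisym; rule subsetI)
    fix v assume "v \<in> verts G - faces"
    hence "pt v \<in> loop_region \<alpha>" "v \<notin> faces" by (simp_all add: verts_eq)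
    thus "v \<in> top_left_boundary \<alpha>"
      using inner_vertex_is_face[of v] face_region_iff[of v] by (auto simp: top_left_boundary_def boundary_def)
  next
    fix v assume "v \<in> top_left_boundary \<alpha>"
    hence v: "v \<in> set \<alpha>" "v \<notin> faces" using face_region_iff[of v] by (simp_all add: top_left_boundary_def boundary_def)
    hence "pt v \<in> loop_region \<alpha>" using vertex_on_curve[of v] unfolding loop_region_def by simp
    thus "v \<in> verts G - faces" using v(2) by (simp add: verts_eq)
  qed
  moreover have "card (verts G - faces) = card (verts G) - card faces"
    using finite_faces faces_subset_verts by (rule card_Diff_subset)
  moreover have "card faces \<le> card (verts G)" using finite_verts faces_subset_verts by (rule card_mono)
  ultimately show ?thesis by simp
qed

text \<open>
  The tree dual to an exit rule.
\<close>
definition tree_of :: "(int \<times> int \<Rightarrow> nat) \<Rightarrow> (int \<times> int) ugraph" where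
  "tree_of \<psi> = \<lparr>verts = verts G, edges = region_edges faces - crossed faces \<psi>\<rparr>"

text \<open>
  The definition in terms of edge sets.
\<close>
lemma spanning_trees_iff:
  "T \<in> spanning_trees G \<longleftrightarrow> verts T = verts G \<and> edges T \<subseteq> region_edges faces \<and>
     (\<forall>u\<in>verts G. \<forall>v\<in>verts G. (u, v) \<in> {(x, y). {x, y} \<in> edges T}\<^sup>*) \<and>
     (\<nexists>\<beta>. length \<beta> > 2 \<and> distinct \<beta> \<and> loop_edges \<beta> \<subseteq> edges T)"
proof -
  have "ugraph T" if "verts T = verts G" "edges T \<subseteq> region_edges faces"
    unfolding ugraph_def using that edge_in_graph by auto
  thus ?thesis
    unfolding spanning_trees_def subgraph_def graph_tree_def graph_connected_def simple_closed_loop_iff edges_eq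
    using verts_nonempty by auto
qed

lemma tree_of_spanning:
  assumes "\<psi> \<in> exit_rules faces 4 lattice_step"
  shows "tree_of \<psi> \<in> spanning_trees G"
proof -
  have "(u, v) \<in> {(x, y). {x, y} \<in> region_edges faces - crossed faces \<psi>}\<^sup>*" if "u \<in> verts G" "v \<in> verts G" for u v
    by (rule uncrossed_connected[OF finite_faces assms connected that])
  moreover have "\<nexists>\<beta>. length \<beta> > 2 \<and> distinct \<beta> \<and> loop_edges \<beta> \<subseteq> region_edges faces - crossed faces \<psi>"
    by (rule uncrossed_loop_free[OF lattice_loop_axioms assms])
  ultimately show ?thesis unfolding spanning_trees_iff tree_of_def by simp
qed

lemma tree_of_surj:
  assumes T: "T \<in> spanning_trees G"
  shows "\<exists>\<psi>\<in>exit_rules faces 4 lattice_step. T = tree_of \<psi>"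
proof -
  note T' = T[unfolded spanning_trees_iff]
  obtain \<psi> where \<psi>: "\<psi> \<in> exit_rules faces 4 lattice_step" "crossed faces \<psi> \<inter> edges T = {}"
    using exit_rule_avoiding_tree[OF finite_faces] T' by blast
  have sub: "edges T \<subseteq> region_edges faces - crossed faces \<psi>" using \<psi>(2) T' by blast
  have "edges T = region_edges faces - crossed faces \<psi>"
  proof (rule connected_subset_loop_free_eq[where V = "verts G"])
    show "\<nexists>\<beta>. length \<beta> > 2 \<and> distinct \<beta> \<and> loop_edges \<beta> \<subseteq> region_edges faces - crossed faces \<psi>"
      by (rule uncrossed_loop_free[OF lattice_loop_axioms \<psi>(1)])
    show "e \<subseteq> verts G \<and> card e = 2" if "e \<in> region_edges faces - crossed faces \<psi>" for e
      using that by (intro edge_in_graph) simp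
    show "(u, v) \<in> {(x, y). {x, y} \<in> edges T}\<^sup>*" if "u \<in> verts G" "v \<in> verts G" for u v
      using T' that by simp
  qed (rule sub)
  hence "T = tree_of \<psi>" using T' by (cases T) (simp add: tree_of_def)
  thus ?thesis using \<psi>(1) by (rule bexI)
qed

lemma \<tau>_eq_card_exit_rules: "\<tau> G = card (exit_rules faces 4 lattice_step)"
proof -
  have "inj_on tree_of (exit_rules faces 4 lattice_step)"
  proof (rule inj_onI)
    fix \<psi> \<phi> assume a: "\<psi> \<in> exit_rules faces 4 lattice_step" "\<phi> \<in> exit_rules faces 4 lattice_step" "tree_of \<psi> = tree_of \<phi>"
    have "region_edges faces - crossed faces \<psi> = region_edges faces - crossed faces \<phi>"
      using a(3) by (simp add: tree_of_def)
    hence "crossed faces \<psi> = crossed faces \<phi>"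
      using crossed_subset[OF a(1)] crossed_subset[OF a(2)] by (metis double_diff order_refl)
    thus "\<psi> = \<phi>" by (rule crossed_inj[OF a(1,2)])
  qed
  moreover have "tree_of ` exit_rules faces 4 lattice_step = spanning_trees G"
    using tree_of_spanning tree_of_surj by (intro subset_antisym subsetI) (auto simp: image_iff)
  ultimately show ?thesis unfolding \<tau>_def by (metis card_image)
qed

text \<open>
  Euler's formula, read off from a single dual pair: the tree has \<open>card (verts G) - 1\<close> edges and its
  complement one for each face.
\<close>
lemma euler: "card (region_edges faces) + 1 = card (verts G) + card faces"
proof -
  obtain \<psi> where \<psi>: "\<psi> \<in> exit_rules faces 4 lattice_step" using exit_rules_nonempty[OF finite_faces] by blast
  obtain r where r: "r \<in> verts G" using verts_nonempty by blast
  note T = tree_of_spanning[OF \<psi>, unfolded spanning_trees_iff]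
  have "card (region_edges faces - crossed faces \<psi>) + 1 = card (verts G)"
  proof (rule tree_card_edges[OF finite_verts r])
    show "\<nexists>\<beta>. length \<beta> > 2 \<and> distinct \<beta> \<and> loop_edges \<beta> \<subseteq> region_edges faces - crossed faces \<psi>"
      by (rule uncrossed_loop_free[OF lattice_loop_axioms \<psi>])
    show "e \<subseteq> verts G \<and> card e = 2" if "e \<in> region_edges faces - crossed faces \<psi>" for e
      using that by (intro edge_in_graph) simp
    show "(u, v) \<in> {(x, y). {x, y} \<in> region_edges faces - crossed faces \<psi>}\<^sup>*" if "u \<in> verts G" "v \<in> verts G" for u v
      by (rule uncrossed_connected[OF finite_faces \<psi> connected that])
  qed
  moreover have "card (region_edges faces - crossed faces \<psi>) = card (region_edges faces) - card faces"
    using card_Diff_subset[OF _ crossed_subset[OF \<psi>]] finite_faces card_crossed[OF \<psi>]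
    by (simp add: crossed_def)
  moreover have "card faces \<le> card (region_edges faces)"
    using card_mono[OF finite_region_edges crossed_subset[OF \<psi>]] card_crossed[OF \<psi>] by simp
  ultimately show ?thesis by linarith
qed

text \<open>
  Each of the \<open>4 m\<close> sides of enclosed faces is an edge of the graph. Edges of the loop occur
  once and all others twice.
\<close>
lemma double_count: "4 * card faces + length \<alpha> = 2 * card (region_edges faces)"
proof -
  define P where "P = faces \<times> {..<4::nat}"
  define s where "s = (\<lambda>(f, k). face_side f k)"
  have finP: "finite P" using finite_faces by (simp add: P_def)
  have mult: "card {p \<in> P. s p = e} = (if e \<in> loop_edges \<alpha> then 1 else 2)" if e: "e \<in> region_edges faces" for e
  proof -
    obtain f k where fk: "f \<in> faces" "k < 4" "e = face_side f k" using e unfolding region_edges_def by blast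
    let ?g = "(lattice_step f k, opposite k)"
    have eq: "s p = e \<longleftrightarrow> p = (f, k) \<or> p = ?g" if "p \<in> P" for p
    proof -
      obtain g l where gl: "p = (g, l)" by fastforce
      hence "l < 4" using that by (simp add: P_def)
      from face_side_eq_iff[OF fk(2) this, of f g] show ?thesis unfolding gl s_def fk(3) by auto
    qed
    show ?thesis
    proof (cases "e \<in> loop_edges \<alpha>")
      case True
      hence "lattice_step f k \<notin> faces" using side_in_loop[OF fk(2), of f] fk(1,3) by simp
      hence "?g \<notin> P" by (simp add: P_def)
      moreover have "(f, k) \<in> P" using fk by (simp add: P_def)
      ultimately have "{p \<in> P. s p = e} = {(f, k)}" using eq by blast
      thus ?thesis using True by simp
    next
      case False
      hence "lattice_step f k \<in> faces" using side_not_in_loop(1)[OF fk(2), of f] fk(1,3) by simp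
      hence "?g \<in> P" using opposite_less by (simp add: P_def)
      moreover have "(f, k) \<in> P" using fk by (simp add: P_def)
      ultimately have "{p \<in> P. s p = e} = {(f, k), ?g}" using eq by blast
      moreover have "(f, k) \<noteq> ?g" using lattice_step_neq[of f k] by auto
      ultimately show ?thesis using False by simp
    qed
  qed
  have img: "s ` P \<subseteq> region_edges faces" by (auto simp: s_def P_def region_edges_def)
  have "4 * card faces = card P" by (simp add: P_def card_cartesian_product)
  also have "\<dots> = (\<Sum>e\<in>region_edges faces. card {p \<in> P. s p = e})"
    using sum.group[OF finP finite_region_edges img, of "\<lambda>_. 1::nat"] by simp
  also have "\<dots> = (\<Sum>e\<in>region_edges faces. if e \<in> loop_edges \<alpha> then 1 else 2)"
    by (rule sum.cong[OF refl]) (rule mult)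
  finally have "4 * card faces + card (loop_edges \<alpha>)
      = (\<Sum>e\<in>region_edges faces. if e \<in> loop_edges \<alpha> then 1 else 2) + (\<Sum>e\<in>region_edges faces. if e \<in> loop_edges \<alpha> then 1 else 0)"
    using finite_region_edges loop_edges_subset_region by (simp add: sum.inter_restrict[symmetric] Int_absorb1 Int_absorb2)
  also have "\<dots> = (\<Sum>e\<in>region_edges faces. 2)"
    unfolding sum.distrib[symmetric] by (rule sum.cong) auto
  finally show ?thesis using card_loop_edges[OF length_gt_2 distinct] by simp
qed

lemma pick: "2 * card faces + card (boundary \<alpha>) + 2 = 2 * card (verts G)"
  using euler double_count distinct_card[OF distinct] by (simp add: boundary_def)

end

theorem theorem1p4:
  fixes G :: "(int \<times> int) ugraph" and \<alpha> :: "(int \<times> int) list"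
  assumes "simple_grid_graph G \<alpha>"
  shows "area \<alpha> = real (card (verts G)) - real (card (boundary \<alpha>)) / 2 - 1 \<and>
         area \<alpha> = real (card (verts G)) - real (card (top_left_boundary \<alpha>)) \<and>
         \<bb> powr area \<alpha> \<le> real (\<tau> G) \<and>
         real (\<tau> G) \<le> 4 powr area \<alpha>"
proof (intro conjI)
  interpret simple_grid G \<alpha> using assms by unfold_locales
  have area: "area \<alpha> = real (card faces)" by (rule area_eq_card_faces[OF finite_faces])
  have "real (2 * card faces + card (boundary \<alpha>) + 2) = real (2 * card (verts G))" by (simp only: pick)
  thus "area \<alpha> = real (card (verts G)) - real (card (boundary \<alpha>)) / 2 - 1" unfolding area by simp
  show "area \<alpha> = real (card (verts G)) - real (card (top_left_boundary \<alpha>))"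
    unfolding area card_verts_top_left by simp
  show "\<bb> powr area \<alpha> \<le> real (\<tau> G)"
    unfolding area \<tau>_eq_card_exit_rules by (rule card_exit_rules_ge[OF finite_faces])
  have "\<tau> G \<le> card (faces \<rightarrow>\<^sub>E {..<4::nat})"
    unfolding \<tau>_eq_card_exit_rules using finite_faces
    by (intro card_mono finite_PiE) (auto simp: exit_rules_def)
  also have "\<dots> = 4 ^ card faces" using finite_faces by (simp add: card_PiE)
  finally have "real (\<tau> G) \<le> real (4 ^ card faces)" by (simp only: of_nat_le_iff)
  thus "real (\<tau> G) \<le> 4 powr area \<alpha>" unfolding area by (simp add: powr_realpow)
qed

end
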